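(* Let $\mathcal{C}$ be an abelian category and let $n\geq 1$ be an integer. Then the following conditions are equivalent: (1) the functor $\mathrm{Ext}^n_{\mathcal{C}}(M,-)$ is right exact for each object $M$ of $\mathcal{C}$; (2) $\mathrm{Ext}^{n+1}_{\mathcal{C}}(M,A)=0$ for each pair of objects $A,M$ of $\mathcal{C}$.
   Context: No existence of enough projectives or injectives is assumed. $\mathrm{Ext}^n$ denotes Yoneda Ext: for $n\ge1$, $\mathrm{Ext}^n_{\mathcal{C}}(X,Z)$ is the abelian group (under Baer sum) of equivalence classes of exact sequences $0\to Z\to B_1\to\cdots\to B_n\to X\to 0$ in $\mathcal{C}$, where equivalence is generated by morphisms of such sequences that are the identity on $Z$ and $X$. The functor $\mathrm{Ext}^n_{\mathcal{C}}(M,-)$ is right exact if for every short exact sequence $0\to A\to B\to D\to 0$ in $\mathcal{C}$ the induced sequence $\mathrm{Ext}^n_{\mathcal{C}}(M,A)\to\mathrm{Ext}^n_{\mathcal{C}}(M,B)\to\mathrm{Ext}^n_{\mathcal{C}}(M,D)\to 0$ is exact. *)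

theory Defs
  imports "HOL-Algebra.Coset"
begin

section \<open>Abelian categories\<close>

text \<open>
  Composition is total as a function but only meaningful on composable arrows:
  \<open>g \<cdot> f\<close> is ``first \<open>f\<close>, then \<open>g\<close>''.
\<close>

record ('o, 'a) category_data =
  Ob :: "'o set"
  Arr :: "'a set"
  Dom :: "'a \<Rightarrow> 'o"
  Cod :: "'a \<Rightarrow> 'o"
  Id :: "'o \<Rightarrow> 'a"
  Comp :: "'a \<Rightarrow> 'a \<Rightarrow> 'a"  (infixr "\<cdot>\<index>" 75)
  Add :: "'a \<Rightarrow> 'a \<Rightarrow> 'a"
  Zero :: "'o \<Rightarrow> 'o \<Rightarrow> 'a"

definition Hom :: "('o, 'a) category_data \<Rightarrow> 'o \<Rightarrow> 'o \<Rightarrow> 'a set" where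
  "Hom C X Y = {f \<in> Arr C. Dom C f = X \<and> Cod C f = Y}"

definition hom_group :: "('o, 'a) category_data \<Rightarrow> 'o \<Rightarrow> 'o \<Rightarrow> 'a monoid" where
  "hom_group C X Y = \<lparr>carrier = Hom C X Y, mult = Add C, one = Zero C X Y\<rparr>"

locale category =
  fixes C :: "('o, 'a) category_data" (structure)
  assumes Dom_Ob: "f \<in> Arr C \<Longrightarrow> Dom C f \<in> Ob C"
    and Cod_Ob: "f \<in> Arr C \<Longrightarrow> Cod C f \<in> Ob C"
    and Id_Hom: "X \<in> Ob C \<Longrightarrow> Id C X \<in> Hom C X X"
    and Comp_Hom: "\<lbrakk>f \<in> Hom C X Y; g \<in> Hom C Y Z\<rbrakk> \<Longrightarrow> g \<cdot> f \<in> Hom C X Z"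
    and Comp_assoc: "\<lbrakk>f \<in> Hom C W X; g \<in> Hom C X Y; h \<in> Hom C Y Z\<rbrakk>
      \<Longrightarrow> (h \<cdot> g) \<cdot> f = h \<cdot> (g \<cdot> f)"
    and Comp_Id: "f \<in> Hom C X Y \<Longrightarrow> f \<cdot> Id C X = f"
    and Id_Comp: "f \<in> Hom C X Y \<Longrightarrow> Id C Y \<cdot> f = f"

locale preadditive_category = category +
  assumes comm_group_Hom: "\<lbrakk>X \<in> Ob C; Y \<in> Ob C\<rbrakk> \<Longrightarrow> comm_group (hom_group C X Y)"
    and Comp_Add: "\<lbrakk>f \<in> Hom C X Y; f' \<in> Hom C X Y; g \<in> Hom C Y Z\<rbrakk>
      \<Longrightarrow> g \<cdot> Add C f f' = Add C (g \<cdot> f) (g \<cdot> f')"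
    and Add_Comp: "\<lbrakk>f \<in> Hom C X Y; g \<in> Hom C Y Z; g' \<in> Hom C Y Z\<rbrakk>
      \<Longrightarrow> Add C g g' \<cdot> f = Add C (g \<cdot> f) (g' \<cdot> f)"

definition is_zero_object :: "('o, 'a) category_data \<Rightarrow> 'o \<Rightarrow> bool" where
  "is_zero_object C Z \<longleftrightarrow> Z \<in> Ob C \<and>
     (\<forall>X\<in>Ob C. (\<exists>!f. f \<in> Hom C X Z) \<and> (\<exists>!f. f \<in> Hom C Z X))"

text \<open>\<open>P\<close> is a biproduct of \<open>A\<close> and \<open>B\<close> with injections \<open>i, j\<close> and projections \<open>p, q\<close>.\<close>

definition is_biproduct ::
    "('o, 'a) category_data \<Rightarrow> 'o \<Rightarrow> 'o \<Rightarrow> 'o \<Rightarrow> 'a \<Rightarrow> 'a \<Rightarrow> 'a \<Rightarrow> 'a \<Rightarrow> bool" where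
  "is_biproduct C A B P i j p q \<longleftrightarrow>
     i \<in> Hom C A P \<and> j \<in> Hom C B P \<and> p \<in> Hom C P A \<and> q \<in> Hom C P B \<and>
     p \<cdot>\<^bsub>C\<^esub> i = Id C A \<and> q \<cdot>\<^bsub>C\<^esub> j = Id C B \<and> p \<cdot>\<^bsub>C\<^esub> j = Zero C B A \<and> q \<cdot>\<^bsub>C\<^esub> i = Zero C A B \<and>
     Add C (i \<cdot>\<^bsub>C\<^esub> p) (j \<cdot>\<^bsub>C\<^esub> q) = Id C P"

definition is_mono :: "('o, 'a) category_data \<Rightarrow> 'a \<Rightarrow> bool" where
  "is_mono C f \<longleftrightarrow> f \<in> Arr C \<and>
     (\<forall>X. \<forall>g\<in>Hom C X (Dom C f). \<forall>h\<in>Hom C X (Dom C f). f \<cdot>\<^bsub>C\<^esub> g = f \<cdot>\<^bsub>C\<^esub> h \<longrightarrow> g = h)"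

definition is_epi :: "('o, 'a) category_data \<Rightarrow> 'a \<Rightarrow> bool" where
  "is_epi C f \<longleftrightarrow> f \<in> Arr C \<and>
     (\<forall>X. \<forall>g\<in>Hom C (Cod C f) X. \<forall>h\<in>Hom C (Cod C f) X. g \<cdot>\<^bsub>C\<^esub> f = h \<cdot>\<^bsub>C\<^esub> f \<longrightarrow> g = h)"

definition is_kernel :: "('o, 'a) category_data \<Rightarrow> 'a \<Rightarrow> 'a \<Rightarrow> bool" where
  "is_kernel C f k \<longleftrightarrow> f \<in> Arr C \<and> k \<in> Arr C \<and> Cod C k = Dom C f \<and>
     f \<cdot>\<^bsub>C\<^esub> k = Zero C (Dom C k) (Cod C f) \<and>
     (\<forall>X. \<forall>h\<in>Hom C X (Dom C f). f \<cdot>\<^bsub>C\<^esub> h = Zero C X (Cod C f) \<longrightarrow>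
        (\<exists>!u. u \<in> Hom C X (Dom C k) \<and> k \<cdot>\<^bsub>C\<^esub> u = h))"

definition is_cokernel :: "('o, 'a) category_data \<Rightarrow> 'a \<Rightarrow> 'a \<Rightarrow> bool" where
  "is_cokernel C f c \<longleftrightarrow> f \<in> Arr C \<and> c \<in> Arr C \<and> Dom C c = Cod C f \<and>
     c \<cdot>\<^bsub>C\<^esub> f = Zero C (Dom C f) (Cod C c) \<and>
     (\<forall>X. \<forall>h\<in>Hom C (Cod C f) X. h \<cdot>\<^bsub>C\<^esub> f = Zero C (Dom C f) X \<longrightarrow>
        (\<exists>!u. u \<in> Hom C (Cod C c) X \<and> u \<cdot>\<^bsub>C\<^esub> c = h))"

locale abelian_category = preadditive_category +
  assumes ex_zero_object: "\<exists>Z. is_zero_object C Z"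
    and ex_biproduct: "\<lbrakk>A \<in> Ob C; B \<in> Ob C\<rbrakk> \<Longrightarrow> \<exists>P i j p q. is_biproduct C A B P i j p q"
    and ex_kernel: "f \<in> Arr C \<Longrightarrow> \<exists>k. is_kernel C f k"
    and ex_cokernel: "f \<in> Arr C \<Longrightarrow> \<exists>c. is_cokernel C f c"
    and mono_is_kernel: "is_mono C f \<Longrightarrow> \<exists>g. is_kernel C g f"
    and epi_is_cokernel: "is_epi C f \<Longrightarrow> \<exists>g. is_cokernel C g f"


section \<open>Exact sequences\<close>

definition is_image :: "('o, 'a) category_data \<Rightarrow> 'a \<Rightarrow> 'a \<Rightarrow> bool" where
  "is_image C f m \<longleftrightarrow> (\<exists>c. is_cokernel C f c \<and> is_kernel C c m)"

text \<open>
  \<open>X \<rightarrow> Y \<rightarrow> Z\<close> is exact at \<open>Y\<close> if the image of the first arrow and the kernel of the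
  second are the same subobject of \<open>Y\<close>, i.e. have a common representative.
\<close>

definition exact_at :: "('o, 'a) category_data \<Rightarrow> 'a \<Rightarrow> 'a \<Rightarrow> bool" where
  "exact_at C f g \<longleftrightarrow> (\<exists>m. is_image C f m \<and> is_kernel C g m)"

text \<open>
  An exact sequence \<open>0 \<rightarrow> A \<rightarrow> B\<^sub>1 \<rightarrow> \<dots> \<rightarrow> B\<^sub>n \<rightarrow> M \<rightarrow> 0\<close> is represented by the list of its
  \<open>n + 1\<close> arrows between \<open>A\<close> and \<open>M\<close>; the objects are the domains and codomains.
\<close>

definition extensions :: "('o, 'a) category_data \<Rightarrow> nat \<Rightarrow> 'o \<Rightarrow> 'o \<Rightarrow> 'a list set" where
  "extensions C n M A = {E. length E = n + 1 \<and> Dom C (hd E) = A \<and> Cod C (last E) = M \<and>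
     (\<exists>Z. is_zero_object C Z \<and> successively (exact_at C) (Zero C Z A # E @ [Zero C M Z]))}"

definition short_exact ::
    "('o, 'a) category_data \<Rightarrow> 'o \<Rightarrow> 'o \<Rightarrow> 'o \<Rightarrow> 'a \<Rightarrow> 'a \<Rightarrow> bool" where
  "short_exact C A B D f g \<longleftrightarrow>
     f \<in> Hom C A B \<and> g \<in> Hom C B D \<and> [f, g] \<in> extensions C 1 D A"


section \<open>Yoneda Ext\<close>

definition ext_morphism ::
    "('o, 'a) category_data \<Rightarrow> nat \<Rightarrow> 'o \<Rightarrow> 'o \<Rightarrow> 'a list \<Rightarrow> 'a list \<Rightarrow> bool" where
  "ext_morphism C n M A E E' \<longleftrightarrow> E \<in> extensions C n M A \<and> E' \<in> extensions C n M A \<and>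
     (\<exists>\<phi> :: nat \<Rightarrow> 'a. \<phi> 0 = Id C A \<and> \<phi> (n + 1) = Id C M \<and>
        (\<forall>k \<le> n. \<phi> k \<in> Hom C (Dom C (E ! k)) (Dom C (E' ! k)) \<and>
                 \<phi> (k + 1) \<in> Hom C (Cod C (E ! k)) (Cod C (E' ! k)) \<and>
                 \<phi> (k + 1) \<cdot>\<^bsub>C\<^esub> E ! k = E' ! k \<cdot>\<^bsub>C\<^esub> \<phi> k))"

definition ext_rel :: "('o, 'a) category_data \<Rightarrow> nat \<Rightarrow> 'o \<Rightarrow> 'o \<Rightarrow> ('a list \<times> 'a list) set" where
  "ext_rel C n M A = {(E, E'). E \<in> extensions C n M A \<and> E' \<in> extensions C n M A \<and>
     equivclp (ext_morphism C n M A) E E'}"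

definition is_pushout ::
    "('o, 'a) category_data \<Rightarrow> 'a \<Rightarrow> 'a \<Rightarrow> 'a \<Rightarrow> 'a \<Rightarrow> bool" where
  "is_pushout C f d e u \<longleftrightarrow> f \<in> Arr C \<and> d \<in> Arr C \<and> e \<in> Arr C \<and> u \<in> Arr C \<and>
     Dom C f = Dom C d \<and> Dom C e = Cod C f \<and> Dom C u = Cod C d \<and> Cod C e = Cod C u \<and>
     e \<cdot>\<^bsub>C\<^esub> f = u \<cdot>\<^bsub>C\<^esub> d \<and>
     (\<forall>X. \<forall>x\<in>Hom C (Cod C f) X. \<forall>y\<in>Hom C (Cod C d) X. x \<cdot>\<^bsub>C\<^esub> f = y \<cdot>\<^bsub>C\<^esub> d \<longrightarrow>
        (\<exists>!w. w \<in> Hom C (Cod C e) X \<and> w \<cdot>\<^bsub>C\<^esub> e = x \<and> w \<cdot>\<^bsub>C\<^esub> u = y))"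

definition is_pullback ::
    "('o, 'a) category_data \<Rightarrow> 'a \<Rightarrow> 'a \<Rightarrow> 'a \<Rightarrow> 'a \<Rightarrow> bool" where
  "is_pullback C g d e v \<longleftrightarrow> g \<in> Arr C \<and> d \<in> Arr C \<and> e \<in> Arr C \<and> v \<in> Arr C \<and>
     Cod C g = Cod C d \<and> Cod C e = Dom C g \<and> Cod C v = Dom C d \<and> Dom C e = Dom C v \<and>
     g \<cdot>\<^bsub>C\<^esub> e = d \<cdot>\<^bsub>C\<^esub> v \<and>
     (\<forall>X. \<forall>x\<in>Hom C X (Dom C g). \<forall>y\<in>Hom C X (Dom C d). g \<cdot>\<^bsub>C\<^esub> x = d \<cdot>\<^bsub>C\<^esub> y \<longrightarrow>
        (\<exists>!w. w \<in> Hom C X (Dom C e) \<and> e \<cdot>\<^bsub>C\<^esub> w = x \<and> v \<cdot>\<^bsub>C\<^esub> w = y))"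

text \<open>
  \<open>E'\<close> arises from \<open>E : 0 \<rightarrow> A \<rightarrow> B\<^sub>1 \<rightarrow> B\<^sub>2 \<rightarrow> \<dots>\<close> by replacing \<open>B\<^sub>1\<close> with the pushout of
  \<open>A \<rightarrow> B\<^sub>1\<close> along \<open>f : A \<rightarrow> A'\<close>; the next arrow is the one induced by \<open>B\<^sub>1 \<rightarrow> B\<^sub>2\<close> and
  \<open>0 : A' \<rightarrow> B\<^sub>2\<close> (where \<open>B\<^sub>2\<close> stands for \<open>M\<close> if \<open>n = 1\<close>). Dually for pullbacks along
  \<open>g : M' \<rightarrow> M\<close>.
\<close>

definition pushforward :: "('o, 'a) category_data \<Rightarrow> 'a \<Rightarrow> 'a list \<Rightarrow> 'a list \<Rightarrow> bool" where
  "pushforward C f E E' \<longleftrightarrow> (\<exists>d d1 ds e e1 u. E = d # d1 # ds \<and> E' = e # e1 # ds \<and>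
     is_pushout C f d e u \<and> e1 \<in> Hom C (Cod C e) (Cod C d1) \<and>
     e1 \<cdot>\<^bsub>C\<^esub> u = d1 \<and> e1 \<cdot>\<^bsub>C\<^esub> e = Zero C (Dom C e) (Cod C d1))"

definition pullback :: "('o, 'a) category_data \<Rightarrow> 'a \<Rightarrow> 'a list \<Rightarrow> 'a list \<Rightarrow> bool" where
  "pullback C g E E' \<longleftrightarrow> (\<exists>d d1 ds e e1 v. E = ds @ [d1, d] \<and> E' = ds @ [e1, e] \<and>
     is_pullback C g d e v \<and> e1 \<in> Hom C (Dom C d1) (Dom C e) \<and>
     v \<cdot>\<^bsub>C\<^esub> e1 = d1 \<and> e \<cdot>\<^bsub>C\<^esub> e1 = Zero C (Dom C d1) (Cod C e))"

definition seq_object :: "('o, 'a) category_data \<Rightarrow> 'a list \<Rightarrow> nat \<Rightarrow> 'o" where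
  "seq_object C E k = (if k = 0 then Dom C (hd E) else Cod C (E ! (k - 1)))"

text \<open>
  The Baer sum \<open>\<nabla> (E\<^sub>1 \<oplus> E\<^sub>2) \<Delta>\<close>. The families \<open>i, j, p, q\<close> present the objects of
  \<open>E = E\<^sub>1 \<oplus> E\<^sub>2\<close> as biproducts, so that the codiagonal of \<open>A \<oplus> A\<close> is \<open>p 0 + q 0\<close> and the
  diagonal of \<open>M \<oplus> M\<close> is \<open>i (n + 1) + j (n + 1)\<close>.
\<close>

definition baer_sum ::
    "('o, 'a) category_data \<Rightarrow> nat \<Rightarrow> 'a list \<Rightarrow> 'a list \<Rightarrow> 'a list \<Rightarrow> bool" where
  "baer_sum C n E1 E2 S \<longleftrightarrow> (\<exists>(P :: nat \<Rightarrow> 'o) (i :: nat \<Rightarrow> 'a) j p q E E'.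
     (\<forall>k \<le> n + 1. is_biproduct C (seq_object C E1 k) (seq_object C E2 k) (P k)
        (i k) (j k) (p k) (q k)) \<and>
     length E = n + 1 \<and>
     (\<forall>k \<le> n. E ! k = Add C (i (k + 1) \<cdot>\<^bsub>C\<^esub> E1 ! k \<cdot>\<^bsub>C\<^esub> p k) (j (k + 1) \<cdot>\<^bsub>C\<^esub> E2 ! k \<cdot>\<^bsub>C\<^esub> q k)) \<and>
     pushforward C (Add C (p 0) (q 0)) E E' \<and>
     pullback C (Add C (i (n + 1)) (j (n + 1))) E' S)"

text \<open>
  Representatives of the neutral element: \<open>0 \<rightarrow> A \<rightarrow> A \<oplus> M \<rightarrow> M \<rightarrow> 0\<close> if \<open>n = 1\<close>, and
  \<open>0 \<rightarrow> A = A \<rightarrow> 0 \<rightarrow> \<dots> \<rightarrow> 0 \<rightarrow> M = M \<rightarrow> 0\<close> if \<open>n \<ge> 2\<close>, with \<open>n - 2\<close> zero objects in the middle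
  (so \<open>0 \<rightarrow> A = A \<rightarrow> M = M \<rightarrow> 0\<close>, with zero middle arrow, if \<open>n = 2\<close>).
\<close>

definition trivial_extensions ::
    "('o, 'a) category_data \<Rightarrow> nat \<Rightarrow> 'o \<Rightarrow> 'o \<Rightarrow> 'a list set" where
  "trivial_extensions C n M A =
     (if n = 1 then {[i, q] | i q. \<exists>P j p. is_biproduct C A M P i j p q}
      else {Id C A # map2 (Zero C) (A # replicate (n - 2) Z) (replicate (n - 2) Z @ [M]) @ [Id C M]
            | Z. is_zero_object C Z})"

text \<open>
  The group of \<open>n\<close>-fold extensions \<open>Ext\<^sup>n(M, A)\<close>, for \<open>n \<ge> 1\<close>, under Baer sum; its elements
  are the equivalence classes, and the operations return the class of the representatives they
  construct.
\<close>

definition Ext :: "('o, 'a) category_data \<Rightarrow> nat \<Rightarrow> 'o \<Rightarrow> 'o \<Rightarrow> 'a list set monoid" where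
  "Ext C n M A =
     \<lparr>carrier = extensions C n M A // ext_rel C n M A,
      mult = (\<lambda>\<xi> \<eta>. ext_rel C n M A `` {S. \<exists>E1\<in>\<xi>. \<exists>E2\<in>\<eta>. baer_sum C n E1 E2 S}),
      one = ext_rel C n M A `` trivial_extensions C n M A\<rparr>"

text \<open>The induced map \<open>Ext\<^sup>n(M, f)\<close>.\<close>

definition Ext_map ::
    "('o, 'a) category_data \<Rightarrow> nat \<Rightarrow> 'o \<Rightarrow> 'a \<Rightarrow> 'a list set \<Rightarrow> 'a list set" where
  "Ext_map C n M f \<xi> = ext_rel C n M (Cod C f) `` {E'. \<exists>E\<in>\<xi>. pushforward C f E E'}"

definition Ext_right_exact :: "('o, 'a) category_data \<Rightarrow> nat \<Rightarrow> 'o \<Rightarrow> bool" where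
  "Ext_right_exact C n M \<longleftrightarrow> (\<forall>A B D f g. short_exact C A B D f g \<longrightarrow>
     Ext_map C n M f ` carrier (Ext C n M A) = kernel (Ext C n M B) (Ext C n M D) (Ext_map C n M g) \<and>
     Ext_map C n M g ` carrier (Ext C n M B) = carrier (Ext C n M D))"

end

theory Submission
  imports Defs
begin

text \<open>
  Let \<open>0 \<rightarrow> A \<rightarrow> B \<rightarrow> D \<rightarrow> 0\<close> be exact. Splicing it with \<open>E \<in> Ext\<^sup>n(M, D)\<close> gives the obstruction in
  \<open>Ext\<^sup>n\<^sup>+\<^sup>1(M, A)\<close> to lifting \<open>E\<close> to \<open>Ext\<^sup>n(M, B)\<close>, and every \<open>(n + 1)\<close>-fold extension is such a splice; so the
  theorem amounts to exactness of the long \<open>Ext\<close>-sequence at \<open>Ext\<^sup>n(M, B)\<close> and \<open>Ext\<^sup>n(M, D)\<close>. Yoneda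
  equivalence is a zigzag of morphisms, and the point is to move information backwards along a morphism.
  This is done by homotopy fibre products of complexes: if \<open>F \<rightarrow> Y\<close> lies over an epimorphism \<open>B \<rightarrow> D\<close> and
  \<open>X \<rightarrow> Y\<close> over an arrow \<open>A \<rightarrow> D\<close>, there is an extension by \<open>A \<times>\<^sub>D B\<close> mapping to both \<open>F\<close> and \<open>X\<close>.
\<close>

subsection \<open>Calculus of arrows\<close>

text \<open>The degreewise fibre product of exact complexes is not exact in general: the lifts of an
  element to \<open>F\<close> and to \<open>X\<close> may have images in \<open>Y\<close> that agree
  only up to a boundary of \<open>Y\<close>. If \<open>F\<close> maps onto \<open>Y\<close> in all
  degrees up to \<open>n\<close>, this boundary can be lifted to \<open>F\<close> and subtracted;
  hence the enlargement of \<open>F\<close> by a contractible complex. That complex must vanish at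
  both ends, since the ends of an extension are fixed, and therefore degree \<open>n\<close> needs a
  separate argument. That an extension by \<open>D\<close> lifts to \<open>B\<close> cannot be
  followed directly along a zigzag of \<open>(n + 1)\<close>-fold extensions, because
  \<open>B\<close> and \<open>D\<close> change with the extension. The predicate
  \<open>tail_covered\<close> refers only to what is left of an extension after deleting its first
  object. Such a tail is exact except at its left end, where the kernel is \<open>A\<close>; a
  Yoneda morphism is the identity on \<open>A\<close>, and this gives enough injectivity and
  surjectivity on kernels for the fibre product to be exact. Neither elements nor projectives are
  available, so chases use arrows up to precomposition with epimorphisms.\<close>

context category
begin

lemma HomD: "f \<in> Hom C X Y \<Longrightarrow> f \<in> Arr C" "f \<in> Hom C X Y \<Longrightarrow> Dom C f = X"
  "f \<in> Hom C X Y \<Longrightarrow> Cod C f = Y"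
  by (simp_all add: Hom_def)

lemma Hom_Ob: assumes "f \<in> Hom C X Y" shows "X \<in> Ob C" "Y \<in> Ob C"
  using assms Dom_Ob Cod_Ob by (auto simp: Hom_def)

text \<open>The locale axioms mention a middle object that rewriting cannot guess. In terms of
  \<open>Arr\<close>, \<open>Dom\<close> and \<open>Cod\<close> the side conditions are equations
  that simp can decide, which is why later proofs unfold \<open>Hom_def\<close>.\<close>

lemma Comp_simps [simp]:
  assumes "f \<in> Arr C" "g \<in> Arr C" "Cod C f = Dom C g"
  shows "g \<cdot> f \<in> Arr C" "Dom C (g \<cdot> f) = Dom C f" "Cod C (g \<cdot> f) = Cod C g"
  using Comp_Hom[of f "Dom C f" "Dom C g" g "Cod C g"] assms by (auto simp: Hom_def)

lemma Comp_assoc' [simp]: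
  assumes "f \<in> Arr C" "g \<in> Arr C" "h \<in> Arr C" "Cod C f = Dom C g" "Cod C g = Dom C h"
  shows "(h \<cdot> g) \<cdot> f = h \<cdot> (g \<cdot> f)"
  using Comp_assoc[of f "Dom C f" "Dom C g" g "Dom C h" h "Cod C h"] assms by (auto simp: Hom_def)

lemma Id_simps [simp]:
  assumes "X \<in> Ob C"
  shows "Id C X \<in> Arr C" "Dom C (Id C X) = X" "Cod C (Id C X) = X"
  using Id_Hom[OF assms] by (auto simp: Hom_def)

lemma Comp_Id' [simp]: "\<lbrakk>f \<in> Arr C; Dom C f = X\<rbrakk> \<Longrightarrow> f \<cdot> Id C X = f"
  using Comp_Id by (auto simp: Hom_def)

lemma Id_Comp' [simp]: "\<lbrakk>f \<in> Arr C; Cod C f = X\<rbrakk> \<Longrightarrow> Id C X \<cdot> f = f"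
  using Id_Comp by (auto simp: Hom_def)

lemma Dom_in_Ob [simp]: "f \<in> Arr C \<Longrightarrow> Dom C f \<in> Ob C"
  and Cod_in_Ob [simp]: "f \<in> Arr C \<Longrightarrow> Cod C f \<in> Ob C"
  by (simp_all add: Dom_Ob Cod_Ob)

text \<open>Composites are normalized to the right, so an equation between two-step composites no
  longer matches inside a longer one; this form applies it there. The primed variant serves when one
  side is a single arrow.\<close>

lemma Comp_eq_Comp:
  assumes "g \<cdot> f = g' \<cdot> f'" "f \<in> Hom C X Y" "g \<in> Hom C Y Z" "f' \<in> Hom C X Y'" "g' \<in> Hom C Y' Z"
    "h \<in> Hom C W X"
  shows "g \<cdot> (f \<cdot> h) = g' \<cdot> (f' \<cdot> h)"
  using Comp_assoc[OF assms(6,2,3)] Comp_assoc[OF assms(6,4,5)] assms(1) by simp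

lemma Comp_eq_Comp':
  assumes "g \<cdot> f = g'" "f \<in> Hom C X Y" "g \<in> Hom C Y Z" "h \<in> Hom C W X"
  shows "g \<cdot> (f \<cdot> h) = g' \<cdot> h"
  using Comp_assoc[OF assms(4,2,3)] assms(1) by simp

lemma is_epi_comp:
  assumes "is_epi C f" "is_epi C g" "Cod C f = Dom C g"
  shows "is_epi C (g \<cdot> f)"
  unfolding is_epi_def
proof (intro conjI allI ballI impI)
  have [simp]: "f \<in> Arr C" "g \<in> Arr C" using assms by (auto simp: is_epi_def)
  show "g \<cdot> f \<in> Arr C" using assms by simp
  fix X u v assume uv: "u \<in> Hom C (Cod C (g \<cdot> f)) X" "v \<in> Hom C (Cod C (g \<cdot> f)) X"
    and eq: "u \<cdot> (g \<cdot> f) = v \<cdot> (g \<cdot> f)"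
  have uv': "u \<in> Hom C (Cod C g) X" "v \<in> Hom C (Cod C g) X" using uv assms(3) by simp_all
  have "(u \<cdot> g) \<cdot> f = (v \<cdot> g) \<cdot> f" using eq uv' assms(3) by (simp add: Hom_def)
  moreover have "u \<cdot> g \<in> Hom C (Cod C f) X" "v \<cdot> g \<in> Hom C (Cod C f) X"
    using uv' assms(3) by (simp_all add: Hom_def)
  ultimately have "u \<cdot> g = v \<cdot> g" using assms(1) by (auto simp: is_epi_def)
  then show "u = v" using uv' assms(2) by (auto simp: is_epi_def)
qed

lemma is_epi_Id: "X \<in> Ob C \<Longrightarrow> is_epi C (Id C X)"
  by (auto simp: is_epi_def Hom_def)

lemma epi_cancel:
  assumes "is_epi C e" "e \<in> Hom C X Y" "g \<in> Hom C Y Z" "h \<in> Hom C Y Z" "g \<cdot> e = h \<cdot> e"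
  shows "g = h"
  using assms by (auto simp: is_epi_def Hom_def)

lemma mono_cancel:
  assumes "is_mono C m" "m \<in> Hom C Y Z" "g \<in> Hom C X Y" "h \<in> Hom C X Y" "m \<cdot> g = m \<cdot> h"
  shows "g = h"
  using assms by (auto simp: is_mono_def Hom_def)

end

section \<open>Additive structure: zero arrows, negatives and differences\<close>

context preadditive_category
begin

definition neg :: "'b \<Rightarrow> 'b" where
  "neg f = inv\<^bsub>hom_group C (Dom C f) (Cod C f)\<^esub> f"

definition sub :: "'b \<Rightarrow> 'b \<Rightarrow> 'b" where
  "sub f g = Add C f (neg g)"

lemma Zero_Hom: assumes "X \<in> Ob C" "Y \<in> Ob C" shows "Zero C X Y \<in> Hom C X Y"
proof -
  interpret comm_group "hom_group C X Y" by (rule comm_group_Hom[OF assms])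
  show ?thesis using one_closed by (simp add: hom_group_def)
qed

lemma Zero_simps [simp]:
  assumes "X \<in> Ob C" "Y \<in> Ob C"
  shows "Zero C X Y \<in> Arr C" "Dom C (Zero C X Y) = X" "Cod C (Zero C X Y) = Y"
  using Zero_Hom[OF assms] by (auto simp: Hom_def)

lemma Add_Hom: assumes "f \<in> Hom C X Y" "g \<in> Hom C X Y" shows "Add C f g \<in> Hom C X Y"
proof -
  interpret comm_group "hom_group C X Y" using comm_group_Hom Hom_Ob[OF assms(1)] by blast
  show ?thesis using m_closed[of f g] assms by (simp add: hom_group_def)
qed

lemma Add_simps [simp]:
  assumes "f \<in> Arr C" "g \<in> Arr C" "Dom C f = Dom C g" "Cod C f = Cod C g"
  shows "Add C f g \<in> Arr C" "Dom C (Add C f g) = Dom C g" "Cod C (Add C f g) = Cod C g"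
  using Add_Hom[of f "Dom C g" "Cod C g" g] assms by (auto simp: Hom_def)

lemma neg_Hom: assumes "f \<in> Hom C X Y" shows "neg f \<in> Hom C X Y"
proof -
  interpret comm_group "hom_group C X Y" using comm_group_Hom Hom_Ob[OF assms] by blast
  show ?thesis using inv_closed[of f] assms by (auto simp: hom_group_def neg_def Hom_def)
qed

lemma neg_simps [simp]:
  assumes "f \<in> Arr C"
  shows "neg f \<in> Arr C" "Dom C (neg f) = Dom C f" "Cod C (neg f) = Cod C f"
  using neg_Hom[of f "Dom C f" "Cod C f"] assms by (auto simp: Hom_def)

lemma Add_assoc:
  assumes "f \<in> Hom C X Y" "g \<in> Hom C X Y" "h \<in> Hom C X Y"
  shows "Add C (Add C f g) h = Add C f (Add C g h)"
proof -
  interpret comm_group "hom_group C X Y" using comm_group_Hom Hom_Ob[OF assms(1)] by blast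
  show ?thesis using m_assoc[of f g h] assms by (simp add: hom_group_def)
qed

lemma Add_commute:
  assumes "f \<in> Hom C X Y" "g \<in> Hom C X Y"
  shows "Add C f g = Add C g f"
proof -
  interpret comm_group "hom_group C X Y" using comm_group_Hom Hom_Ob[OF assms(1)] by blast
  show ?thesis using m_comm[of f g] assms by (simp add: hom_group_def)
qed

lemma Add_Zero_Hom:
  assumes "f \<in> Hom C X Y"
  shows "Add C f (Zero C X Y) = f" "Add C (Zero C X Y) f = f"
proof -
  interpret comm_group "hom_group C X Y" using comm_group_Hom Hom_Ob[OF assms] by blast
  show "Add C f (Zero C X Y) = f" "Add C (Zero C X Y) f = f"
    using r_one[of f] l_one[of f] assms by (simp_all add: hom_group_def)
qed

lemma Add_Zero [simp]:
  assumes "f \<in> Arr C" "Dom C f = X" "Cod C f = Y"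
  shows "Add C f (Zero C X Y) = f" "Add C (Zero C X Y) f = f"
  using Add_Zero_Hom assms by (auto simp: Hom_def)

lemma Add_neg:
  assumes "f \<in> Hom C X Y"
  shows "Add C f (neg f) = Zero C X Y" "Add C (neg f) f = Zero C X Y"
proof -
  interpret comm_group "hom_group C X Y" using comm_group_Hom Hom_Ob[OF assms] by blast
  show "Add C f (neg f) = Zero C X Y" "Add C (neg f) f = Zero C X Y"
    using r_inv[of f] l_inv[of f] assms by (auto simp: hom_group_def neg_def Hom_def)
qed

lemma Add_eq_left_imp_Zero:
  assumes "f \<in> Hom C X Y" "g \<in> Hom C X Y" "Add C f g = f"
  shows "g = Zero C X Y"
proof -
  interpret comm_group "hom_group C X Y" using comm_group_Hom Hom_Ob[OF assms(1)] by blast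
  show ?thesis using l_cancel_one[of f g] assms by (simp add: hom_group_def)
qed

text \<open>By additivity the composite equals its own double, and a group element with this
  property is neutral.\<close>

lemma Comp_Zero [simp]:
  assumes "g \<in> Arr C" "X \<in> Ob C" "Dom C g = Y"
  shows "g \<cdot> Zero C X Y = Zero C X (Cod C g)"
proof (rule Add_eq_left_imp_Zero)
  have Y: "Y \<in> Ob C" using assms by auto
  show "g \<cdot> Zero C X Y \<in> Hom C X (Cod C g)" "g \<cdot> Zero C X Y \<in> Hom C X (Cod C g)"
    using assms Y by (auto simp: Hom_def)
  have "Add C (g \<cdot> Zero C X Y) (g \<cdot> Zero C X Y) = g \<cdot> Add C (Zero C X Y) (Zero C X Y)"
    using Comp_Add[of "Zero C X Y" X Y "Zero C X Y" g "Cod C g"] assms Y by (simp add: Hom_def)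
  then show "Add C (g \<cdot> Zero C X Y) (g \<cdot> Zero C X Y) = g \<cdot> Zero C X Y"
    using assms Y by simp
qed

lemma Zero_Comp [simp]:
  assumes "f \<in> Arr C" "Z \<in> Ob C" "Cod C f = Y"
  shows "Zero C Y Z \<cdot> f = Zero C (Dom C f) Z"
proof (rule Add_eq_left_imp_Zero)
  have Y: "Y \<in> Ob C" using assms by auto
  show "Zero C Y Z \<cdot> f \<in> Hom C (Dom C f) Z" "Zero C Y Z \<cdot> f \<in> Hom C (Dom C f) Z"
    using assms Y by (auto simp: Hom_def)
  have "Add C (Zero C Y Z \<cdot> f) (Zero C Y Z \<cdot> f) = Add C (Zero C Y Z) (Zero C Y Z) \<cdot> f"
    using Add_Comp[of f "Dom C f" Y "Zero C Y Z" Z "Zero C Y Z"] assms Y by (simp add: Hom_def)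
  then show "Add C (Zero C Y Z \<cdot> f) (Zero C Y Z \<cdot> f) = Zero C Y Z \<cdot> f"
    using assms Y by simp
qed

lemma Comp_Add' [simp]:
  assumes "f \<in> Arr C" "f' \<in> Arr C" "g \<in> Arr C" "Dom C f = Dom C f'" "Cod C f = Dom C g" "Cod C f' = Dom C g"
  shows "g \<cdot> Add C f f' = Add C (g \<cdot> f) (g \<cdot> f')"
  using Comp_Add[of f "Dom C f" "Dom C g" f' g "Cod C g"] assms by (simp add: Hom_def)

lemma Add_Comp' [simp]:
  assumes "f \<in> Arr C" "g \<in> Arr C" "g' \<in> Arr C" "Dom C g = Cod C f" "Dom C g' = Cod C f" "Cod C g = Cod C g'"
  shows "Add C g g' \<cdot> f = Add C (g \<cdot> f) (g' \<cdot> f)"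
  using Add_Comp[of f "Dom C f" "Cod C f" g "Cod C g" g'] assms by (simp add: Hom_def)

lemma Add_neg_simps [simp]:
  assumes "f \<in> Arr C"
  shows "Add C f (neg f) = Zero C (Dom C f) (Cod C f)" "Add C (neg f) f = Zero C (Dom C f) (Cod C f)"
  using Add_neg[of f "Dom C f" "Cod C f"] assms by (simp_all add: Hom_def)

lemma neg_unique:
  assumes "f \<in> Hom C X Y" "g \<in> Hom C X Y" "Add C f g = Zero C X Y"
  shows "g = neg f"
proof -
  have "g = Add C (Add C (neg f) f) g" using assms by (simp add: Hom_def)
  also have "\<dots> = Add C (neg f) (Add C f g)" using assms
    by (intro Add_assoc[of _ X Y]) (simp_all add: Hom_def)
  also have "\<dots> = neg f" using assms by (simp add: Hom_def)
  finally show ?thesis .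
qed

lemma Comp_neg [simp]:
  assumes "f \<in> Arr C" "g \<in> Arr C" "Cod C f = Dom C g"
  shows "g \<cdot> neg f = neg (g \<cdot> f)"
proof (rule neg_unique)
  show "g \<cdot> f \<in> Hom C (Dom C f) (Cod C g)" "g \<cdot> neg f \<in> Hom C (Dom C f) (Cod C g)"
    using assms by (simp_all add: Hom_def)
  show "Add C (g \<cdot> f) (g \<cdot> neg f) = Zero C (Dom C f) (Cod C g)"
    using assms Comp_Add'[of f "neg f" g] by (simp del: Comp_Add')
qed

lemma neg_Comp [simp]:
  assumes "f \<in> Arr C" "g \<in> Arr C" "Cod C f = Dom C g"
  shows "neg g \<cdot> f = neg (g \<cdot> f)"
proof (rule neg_unique)
  show "g \<cdot> f \<in> Hom C (Dom C f) (Cod C g)" "neg g \<cdot> f \<in> Hom C (Dom C f) (Cod C g)"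
    using assms by (simp_all add: Hom_def)
  show "Add C (g \<cdot> f) (neg g \<cdot> f) = Zero C (Dom C f) (Cod C g)"
    using assms Add_Comp'[of f g "neg g"] by (simp del: Add_Comp')
qed

lemma sub_simps [simp]:
  assumes "f \<in> Arr C" "g \<in> Arr C" "Dom C f = Dom C g" "Cod C f = Cod C g"
  shows "sub f g \<in> Arr C" "Dom C (sub f g) = Dom C g" "Cod C (sub f g) = Cod C g"
  using assms by (simp_all add: sub_def)

lemma Comp_sub [simp]:
  assumes "f \<in> Arr C" "f' \<in> Arr C" "g \<in> Arr C" "Dom C f = Dom C f'" "Cod C f = Dom C g" "Cod C f' = Dom C g"
  shows "g \<cdot> sub f f' = sub (g \<cdot> f) (g \<cdot> f')"
  using assms by (simp add: sub_def)

lemma sub_Comp [simp]: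
  assumes "f \<in> Arr C" "g \<in> Arr C" "g' \<in> Arr C" "Dom C g = Cod C f" "Dom C g' = Cod C f" "Cod C g = Cod C g'"
  shows "sub g g' \<cdot> f = sub (g \<cdot> f) (g' \<cdot> f)"
  using assms by (simp add: sub_def)

lemma sub_self [simp]: "f \<in> Arr C \<Longrightarrow> sub f f = Zero C (Dom C f) (Cod C f)"
  by (simp add: sub_def)

lemma neg_Zero [simp]: "\<lbrakk>X \<in> Ob C; Y \<in> Ob C\<rbrakk> \<Longrightarrow> neg (Zero C X Y) = Zero C X Y"
  using neg_unique[of "Zero C X Y" X Y "Zero C X Y"] by (simp add: Zero_Hom)

lemma sub_Zero [simp]: "\<lbrakk>f \<in> Arr C; Dom C f = X; Cod C f = Y\<rbrakk> \<Longrightarrow> sub f (Zero C X Y) = f"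
  by (auto simp add: sub_def)

lemma Add_sub_cancel:
  assumes "f \<in> Hom C X Y" "g \<in> Hom C X Y"
  shows "Add C g (sub f g) = f"
proof -
  have "Add C g (sub f g) = Add C (sub f g) g"
    using assms by (intro Add_commute[of _ X Y]) (simp_all add: Hom_def)
  also have "\<dots> = Add C f (Add C (neg g) g)" unfolding sub_def
    using assms by (intro Add_assoc[of _ X Y]) (simp_all add: Hom_def)
  also have "\<dots> = f" using assms by (simp add: Hom_def)
  finally show ?thesis .
qed

lemma sub_eq_ZeroD:
  assumes "f \<in> Hom C X Y" "g \<in> Hom C X Y" "sub f g = Zero C X Y"
  shows "f = g"
  using Add_sub_cancel[OF assms(1,2)] assms by (simp add: Hom_def)

lemma sub_sub_cancel:
  assumes "f \<in> Hom C X Y" "g \<in> Hom C X Y"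
  shows "sub f (sub f g) = g"
proof -
  have s: "sub f g \<in> Hom C X Y" using assms by (simp add: Hom_def)
  have "Add C (sub f g) (sub f (sub f g)) = f" by (rule Add_sub_cancel[OF assms(1) s])
  also have "\<dots> = Add C g (sub f g)" using Add_sub_cancel[OF assms] by simp
  also have "\<dots> = Add C (sub f g) g" by (rule Add_commute[OF assms(2) s])
  finally have "Add C (sub f g) (sub f (sub f g)) = Add C (sub f g) g" .
  then have "sub (Add C (sub f g) (sub f (sub f g))) (sub f g) = sub (Add C (sub f g) g) (sub f g)"
    by simp
  moreover have "sub (Add C a b) a = b" if "a \<in> Hom C X Y" "b \<in> Hom C X Y" for a b
  proof -
    have "sub (Add C a b) a = sub (Add C b a) a" using that by (simp add: Add_commute)
    also have "\<dots> = Add C b (Add C a (neg a))" unfolding sub_def using that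
      by (intro Add_assoc[of _ X Y]) (simp_all add: Hom_def)
    also have "\<dots> = b" using that by (simp add: Hom_def)
    finally show ?thesis .
  qed
  ultimately show ?thesis using assms by (simp add: Hom_def)
qed

lemma epi_zeroD:
  assumes "is_epi C e" "e \<in> Hom C X Y" "g \<in> Hom C Y Z" "g \<cdot> e = Zero C X Z"
  shows "g = Zero C Y Z"
  using assms Hom_Ob[OF assms(3)] by (intro epi_cancel[OF assms(1,2,3)]) (auto simp: Hom_def)

lemma mono_zeroD:
  assumes "is_mono C m" "m \<in> Hom C Y Z" "g \<in> Hom C X Y" "m \<cdot> g = Zero C X Z"
  shows "g = Zero C X Y"
  using assms Hom_Ob[OF assms(3)] by (intro mono_cancel[OF assms(1,2,3)]) (auto simp: Hom_def)

text \<open>By additivity, \<open>g \<cdot> e = h \<cdot> e\<close> concerns only the difference of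
  \<open>g\<close> and \<open>h\<close>, so cancellation need only be tested against zero.\<close>

lemma epi_zeroI:
  assumes "e \<in> Hom C X Y" "\<And>Z g. \<lbrakk>g \<in> Hom C Y Z; g \<cdot> e = Zero C X Z\<rbrakk> \<Longrightarrow> g = Zero C Y Z"
  shows "is_epi C e"
  unfolding is_epi_def
proof (intro conjI allI ballI impI)
  show "e \<in> Arr C" using assms by (simp add: Hom_def)
  fix Z g h assume gh: "g \<in> Hom C (Cod C e) Z" "h \<in> Hom C (Cod C e) Z" "g \<cdot> e = h \<cdot> e"
  have gh': "g \<in> Hom C Y Z" "h \<in> Hom C Y Z" using gh assms(1) by (simp_all add: Hom_def)
  have "sub g h = Zero C Y Z"
    using gh gh' assms(1) by (intro assms(2)) (auto simp: Hom_def)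
  then show "g = h" using sub_eq_ZeroD gh' by blast
qed

lemma mono_zeroI:
  assumes "m \<in> Hom C X Y" "\<And>Z g. \<lbrakk>g \<in> Hom C Z X; m \<cdot> g = Zero C Z Y\<rbrakk> \<Longrightarrow> g = Zero C Z X"
  shows "is_mono C m"
  unfolding is_mono_def
proof (intro conjI allI ballI impI)
  show "m \<in> Arr C" using assms by (simp add: Hom_def)
  fix Z g h assume gh: "g \<in> Hom C Z (Dom C m)" "h \<in> Hom C Z (Dom C m)" "m \<cdot> g = m \<cdot> h"
  have gh': "g \<in> Hom C Z X" "h \<in> Hom C Z X" using gh assms(1) by (simp_all add: Hom_def)
  have "sub g h = Zero C Z X"
    using gh gh' assms(1) by (intro assms(2)) (auto simp: Hom_def)
  then show "g = h" using sub_eq_ZeroD gh' by blast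
qed

end

context abelian_category
begin

subsection \<open>Pullbacks and generalized elements\<close>

lemma biproduct_simps:
  assumes "is_biproduct C A B P i j p q"
  shows "i \<in> Hom C A P" "j \<in> Hom C B P" "p \<in> Hom C P A" "q \<in> Hom C P B"
    "p \<cdot> i = Id C A" "q \<cdot> j = Id C B" "p \<cdot> j = Zero C B A" "q \<cdot> i = Zero C A B"
    "Add C (i \<cdot> p) (j \<cdot> q) = Id C P"
  using assms by (auto simp: is_biproduct_def)

lemma biproduct_pair:
  assumes "is_biproduct C A B P i j p q" "f \<in> Hom C T A" "g \<in> Hom C T B"
  shows "Add C (i \<cdot> f) (j \<cdot> g) \<in> Hom C T P"
    "p \<cdot> Add C (i \<cdot> f) (j \<cdot> g) = f" "q \<cdot> Add C (i \<cdot> f) (j \<cdot> g) = g"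
proof -
  note b = biproduct_simps[OF assms(1)]
  note O = Hom_Ob[OF assms(2)] Hom_Ob[OF assms(3)] Hom_Ob[OF b(1)]
  show "Add C (i \<cdot> f) (j \<cdot> g) \<in> Hom C T P" using b assms(2,3) by (auto simp: Hom_def)
  have "p \<cdot> (i \<cdot> f) = f" "p \<cdot> (j \<cdot> g) = Zero C T A" "q \<cdot> (i \<cdot> f) = Zero C T B" "q \<cdot> (j \<cdot> g) = g"
    using Comp_eq_Comp'[OF b(5,1,3) assms(2)] Comp_eq_Comp'[OF b(7,2,3) assms(3)]
      Comp_eq_Comp'[OF b(8,1,4) assms(2)] Comp_eq_Comp'[OF b(6,2,4) assms(3)] O assms(2,3)
    by (simp_all add: Hom_def)
  then show "p \<cdot> Add C (i \<cdot> f) (j \<cdot> g) = f" "q \<cdot> Add C (i \<cdot> f) (j \<cdot> g) = g"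
    using b(1-4) O assms(2,3) by (simp_all add: Hom_def)
qed

lemma biproduct_expand:
  assumes "is_biproduct C A B P i j p q" "t \<in> Hom C T P"
  shows "t = Add C (i \<cdot> (p \<cdot> t)) (j \<cdot> (q \<cdot> t))"
proof -
  note b = biproduct_simps[OF assms(1)]
  have "t = Add C (i \<cdot> p) (j \<cdot> q) \<cdot> t" using b(9) assms(2) by (simp add: Hom_def)
  then show ?thesis using b(1-4) assms(2) by (simp add: Hom_def)
qed

lemma biproduct_joint_mono:
  assumes "is_biproduct C A B P i j p q" "t \<in> Hom C T P" "t' \<in> Hom C T P" "p \<cdot> t = p \<cdot> t'" "q \<cdot> t = q \<cdot> t'"
  shows "t = t'"
  using biproduct_expand[OF assms(1,2)] biproduct_expand[OF assms(1,3)] assms(4,5) by simp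

lemma biproduct_joint_epi:
  assumes "is_biproduct C A B P i j p q" "t \<in> Hom C P T" "t' \<in> Hom C P T" "t \<cdot> i = t' \<cdot> i" "t \<cdot> j = t' \<cdot> j"
  shows "t = t'"
proof -
  note b = biproduct_simps[OF assms(1)]
  have e: "s = Add C ((s \<cdot> i) \<cdot> p) ((s \<cdot> j) \<cdot> q)" if "s \<in> Hom C P T" for s
  proof -
    have "s = s \<cdot> Add C (i \<cdot> p) (j \<cdot> q)" using b(9) that by (simp add: Hom_def)
    then show ?thesis using b(1-4) that by (simp add: Hom_def)
  qed
  show ?thesis using e[OF assms(2)] e[OF assms(3)] assms(4,5) by simp
qed

lemma biproduct_copair:
  assumes "is_biproduct C A B P i j p q" "f \<in> Hom C A T" "g \<in> Hom C B T"
  shows "Add C (f \<cdot> p) (g \<cdot> q) \<in> Hom C P T"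
    "Add C (f \<cdot> p) (g \<cdot> q) \<cdot> i = f" "Add C (f \<cdot> p) (g \<cdot> q) \<cdot> j = g"
  using biproduct_simps[OF assms(1)] assms(2,3) Hom_Ob[OF assms(2)] Hom_Ob[OF assms(3)]
  by (simp_all add: Hom_def)

section \<open>Kernels and cokernels in elimination form\<close>

lemma kernelD:
  assumes "is_kernel C f k" "f \<in> Hom C X Y"
  obtains K where "k \<in> Hom C K X" "f \<cdot> k = Zero C K Y" "is_mono C k"
    "\<And>T t. \<lbrakk>t \<in> Hom C T X; f \<cdot> t = Zero C T Y\<rbrakk> \<Longrightarrow> \<exists>u. u \<in> Hom C T K \<and> k \<cdot> u = t"
proof -
  have k: "k \<in> Hom C (Dom C k) X" "f \<cdot> k = Zero C (Dom C k) Y"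
    using assms by (auto simp: is_kernel_def Hom_def)
  have ex1: "\<exists>!u. u \<in> Hom C T (Dom C k) \<and> k \<cdot> u = t" if "t \<in> Hom C T X" "f \<cdot> t = Zero C T Y" for T t
    using assms(1) that unfolding is_kernel_def HomD(2,3)[OF assms(2)] by blast
  \<comment> \<open>Uniqueness of the factorization of the zero arrow through \<open>k\<close>
    amounts to monicity of \<open>k\<close>; chases use existence and monicity separately.\<close>
  have "is_mono C k"
  proof (rule mono_zeroI[OF k(1)])
    fix Z g assume g: "g \<in> Hom C Z (Dom C k)" "k \<cdot> g = Zero C Z X"
    note O = Hom_Ob[OF g(1)] Hom_Ob[OF k(1)] Hom_Ob[OF assms(2)]
    have "\<exists>!u. u \<in> Hom C Z (Dom C k) \<and> k \<cdot> u = Zero C Z X"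
      using O assms(2) by (intro ex1) (auto simp: Hom_def)
    moreover have "Zero C Z (Dom C k) \<in> Hom C Z (Dom C k)" "k \<cdot> Zero C Z (Dom C k) = Zero C Z X"
      using O k(1) by (auto simp: Hom_def)
    ultimately show "g = Zero C Z (Dom C k)" using g by blast
  qed
  then show ?thesis using that k ex1 by blast
qed

lemma kernelI:
  assumes "f \<in> Hom C X Y" "k \<in> Hom C K X" "f \<cdot> k = Zero C K Y" "is_mono C k"
    "\<And>T t. \<lbrakk>t \<in> Hom C T X; f \<cdot> t = Zero C T Y\<rbrakk> \<Longrightarrow> \<exists>u. u \<in> Hom C T K \<and> k \<cdot> u = t"
  shows "is_kernel C f k"
  unfolding is_kernel_def
proof (intro conjI allI ballI impI)
  fix T t assume t: "t \<in> Hom C T (Dom C f)" "f \<cdot> t = Zero C T (Cod C f)"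
  have "\<exists>u. u \<in> Hom C T K \<and> k \<cdot> u = t" using t assms(1) by (intro assms(5)) (auto simp: Hom_def)
  moreover have "u = v" if "u \<in> Hom C T K" "v \<in> Hom C T K" "k \<cdot> u = t" "k \<cdot> v = t" for u v
    using that mono_cancel[OF assms(4,2)] by auto
  ultimately show "\<exists>!u. u \<in> Hom C T (Dom C k) \<and> k \<cdot> u = t"
    using HomD[OF assms(2)] by auto
qed (use assms in \<open>auto simp: Hom_def\<close>)

lemma cokernelD:
  assumes "is_cokernel C f c" "f \<in> Hom C X Y"
  obtains K where "c \<in> Hom C Y K" "c \<cdot> f = Zero C X K" "is_epi C c"
    "\<And>T t. \<lbrakk>t \<in> Hom C Y T; t \<cdot> f = Zero C X T\<rbrakk> \<Longrightarrow> \<exists>u. u \<in> Hom C K T \<and> u \<cdot> c = t"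
proof -
  have k: "c \<in> Hom C Y (Cod C c)" "c \<cdot> f = Zero C X (Cod C c)"
    using assms by (auto simp: is_cokernel_def Hom_def)
  have ex1: "\<exists>!u. u \<in> Hom C (Cod C c) T \<and> u \<cdot> c = t" if "t \<in> Hom C Y T" "t \<cdot> f = Zero C X T" for T t
    using assms(1) that unfolding is_cokernel_def HomD(2,3)[OF assms(2)] by blast
  have "is_epi C c"
  proof (rule epi_zeroI[OF k(1)])
    fix Z g assume g: "g \<in> Hom C (Cod C c) Z" "g \<cdot> c = Zero C Y Z"
    note O = Hom_Ob[OF g(1)] Hom_Ob[OF k(1)] Hom_Ob[OF assms(2)]
    have "\<exists>!u. u \<in> Hom C (Cod C c) Z \<and> u \<cdot> c = Zero C Y Z"
      using O assms(2) by (intro ex1) (auto simp: Hom_def)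
    moreover have "Zero C (Cod C c) Z \<in> Hom C (Cod C c) Z" "Zero C (Cod C c) Z \<cdot> c = Zero C Y Z"
      using O k(1) by (auto simp: Hom_def)
    ultimately show "g = Zero C (Cod C c) Z" using g by blast
  qed
  then show ?thesis using that k ex1 by blast
qed

lemma obtain_kernel:
  assumes "f \<in> Hom C X Y"
  obtains K k where "k \<in> Hom C K X" "f \<cdot> k = Zero C K Y" "is_mono C k"
    "\<And>T t. \<lbrakk>t \<in> Hom C T X; f \<cdot> t = Zero C T Y\<rbrakk> \<Longrightarrow> \<exists>u. u \<in> Hom C T K \<and> k \<cdot> u = t"
proof -
  obtain k where k: "is_kernel C f k" using ex_kernel HomD[OF assms] by blast
  show thesis by (rule kernelD[OF k assms]) (rule that)
qed

lemma obtain_cokernel: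
  assumes "f \<in> Hom C X Y"
  obtains K c where "is_cokernel C f c" "c \<in> Hom C Y K" "c \<cdot> f = Zero C X K" "is_epi C c"
    "\<And>T t. \<lbrakk>t \<in> Hom C Y T; t \<cdot> f = Zero C X T\<rbrakk> \<Longrightarrow> \<exists>u. u \<in> Hom C K T \<and> u \<cdot> c = t"
proof -
  obtain c where c: "is_cokernel C f c" using ex_cokernel HomD[OF assms] by blast
  show thesis by (rule cokernelD[OF c assms]) (rule that[OF c])
qed

section \<open>Pullbacks and stability of epimorphisms\<close>

lemma pullbackI:
  assumes "g \<in> Hom C B D" "d \<in> Hom C X D" "e \<in> Hom C P B" "v \<in> Hom C P X" "g \<cdot> e = d \<cdot> v"
    "\<And>T x y. \<lbrakk>x \<in> Hom C T B; y \<in> Hom C T X; g \<cdot> x = d \<cdot> y\<rbrakk> \<Longrightarrow> \<exists>w. w \<in> Hom C T P \<and> e \<cdot> w = x \<and> v \<cdot> w = y"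
    "\<And>T w. \<lbrakk>w \<in> Hom C T P; e \<cdot> w = Zero C T B; v \<cdot> w = Zero C T X\<rbrakk> \<Longrightarrow> w = Zero C T P"
  shows "is_pullback C g d e v"
proof -
  \<comment> \<open>The difference of two competing arrows is killed by both projections, hence zero
    by the last assumption.\<close>
  have u: "w = w'" if "w \<in> Hom C T P" "w' \<in> Hom C T P" "e \<cdot> w = e \<cdot> w'" "v \<cdot> w = v \<cdot> w'" for T w w'
  proof (rule sub_eq_ZeroD[OF that(1,2)], rule assms(7))
    show "sub w w' \<in> Hom C T P" "e \<cdot> sub w w' = Zero C T B" "v \<cdot> sub w w' = Zero C T X"
      using that assms(3,4) by (auto simp: Hom_def)
  qed
  have "\<exists>!w. w \<in> Hom C T P \<and> e \<cdot> w = x \<and> v \<cdot> w = y"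
    if xy: "x \<in> Hom C T B" "y \<in> Hom C T X" "g \<cdot> x = d \<cdot> y" for T x y
  proof -
    obtain w where w: "w \<in> Hom C T P \<and> e \<cdot> w = x \<and> v \<cdot> w = y" using assms(6)[OF xy] by blast
    then show ?thesis by (rule ex1I) (use w u in auto)
  qed
  then show ?thesis unfolding is_pullback_def
    using HomD[OF assms(1)] HomD[OF assms(2)] HomD[OF assms(3)] HomD[OF assms(4)] assms(5) by auto
qed

lemma pullbackD:
  assumes "is_pullback C g d e v" "g \<in> Hom C B D" "d \<in> Hom C X D"
  obtains P where "e \<in> Hom C P B" "v \<in> Hom C P X" "g \<cdot> e = d \<cdot> v" "P = Dom C e"
    "\<And>T x y. \<lbrakk>x \<in> Hom C T B; y \<in> Hom C T X; g \<cdot> x = d \<cdot> y\<rbrakk> \<Longrightarrow> \<exists>w. w \<in> Hom C T P \<and> e \<cdot> w = x \<and> v \<cdot> w = y"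
    "\<And>T w w'. \<lbrakk>w \<in> Hom C T P; w' \<in> Hom C T P; e \<cdot> w = e \<cdot> w'; v \<cdot> w = v \<cdot> w'\<rbrakk> \<Longrightarrow> w = w'"
proof -
  have e: "e \<in> Hom C (Dom C e) B" "v \<in> Hom C (Dom C e) X" "g \<cdot> e = d \<cdot> v"
    using assms by (auto simp: is_pullback_def Hom_def)
  have ex1: "\<exists>!w. w \<in> Hom C T (Dom C e) \<and> e \<cdot> w = x \<and> v \<cdot> w = y"
    if "x \<in> Hom C T B" "y \<in> Hom C T X" "g \<cdot> x = d \<cdot> y" for T x y
    using assms(1) that unfolding is_pullback_def HomD(2,3)[OF assms(2)] HomD(2,3)[OF assms(3)] by blast
  have "w = w'" if w: "w \<in> Hom C T (Dom C e)" "w' \<in> Hom C T (Dom C e)" "e \<cdot> w = e \<cdot> w'" "v \<cdot> w = v \<cdot> w'" for T w w'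
  proof -
    have "\<exists>!u. u \<in> Hom C T (Dom C e) \<and> e \<cdot> u = e \<cdot> w \<and> v \<cdot> u = v \<cdot> w"
      by (rule ex1) (use e Comp_Hom w(1) Comp_eq_Comp[OF e(3) e(1) assms(2) e(2) assms(3) w(1)] in auto)
    then show ?thesis using w by auto
  qed
  then show ?thesis using that e ex1 by blast
qed

text \<open>The pullback is the kernel of \<open>g \<cdot> p - d \<cdot> q\<close> on the biproduct
  of \<open>B\<close> and \<open>X\<close>.\<close>

lemma ex_pullback:
  assumes g: "g \<in> Hom C B D" and d: "d \<in> Hom C X D"
  shows "\<exists>e v. is_pullback C g d e v"
proof -
  obtain P i j p q where b: "is_biproduct C B X P i j p q"
    using ex_biproduct[OF Hom_Ob(1)[OF g] Hom_Ob(1)[OF d]] by blast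
  note bs = biproduct_simps[OF b]
  have s: "sub (g \<cdot> p) (d \<cdot> q) \<in> Hom C P D" using bs g d by (simp add: Hom_def)
  obtain K k where k: "k \<in> Hom C K P" "sub (g \<cdot> p) (d \<cdot> q) \<cdot> k = Zero C K D" "is_mono C k"
    "\<And>T t. \<lbrakk>t \<in> Hom C T P; sub (g \<cdot> p) (d \<cdot> q) \<cdot> t = Zero C T D\<rbrakk> \<Longrightarrow> \<exists>u. u \<in> Hom C T K \<and> k \<cdot> u = t"
    by (rule obtain_kernel[OF s]) (rule that; blast)
  have "is_pullback C g d (p \<cdot> k) (q \<cdot> k)"
  proof (rule pullbackI[OF g d])
    show "p \<cdot> k \<in> Hom C K B" "q \<cdot> k \<in> Hom C K X" using bs k(1) by (simp_all add: Hom_def)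
    show "g \<cdot> (p \<cdot> k) = d \<cdot> (q \<cdot> k)"
    proof (rule sub_eq_ZeroD)
      show "g \<cdot> (p \<cdot> k) \<in> Hom C K D" "d \<cdot> (q \<cdot> k) \<in> Hom C K D"
        using k(1) bs(3,4) g d by (simp_all add: Hom_def)
      show "sub (g \<cdot> (p \<cdot> k)) (d \<cdot> (q \<cdot> k)) = Zero C K D"
        using k(1,2) bs(3,4) g d by (simp add: Hom_def)
    qed
    fix T x y assume xy: "x \<in> Hom C T B" "y \<in> Hom C T X" "g \<cdot> x = d \<cdot> y"
    define t where "t = Add C (i \<cdot> x) (j \<cdot> y)"
    have t: "t \<in> Hom C T P" "p \<cdot> t = x" "q \<cdot> t = y"
      using biproduct_pair[OF b xy(1,2)] by (simp_all add: t_def)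
    have "sub (g \<cdot> p) (d \<cdot> q) \<cdot> t = Zero C T D"
      using t xy bs g d by (simp add: Hom_def)
    with k(4) t(1) obtain u where u: "u \<in> Hom C T K" "k \<cdot> u = t" by blast
    then show "\<exists>w. w \<in> Hom C T K \<and> (p \<cdot> k) \<cdot> w = x \<and> (q \<cdot> k) \<cdot> w = y"
      using t bs k(1) by (intro exI[of _ u]) (auto simp: Hom_def)
  next
    fix T w assume w: "w \<in> Hom C T K" "(p \<cdot> k) \<cdot> w = Zero C T B" "(q \<cdot> k) \<cdot> w = Zero C T X"
    note O = Hom_Ob[OF w(1)] Hom_Ob[OF k(1)]
    have "k \<cdot> w = Zero C T P"
      by (rule biproduct_joint_mono[OF b]) (use w k(1) bs O in \<open>auto simp: Hom_def\<close>)
    then show "w = Zero C T K" using mono_zeroD[OF k(3,1) w(1)] by simp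
  qed
  then show ?thesis by blast
qed

text \<open>Stability of epimorphisms under pullback is what lets lifts be found after changing the
  stage \<open>T\<close>. It rests on the axiom that every epi is a cokernel, applied to the
  difference \<open>s\<close> of \<open>g \<cdot> p\<close> and \<open>d \<cdot> q\<close>.\<close>

lemma pullback_epi:
  assumes pb: "is_pullback C g d e v" and g: "g \<in> Hom C B D" and d: "d \<in> Hom C X D" and "is_epi C g"
  shows "is_epi C v"
proof -
  obtain Q where Q: "e \<in> Hom C Q B" "v \<in> Hom C Q X" "g \<cdot> e = d \<cdot> v"
    "\<And>T x y. \<lbrakk>x \<in> Hom C T B; y \<in> Hom C T X; g \<cdot> x = d \<cdot> y\<rbrakk> \<Longrightarrow> \<exists>w. w \<in> Hom C T Q \<and> e \<cdot> w = x \<and> v \<cdot> w = y"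
    by (rule pullbackD[OF pb g d]) (rule that; blast)
  obtain P i j p q where b: "is_biproduct C B X P i j p q"
    using ex_biproduct[OF Hom_Ob(1)[OF g] Hom_Ob(1)[OF d]] by blast
  note bs = biproduct_simps[OF b]
  note O = Hom_Ob[OF g] Hom_Ob[OF d] Hom_Ob[OF bs(1)]
  define s where "s = sub (g \<cdot> p) (d \<cdot> q)"
  have s: "s \<in> Hom C P D" "s \<cdot> i = g" using bs g d O by (simp_all add: Hom_def s_def)
  have "is_epi C s"
  proof (rule epi_zeroI[OF s(1)])
    fix Z h assume h: "h \<in> Hom C D Z" "h \<cdot> s = Zero C P Z"
    have "h \<cdot> g = Zero C B Z"
      using h s bs(1) Comp_eq_Comp'[OF h(2) s(1) h(1) bs(1)] Hom_Ob[OF h(1)] by (simp add: Hom_def)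
    then show "h = Zero C D Z" using epi_zeroD[OF assms(4) g h(1)] by simp
  qed
  then obtain l where l: "is_cokernel C l s" using epi_is_cokernel by blast
  then have lH: "l \<in> Hom C (Dom C l) P" using s(1) by (auto simp: is_cokernel_def Hom_def)
  obtain K where K: "s \<in> Hom C P K" "s \<cdot> l = Zero C (Dom C l) K"
    "\<And>T t. \<lbrakk>t \<in> Hom C P T; t \<cdot> l = Zero C (Dom C l) T\<rbrakk> \<Longrightarrow> \<exists>u. u \<in> Hom C K T \<and> u \<cdot> s = t"
    by (rule cokernelD[OF l lH]) (rule that; blast)
  have KD: "K = D" using K(1) s(1) by (simp add: Hom_def)
  have pl: "p \<cdot> l \<in> Hom C (Dom C l) B" "q \<cdot> l \<in> Hom C (Dom C l) X" using bs lH by (simp_all add: Hom_def)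
  \<comment> \<open>That \<open>s\<close> kills \<open>l\<close> says that the two components of
    \<open>l\<close> form a commuting square over \<open>D\<close>, so they factor through the
    pullback.\<close>
  have "g \<cdot> (p \<cdot> l) = d \<cdot> (q \<cdot> l)"
  proof (rule sub_eq_ZeroD)
    show "g \<cdot> (p \<cdot> l) \<in> Hom C (Dom C l) D" "d \<cdot> (q \<cdot> l) \<in> Hom C (Dom C l) D"
      using lH bs(3,4) g d by (simp_all add: Hom_def)
    show "sub (g \<cdot> (p \<cdot> l)) (d \<cdot> (q \<cdot> l)) = Zero C (Dom C l) D"
      using lH K(2) bs(3,4) g d unfolding KD s_def by (simp add: Hom_def)
  qed
  with Q(4)[OF pl] obtain w where w: "w \<in> Hom C (Dom C l) Q" "v \<cdot> w = q \<cdot> l" by blast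
  show ?thesis
  proof (rule epi_zeroI[OF Q(2)])
    fix Z r assume r: "r \<in> Hom C X Z" "r \<cdot> v = Zero C Q Z"
    have "r \<cdot> (v \<cdot> w) = Zero C (Dom C l) Z"
      using Comp_eq_Comp'[OF r(2) Q(2) r(1) w(1)] w(1) Hom_Ob[OF r(1)] by (simp add: Hom_def)
    then have "(r \<cdot> q) \<cdot> l = Zero C (Dom C l) Z" using w r bs lH by (simp add: Hom_def)
    moreover have "r \<cdot> q \<in> Hom C P Z" using r bs by (simp add: Hom_def)
    ultimately obtain u where u: "u \<in> Hom C D Z" "u \<cdot> s = r \<cdot> q" using K(3) KD by blast
    \<comment> \<open>Restricted to the summand \<open>B\<close>, the arrow
      \<open>r \<cdot> q\<close> vanishes while \<open>s\<close> becomes \<open>g\<close>; hence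
      \<open>u\<close> kills the epi \<open>g\<close>. Restriction to the summand \<open>X\<close>
      then gives \<open>r = 0\<close>.\<close>
    have "u \<cdot> g = (r \<cdot> q) \<cdot> i" using Comp_eq_Comp'[OF u(2) s(1) u(1) bs(1)] s(2) by simp
    also have "\<dots> = Zero C B Z" using r bs O Hom_Ob[OF r(1)] by (simp add: Hom_def)
    finally have "u = Zero C D Z" using epi_zeroD[OF assms(4) g u(1)] by simp
    then have "r \<cdot> q = Zero C P Z" using u s Hom_Ob[OF u(1)] by (simp add: Hom_def)
    then have "(r \<cdot> q) \<cdot> j = Zero C X Z" using bs O Hom_Ob[OF r(1)] by (simp add: Hom_def)
    then show "r = Zero C X Z" using r bs by (simp add: Hom_def)
  qed
qed

text \<open>An arrow \<open>t : T \<rightarrow> Y\<close> serves as a generalized element of \<open>Y\<close>; it lies in the image of \<open>f\<close> iff it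
  factors through \<open>f\<close> after an epimorphism onto \<open>T\<close>. Diagram chases work with such elements.\<close>

definition lifts :: "'b \<Rightarrow> 'b \<Rightarrow> bool" where
  "lifts f t \<longleftrightarrow> (\<exists>T e s. is_epi C e \<and> e \<in> Hom C T (Dom C t) \<and> s \<in> Hom C T (Dom C f) \<and> f \<cdot> s = t \<cdot> e)"

lemma liftsE:
  assumes "lifts f t" "t \<in> Hom C T Y" "f \<in> Hom C X Y"
  obtains T' e s where "is_epi C e" "e \<in> Hom C T' T" "s \<in> Hom C T' X" "f \<cdot> s = t \<cdot> e"
  using assms by (auto simp: lifts_def Hom_def)

lemma liftsI:
  assumes "is_epi C e" "e \<in> Hom C T' T" "s \<in> Hom C T' X" "f \<cdot> s = t \<cdot> e" "t \<in> Hom C T Y" "f \<in> Hom C X Y"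
  shows "lifts f t"
  using assms unfolding lifts_def by (auto simp: Hom_def)

lemma lifts_self:
  assumes "f \<in> Hom C X Y" "s \<in> Hom C T X"
  shows "lifts f (f \<cdot> s)"
  by (rule liftsI[where e="Id C T" and T'=T and T=T and s=s and X=X and Y=Y])
     (use assms Hom_Ob[OF assms(2)] in \<open>auto simp: is_epi_Id Hom_def\<close>)

text \<open>Pulling \<open>f\<close> back along \<open>t\<close> supplies the required epimorphism
  onto \<open>T\<close>.\<close>

lemma lifts_epi:
  assumes "is_epi C f" "f \<in> Hom C X Y" "t \<in> Hom C T Y"
  shows "lifts f t"
proof -
  obtain e v where pb: "is_pullback C f t e v" using ex_pullback[OF assms(2,3)] by blast
  obtain P where P: "e \<in> Hom C P X" "v \<in> Hom C P T" "f \<cdot> e = t \<cdot> v"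
    by (rule pullbackD[OF pb assms(2,3)]) (rule that; blast)
  show ?thesis
    using liftsI[OF pullback_epi[OF pb assms(2,3,1)] P(2,1,3) assms(3,2)] .
qed

text \<open>The identity is the generic element of \<open>Y\<close>: once it lifts, some composite
  \<open>f \<cdot> s\<close> is epi, hence so is \<open>f\<close>.\<close>

lemma epi_if_lifts:
  assumes "f \<in> Hom C X Y" "lifts f (Id C Y)"
  shows "is_epi C f"
proof -
  have Y: "Y \<in> Ob C" using Hom_Ob assms by blast
  obtain T e s where e: "is_epi C e" "e \<in> Hom C T Y" "s \<in> Hom C T X" "f \<cdot> s = Id C Y \<cdot> e"
    by (rule liftsE[OF assms(2) Id_Hom[OF Y] assms(1)])
  show ?thesis
  proof (rule epi_zeroI[OF assms(1)])
    fix Z g assume g: "g \<in> Hom C Y Z" "g \<cdot> f = Zero C X Z"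
    have "g \<cdot> e = g \<cdot> (f \<cdot> s)" using e by (simp add: Hom_def)
    also have "\<dots> = Zero C T Z"
      using Comp_eq_Comp'[OF g(2) assms(1) g(1) e(3)] e(3) Hom_Ob[OF g(1)] by (simp add: Hom_def)
    finally show "g = Zero C Y Z" using epi_zeroD[OF e(1,2) g(1)] by simp
  qed
qed

text \<open>This turns the definition by images and kernels into a condition on generalized
  elements, the form in which exactness is chased afterwards.\<close>

lemma exact_at_iff:
  assumes f: "f \<in> Hom C X Y" and g: "g \<in> Hom C Y Z"
  shows "exact_at C f g \<longleftrightarrow> g \<cdot> f = Zero C X Z \<and> (\<forall>T. \<forall>t\<in>Hom C T Y. g \<cdot> t = Zero C T Z \<longrightarrow> lifts f t)"
    (is "_ \<longleftrightarrow> ?R")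
proof
  note O = Hom_Ob[OF f] Hom_Ob[OF g]
  assume "exact_at C f g"
  then obtain m c where mc: "is_cokernel C f c" "is_kernel C c m" "is_kernel C g m"
    by (auto simp: exact_at_def is_image_def)
  obtain K where c: "c \<in> Hom C Y K" "c \<cdot> f = Zero C X K"
    "\<And>T t. \<lbrakk>t \<in> Hom C Y T; t \<cdot> f = Zero C X T\<rbrakk> \<Longrightarrow> \<exists>u. u \<in> Hom C K T \<and> u \<cdot> c = t"
    by (rule cokernelD[OF mc(1) f]) (rule that; blast)
  obtain I where m: "m \<in> Hom C I Y" "c \<cdot> m = Zero C I K" "is_mono C m"
    "\<And>T t. \<lbrakk>t \<in> Hom C T Y; c \<cdot> t = Zero C T K\<rbrakk> \<Longrightarrow> \<exists>u. u \<in> Hom C T I \<and> m \<cdot> u = t"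
    by (rule kernelD[OF mc(2) c(1)]) (rule that; blast)
  obtain I' where m': "m \<in> Hom C I' Y" "g \<cdot> m = Zero C I' Z"
    "\<And>T t. \<lbrakk>t \<in> Hom C T Y; g \<cdot> t = Zero C T Z\<rbrakk> \<Longrightarrow> \<exists>u. u \<in> Hom C T I' \<and> m \<cdot> u = t"
    by (rule kernelD[OF mc(3) g]) (rule that; blast)
  have I': "I' = I" using m m' by (simp add: Hom_def)
  obtain e where e: "e \<in> Hom C X I" "m \<cdot> e = f" using m(4)[OF f c(2)] by blast
  have gf: "g \<cdot> f = Zero C X Z"
    using Comp_eq_Comp'[OF m'(2,1) g, of e X] e O I' by (simp add: Hom_def)
  \<comment> \<open>\<open>e\<close> is the part of \<open>f\<close> onto its image. If
    \<open>r\<close> kills \<open>e\<close>, then \<open>f\<close> factors through the subobject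
    \<open>m \<cdot> k\<close>, where \<open>k\<close> is the kernel of \<open>r\<close>. Being
    mono, \<open>m \<cdot> k\<close> is the kernel of some \<open>c'\<close>; since
    \<open>c'\<close> kills \<open>f\<close>, it factors through the cokernel \<open>c\<close> and
    so kills \<open>m\<close>. Hence \<open>m\<close> factors through \<open>m \<cdot> k\<close>,
    which splits \<open>k\<close> and forces \<open>r = 0\<close>.\<close>
  have epi: "is_epi C e"
  proof (rule epi_zeroI[OF e(1)])
    fix W r assume r: "r \<in> Hom C I W" "r \<cdot> e = Zero C X W"
    obtain L k where k: "k \<in> Hom C L I" "r \<cdot> k = Zero C L W" "is_mono C k"
      "\<And>T t. \<lbrakk>t \<in> Hom C T I; r \<cdot> t = Zero C T W\<rbrakk> \<Longrightarrow> \<exists>u. u \<in> Hom C T L \<and> k \<cdot> u = t"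
      by (rule obtain_kernel[OF r(1)]) (rule that; blast)
    obtain e' where e': "e' \<in> Hom C X L" "k \<cdot> e' = e" using k(4)[OF e(1) r(2)] by blast
    have mk: "m \<cdot> k \<in> Hom C L Y" using m k by (simp add: Hom_def)
    have "is_mono C (m \<cdot> k)"
    proof (rule mono_zeroI[OF mk])
      fix V h assume h: "h \<in> Hom C V L" "(m \<cdot> k) \<cdot> h = Zero C V Y"
      have "k \<cdot> h = Zero C V I"
        by (rule mono_zeroD[OF m(3,1)]) (use h k m in \<open>simp_all add: Hom_def\<close>)
      then show "h = Zero C V L" using mono_zeroD[OF k(3,1) h(1)] by simp
    qed
    then obtain c' where c': "is_kernel C c' (m \<cdot> k)" using mono_is_kernel by blast
    have c'H: "c' \<in> Hom C Y (Cod C c')" using c' mk by (auto simp: is_kernel_def Hom_def)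
    obtain L' where L': "m \<cdot> k \<in> Hom C L' Y" "c' \<cdot> (m \<cdot> k) = Zero C L' (Cod C c')"
      "\<And>T t. \<lbrakk>t \<in> Hom C T Y; c' \<cdot> t = Zero C T (Cod C c')\<rbrakk> \<Longrightarrow> \<exists>u. u \<in> Hom C T L' \<and> (m \<cdot> k) \<cdot> u = t"
      by (rule kernelD[OF c' c'H]) (rule that; blast)
    have LL: "L' = L" using L' mk by (simp add: Hom_def)
    have O': "L \<in> Ob C" "I \<in> Ob C" "K \<in> Ob C" "W \<in> Ob C" "Cod C c' \<in> Ob C"
      using Hom_Ob[OF k(1)] Hom_Ob[OF c(1)] Hom_Ob[OF r(1)] Hom_Ob[OF c'H] by auto
    have "f = (m \<cdot> k) \<cdot> e'" using e(2) e' m(1) k(1) by (simp add: Hom_def)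
    then have "c' \<cdot> f = Zero C X (Cod C c')"
      using Comp_eq_Comp'[OF L'(2,1) c'H, of e' X] e'(1) O' LL by (simp add: Hom_def)
    then obtain w where w: "w \<in> Hom C K (Cod C c')" "w \<cdot> c = c'" using c(3)[OF c'H] by blast
    have "c' \<cdot> m = Zero C I (Cod C c')"
      using Comp_eq_Comp'[OF w(2) c(1) w(1) m(1)] m(2) w(1) O' by (simp add: Hom_def)
    then obtain v where v: "v \<in> Hom C I L" "(m \<cdot> k) \<cdot> v = m" using L'(3)[OF m(1)] LL by blast
    have "k \<cdot> v = Id C I"
      by (rule mono_cancel[OF m(3,1)]) (use v k m O' in \<open>simp_all add: Hom_def\<close>)
    then have "r = r \<cdot> (k \<cdot> v)" using r by (simp add: Hom_def)
    also have "\<dots> = Zero C I W"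
      using Comp_eq_Comp'[OF k(2,1) r(1) v(1)] v O' by (simp add: Hom_def)
    finally show "r = Zero C I W" .
  qed
  show ?R
  proof (intro conjI allI ballI impI gf)
    fix T t assume t: "t \<in> Hom C T Y" "g \<cdot> t = Zero C T Z"
    then obtain u where u: "u \<in> Hom C T I" "m \<cdot> u = t" using m'(3) I' by blast
    obtain T' p s where p: "is_epi C p" "p \<in> Hom C T' T" "s \<in> Hom C T' X" "e \<cdot> s = u \<cdot> p"
      by (rule liftsE[OF lifts_epi[OF epi e(1) u(1)] u(1) e(1)])
    have "f \<cdot> s = t \<cdot> p"
      using Comp_eq_Comp'[OF e(2,1) m(1) p(3)] Comp_eq_Comp'[OF u(2,1) m(1) p(2)] p(4) by simp
    then show "lifts f t" using liftsI[OF p(1-3) _ t(1) f] by simp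
  qed
next
  note O = Hom_Ob[OF f] Hom_Ob[OF g]
  assume R: ?R
  obtain K c where c: "is_cokernel C f c" "c \<in> Hom C Y K" "c \<cdot> f = Zero C X K"
    "\<And>T t. \<lbrakk>t \<in> Hom C Y T; t \<cdot> f = Zero C X T\<rbrakk> \<Longrightarrow> \<exists>u. u \<in> Hom C K T \<and> u \<cdot> c = t"
    by (rule obtain_cokernel[OF f]) (rule that; blast)
  obtain m where mk: "is_kernel C c m" using ex_kernel HomD[OF c(2)] by blast
  obtain I where m: "m \<in> Hom C I Y" "c \<cdot> m = Zero C I K" "is_mono C m"
    "\<And>T t. \<lbrakk>t \<in> Hom C T Y; c \<cdot> t = Zero C T K\<rbrakk> \<Longrightarrow> \<exists>u. u \<in> Hom C T I \<and> m \<cdot> u = t"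
    by (rule kernelD[OF mk c(2)]) (rule that; blast)
  \<comment> \<open>\<open>g\<close> kills \<open>m\<close> because it factors through the cokernel
    \<open>c\<close>. Conversely, an element killed by \<open>g\<close> lifts to \<open>f\<close>
    after an epi, so \<open>c\<close> kills it as well and it factors through the kernel
    \<open>m\<close> of \<open>c\<close>.\<close>
  have "is_kernel C g m"
  proof (rule kernelI[OF g m(1) _ m(3)])
    obtain w where w: "w \<in> Hom C K Z" "w \<cdot> c = g" using c(4)[OF g] R by blast
    show "g \<cdot> m = Zero C I Z"
      using Comp_eq_Comp'[OF w(2) c(2) w(1) m(1)] m(2) w(1) Hom_Ob[OF m(1)] by (simp add: Hom_def)
    fix T t assume t: "t \<in> Hom C T Y" "g \<cdot> t = Zero C T Z"
    then have "lifts f t" using R by blast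
    then obtain T' p s where p: "is_epi C p" "p \<in> Hom C T' T" "s \<in> Hom C T' X" "f \<cdot> s = t \<cdot> p"
      by (rule liftsE[OF _ t(1) f])
    have "(c \<cdot> t) \<cdot> p = c \<cdot> (f \<cdot> s)" using c t p by (simp add: Hom_def)
    also have "\<dots> = Zero C T' K" using Comp_eq_Comp'[OF c(3) f c(2) p(3)] p Hom_Ob[OF c(2)] by (simp add: Hom_def)
    finally have "c \<cdot> t = Zero C T K"
      using epi_zeroD[OF p(1,2) Comp_Hom[OF t(1) c(2)]] by simp
    then show "\<exists>u. u \<in> Hom C T I \<and> m \<cdot> u = t" using m(4) t by blast
  qed
  then show "exact_at C f g" using c(1) mk by (auto simp: exact_at_def is_image_def)
qed

subsection \<open>Fibre products of complexes\<close>

text \<open>The epi that witnesses the lift of \<open>t\<close> is pulled back along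
  \<open>w\<close>.\<close>

lemma lifts_comp:
  assumes "lifts f t" "f \<in> Hom C X Y" "t \<in> Hom C T Y" "w \<in> Hom C T' T"
  shows "lifts f (t \<cdot> w)"
proof -
  obtain S e s where e: "is_epi C e" "e \<in> Hom C S T" "s \<in> Hom C S X" "f \<cdot> s = t \<cdot> e"
    by (rule liftsE[OF assms(1,3,2)])
  obtain e' v where pb: "is_pullback C e w e' v" using ex_pullback[OF e(2) assms(4)] by blast
  obtain P where P: "e' \<in> Hom C P S" "v \<in> Hom C P T'" "e \<cdot> e' = w \<cdot> v"
    by (rule pullbackD[OF pb e(2) assms(4)])
  show ?thesis
  proof (rule liftsI[OF pullback_epi[OF pb e(2) assms(4) e(1)] P(2) _ _ _ assms(2)])
    show "s \<cdot> e' \<in> Hom C P X" using Comp_Hom P e by blast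
    show "t \<cdot> w \<in> Hom C T' Y" using Comp_Hom assms by blast
    show "f \<cdot> (s \<cdot> e') = (t \<cdot> w) \<cdot> v"
      using Comp_eq_Comp[OF e(4,3) assms(2) e(2) assms(3) P(1)] P assms e by (simp add: Hom_def)
  qed
qed

text \<open>Complexes \<open>X\<^sub>0 \<rightarrow> \<dots> \<rightarrow> X\<^sub>n\<^sub>+\<^sub>1\<close> with arrows \<open>x\<^sub>0, \<dots>, x\<^sub>n\<close>; values at larger indices are irrelevant.
  For \<open>k = n\<close> the lifting condition says that \<open>x\<^sub>n\<close> is epi.\<close>

definition right_exact_cx :: "nat \<Rightarrow> (nat \<Rightarrow> 'a) \<Rightarrow> (nat \<Rightarrow> 'b) \<Rightarrow> bool" where
  "right_exact_cx n X x \<longleftrightarrow> (\<forall>k\<le>n. x k \<in> Hom C (X k) (X (Suc k))) \<and>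
     (\<forall>k<n. x (Suc k) \<cdot> x k = Zero C (X k) (X (Suc (Suc k)))) \<and>
     (\<forall>k\<le>n. \<forall>T. \<forall>t\<in>Hom C T (X (Suc k)).
        (k < n \<longrightarrow> x (Suc k) \<cdot> t = Zero C T (X (Suc (Suc k)))) \<longrightarrow> lifts (x k) t)"

text \<open>Monicity on the left is kept apart because it may fail for the complexes obtained from
  an extension by deleting its first object; right exactness survives there.\<close>

definition exact_cx :: "nat \<Rightarrow> (nat \<Rightarrow> 'a) \<Rightarrow> (nat \<Rightarrow> 'b) \<Rightarrow> bool" where
  "exact_cx n X x \<longleftrightarrow> right_exact_cx n X x \<and> is_mono C (x 0)"

definition chain_map ::
    "nat \<Rightarrow> (nat \<Rightarrow> 'a) \<Rightarrow> (nat \<Rightarrow> 'b) \<Rightarrow> (nat \<Rightarrow> 'a) \<Rightarrow> (nat \<Rightarrow> 'b) \<Rightarrow> (nat \<Rightarrow> 'b) \<Rightarrow> bool" where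
  "chain_map n X x Y y \<phi> \<longleftrightarrow> (\<forall>k\<le>Suc n. \<phi> k \<in> Hom C (X k) (Y k)) \<and>
     (\<forall>k\<le>n. \<phi> (Suc k) \<cdot> x k = y k \<cdot> \<phi> k)"

lemma right_exact_cxD:
  assumes "right_exact_cx n X x"
  shows "k \<le> n \<Longrightarrow> x k \<in> Hom C (X k) (X (Suc k))"
    "k < n \<Longrightarrow> x (Suc k) \<cdot> x k = Zero C (X k) (X (Suc (Suc k)))"
    "\<lbrakk>k \<le> n; t \<in> Hom C T (X (Suc k)); k < n \<Longrightarrow> x (Suc k) \<cdot> t = Zero C T (X (Suc (Suc k)))\<rbrakk> \<Longrightarrow> lifts (x k) t"
  using assms unfolding right_exact_cx_def by blast+

lemma exact_cxD:
  assumes "exact_cx n X x"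
  shows "right_exact_cx n X x" "is_mono C (x 0)"
  using assms unfolding exact_cx_def by blast+

lemma chain_mapD:
  assumes "chain_map n X x Y y \<phi>"
  shows "k \<le> Suc n \<Longrightarrow> \<phi> k \<in> Hom C (X k) (Y k)" "k \<le> n \<Longrightarrow> \<phi> (Suc k) \<cdot> x k = y k \<cdot> \<phi> k"
  using assms unfolding chain_map_def by blast+

lemma chain_map_comp:
  assumes "chain_map n X x Y y \<phi>" "chain_map n Y y Z z \<psi>"
    "\<And>k. k \<le> n \<Longrightarrow> x k \<in> Hom C (X k) (X (Suc k))" "\<And>k. k \<le> n \<Longrightarrow> y k \<in> Hom C (Y k) (Y (Suc k))"
    "\<And>k. k \<le> n \<Longrightarrow> z k \<in> Hom C (Z k) (Z (Suc k))"
  shows "chain_map n X x Z z (\<lambda>k. \<psi> k \<cdot> \<phi> k)"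
  unfolding chain_map_def
proof (intro conjI allI impI)
  fix k assume "k \<le> Suc n"
  then show "\<psi> k \<cdot> \<phi> k \<in> Hom C (X k) (Z k)" using assms(1,2) by (blast intro: Comp_Hom chain_mapD)
next
  fix k assume k: "k \<le> n"
  then have k': "k \<le> Suc n" "Suc k \<le> Suc n" by auto
  note a = chain_mapD(1)[OF assms(1) k'(1)] chain_mapD(1)[OF assms(1) k'(2)]
    and b = chain_mapD(1)[OF assms(2) k'(1)] chain_mapD(1)[OF assms(2) k'(2)]
  have "(\<psi> (Suc k) \<cdot> \<phi> (Suc k)) \<cdot> x k = \<psi> (Suc k) \<cdot> (\<phi> (Suc k) \<cdot> x k)"
    by (rule Comp_assoc[OF assms(3)[OF k] a(2) b(2)])
  also have "\<dots> = \<psi> (Suc k) \<cdot> (y k \<cdot> \<phi> k)" using chain_mapD(2)[OF assms(1) k] by simp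
  also have "\<dots> = z k \<cdot> (\<psi> k \<cdot> \<phi> k)"
    by (rule Comp_eq_Comp[OF chain_mapD(2)[OF assms(2) k] assms(4)[OF k] b(2,1) assms(5)[OF k] a(1)])
  finally show "(\<psi> (Suc k) \<cdot> \<phi> (Suc k)) \<cdot> x k = z k \<cdot> (\<psi> k \<cdot> \<phi> k)" .
qed

text \<open>One degree of the exactness of a fibre product. The components of \<open>t\<close> lift
  separately to \<open>F\<close> and \<open>X\<close>, but the images of these lifts in
  \<open>Y\<close> agree only after \<open>y\<close>. Assumption \<open>star\<close> corrects the
  lifts, without changing what they map to under \<open>f\<close> and \<open>x\<close>, until they
  agree in \<open>Y\<close> and so define an element of the pullback.\<close>

lemma fiber_product_lift:
  assumes f: "f \<in> Hom C F F'" and x: "x \<in> Hom C X X'"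
    and \<phi>: "\<phi> \<in> Hom C F Y" and \<psi>: "\<psi> \<in> Hom C X Y" and \<phi>': "\<phi>' \<in> Hom C F' Y'" and \<psi>': "\<psi>' \<in> Hom C X' Y'"
    and y: "y \<in> Hom C Y Y'"
    and sq: "\<phi>' \<cdot> f = y \<cdot> \<phi>" "\<psi>' \<cdot> x = y \<cdot> \<psi>"
    and pb: "is_pullback C \<phi> \<psi> p q" and pb': "is_pullback C \<phi>' \<psi>' p' q'"
    and h: "h \<in> Hom C (Dom C p) (Dom C p')" "p' \<cdot> h = f \<cdot> p" "q' \<cdot> h = x \<cdot> q"
    and t: "t \<in> Hom C T (Dom C p')" "lifts f (p' \<cdot> t)" "lifts x (q' \<cdot> t)"
    and star: "\<And>T f' x'. \<lbrakk>f' \<in> Hom C T F; x' \<in> Hom C T X; y \<cdot> (\<phi> \<cdot> f') = y \<cdot> (\<psi> \<cdot> x')\<rbrakk> \<Longrightarrow>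
       \<exists>T' e f'' x''. is_epi C e \<and> e \<in> Hom C T' T \<and> f'' \<in> Hom C T' F \<and> x'' \<in> Hom C T' X \<and>
         f \<cdot> f'' = f \<cdot> (f' \<cdot> e) \<and> x \<cdot> x'' = x \<cdot> (x' \<cdot> e) \<and> \<phi> \<cdot> f'' = \<psi> \<cdot> x''"
  shows "lifts h t"
proof -
  obtain P where P: "p \<in> Hom C P F" "q \<in> Hom C P X" "P = Dom C p"
    "\<And>T a b. \<lbrakk>a \<in> Hom C T F; b \<in> Hom C T X; \<phi> \<cdot> a = \<psi> \<cdot> b\<rbrakk> \<Longrightarrow> \<exists>w. w \<in> Hom C T P \<and> p \<cdot> w = a \<and> q \<cdot> w = b"
    by (rule pullbackD[OF pb \<phi> \<psi>]) (rule that; blast)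
  obtain P' where P': "p' \<in> Hom C P' F'" "q' \<in> Hom C P' X'" "\<phi>' \<cdot> p' = \<psi>' \<cdot> q'" "P' = Dom C p'"
    "\<And>T w w'. \<lbrakk>w \<in> Hom C T P'; w' \<in> Hom C T P'; p' \<cdot> w = p' \<cdot> w'; q' \<cdot> w = q' \<cdot> w'\<rbrakk> \<Longrightarrow> w = w'"
    by (rule pullbackD[OF pb' \<phi>' \<psi>']) (rule that; blast)
  have tP: "t \<in> Hom C T P'" and hP: "h \<in> Hom C P P'" using t h P P' by auto
  have pt: "p' \<cdot> t \<in> Hom C T F'" "q' \<cdot> t \<in> Hom C T X'" using tP P' Comp_Hom by auto
  obtain T1 e1 a where a: "is_epi C e1" "e1 \<in> Hom C T1 T" "a \<in> Hom C T1 F" "f \<cdot> a = (p' \<cdot> t) \<cdot> e1"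
    by (rule liftsE[OF t(2) pt(1) f])
  have te: "(q' \<cdot> t) \<cdot> e1 \<in> Hom C T1 X'" using pt a Comp_Hom by blast
  obtain T2 e2 b where b: "is_epi C e2" "e2 \<in> Hom C T2 T1" "b \<in> Hom C T2 X" "x \<cdot> b = ((q' \<cdot> t) \<cdot> e1) \<cdot> e2"
    by (rule liftsE[OF lifts_comp[OF t(3) x pt(2) a(2)] te x])
  have ab: "a \<cdot> e2 \<in> Hom C T2 F" using a b Comp_Hom by blast
  have e12: "t \<cdot> (e1 \<cdot> e2) \<in> Hom C T2 P'" using a b tP by (simp add: Hom_def)
  have fa: "f \<cdot> (a \<cdot> e2) = p' \<cdot> (t \<cdot> (e1 \<cdot> e2))"
    using Comp_eq_Comp[OF a(4,3) f a(2) pt(1) b(2)] P' tP a b by (simp add: Hom_def)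
  have xb: "x \<cdot> b = q' \<cdot> (t \<cdot> (e1 \<cdot> e2))"
    using b(4) P' tP a(2) b(2) by (simp add: Hom_def)
  \<comment> \<open>The lifts agree after \<open>y\<close> because \<open>t\<close> is an element of
    the pullback \<open>P'\<close>, whose two projections coincide in \<open>Y'\<close>.\<close>
  have "y \<cdot> (\<phi> \<cdot> (a \<cdot> e2)) = \<phi>' \<cdot> (f \<cdot> (a \<cdot> e2))"
    using Comp_eq_Comp[OF sq(1) f \<phi>' \<phi> y ab] by simp
  also have "\<dots> = \<psi>' \<cdot> (x \<cdot> b)" unfolding fa xb
    by (rule Comp_eq_Comp[OF P'(3,1) \<phi>' P'(2) \<psi>' e12])
  also have "\<dots> = y \<cdot> (\<psi> \<cdot> b)" by (rule Comp_eq_Comp[OF sq(2) x \<psi>' \<psi> y b(3)])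
  finally have "y \<cdot> (\<phi> \<cdot> (a \<cdot> e2)) = y \<cdot> (\<psi> \<cdot> b)" .
  from star[OF ab b(3) this] obtain T3 e3 a' b' where c: "is_epi C e3" "e3 \<in> Hom C T3 T2" "a' \<in> Hom C T3 F"
    "b' \<in> Hom C T3 X" "f \<cdot> a' = f \<cdot> ((a \<cdot> e2) \<cdot> e3)" "x \<cdot> b' = x \<cdot> (b \<cdot> e3)" "\<phi> \<cdot> a' = \<psi> \<cdot> b'"
    by blast
  from P(4)[OF c(3,4,7)] obtain w where w: "w \<in> Hom C T3 P" "p \<cdot> w = a'" "q \<cdot> w = b'" by blast
  let ?e = "e1 \<cdot> (e2 \<cdot> e3)"
  have e: "?e \<in> Hom C T3 T" using a b c by (simp add: Hom_def)
  have epi: "is_epi C ?e"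
    using a(1,2) b(1,2) c(1,2) by (intro is_epi_comp) (simp_all add: Hom_def)
  have "h \<cdot> w = t \<cdot> ?e"
  proof (rule P'(5))
    show "h \<cdot> w \<in> Hom C T3 P'" "t \<cdot> ?e \<in> Hom C T3 P'" using hP w e tP Comp_Hom by blast+
    have "p' \<cdot> (h \<cdot> w) = f \<cdot> a'" using Comp_eq_Comp[OF h(2) hP P'(1) P(1) f w(1)] w by simp
    also have "\<dots> = (f \<cdot> (a \<cdot> e2)) \<cdot> e3" using c f ab by (simp add: Hom_def)
    also have "\<dots> = p' \<cdot> (t \<cdot> ?e)" unfolding fa using P'(1) tP a(2) b(2) c(2) by (simp add: Hom_def)
    finally show "p' \<cdot> (h \<cdot> w) = p' \<cdot> (t \<cdot> ?e)" .
    have "q' \<cdot> (h \<cdot> w) = x \<cdot> b'" using Comp_eq_Comp[OF h(3) hP P'(2) P(2) x w(1)] w by simp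
    also have "\<dots> = (x \<cdot> b) \<cdot> e3" using c x b(3) by (simp add: Hom_def)
    also have "\<dots> = q' \<cdot> (t \<cdot> ?e)" unfolding xb using P'(2) tP a(2) b(2) c(2) by (simp add: Hom_def)
    finally show "q' \<cdot> (h \<cdot> w) = q' \<cdot> (t \<cdot> ?e)" .
  qed
  then show ?thesis using liftsI[OF epi e w(1) _ tP hP] by simp
qed

text \<open>\<open>star\<close> is the correction that \<open>fiber_product_lift\<close> needs in
  each degree. \<open>jm\<close> stands in for monicity of \<open>x 0\<close>: an arrow killed by
  the first arrow of the fibre product has zero component in \<open>F\<close>, as \<open>f 0\<close>
  is mono, so its component in \<open>X\<close> is killed by both \<open>x 0\<close> and
  \<open>\<psi> 0\<close>.\<close>

lemma fiber_product_exact: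
  assumes F: "exact_cx n F f" and X: "right_exact_cx n X x"
    and y: "\<And>k. k \<le> n \<Longrightarrow> y k \<in> Hom C (Y k) (Y (Suc k))"
    and \<phi>: "chain_map n F f Y y \<phi>" and \<psi>: "chain_map n X x Y y \<psi>"
    and pb: "\<And>k. k \<le> Suc n \<Longrightarrow> is_pullback C (\<phi> k) (\<psi> k) (p k) (q k)"
    and star: "\<And>k T f' x'. \<lbrakk>k \<le> n; f' \<in> Hom C T (F k); x' \<in> Hom C T (X k);
         y k \<cdot> (\<phi> k \<cdot> f') = y k \<cdot> (\<psi> k \<cdot> x')\<rbrakk> \<Longrightarrow>
       \<exists>T' e f'' x''. is_epi C e \<and> e \<in> Hom C T' T \<and> f'' \<in> Hom C T' (F k) \<and> x'' \<in> Hom C T' (X k) \<and>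
         f k \<cdot> f'' = f k \<cdot> (f' \<cdot> e) \<and> x k \<cdot> x'' = x k \<cdot> (x' \<cdot> e) \<and> \<phi> k \<cdot> f'' = \<psi> k \<cdot> x''"
    and jm: "\<And>T v. \<lbrakk>v \<in> Hom C T (X 0); x 0 \<cdot> v = Zero C T (X 1); \<psi> 0 \<cdot> v = Zero C T (Y 0)\<rbrakk> \<Longrightarrow> v = Zero C T (X 0)"
  shows "\<exists>h. exact_cx n (\<lambda>k. Dom C (p k)) h \<and> chain_map n (\<lambda>k. Dom C (p k)) h F f p \<and>
     chain_map n (\<lambda>k. Dom C (p k)) h X x q"
proof -
  let ?P = "\<lambda>k. Dom C (p k)"
  note Fr = exact_cxD(1)[OF F]
  note fH = right_exact_cxD(1)[OF Fr] and xH = right_exact_cxD(1)[OF X]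
  note \<phi>H = chain_mapD(1)[OF \<phi>] and \<psi>H = chain_mapD(1)[OF \<psi>]
  have pq: "p k \<in> Hom C (?P k) (F k)" "q k \<in> Hom C (?P k) (X k)" "\<phi> k \<cdot> p k = \<psi> k \<cdot> q k" if "k \<le> Suc n" for k
    by (rule pullbackD[OF pb[OF that] \<phi>H[OF that] \<psi>H[OF that]]; simp)+
  have univ: "\<exists>w. w \<in> Hom C T (?P k) \<and> p k \<cdot> w = a \<and> q k \<cdot> w = b"
    if "k \<le> Suc n" "a \<in> Hom C T (F k)" "b \<in> Hom C T (X k)" "\<phi> k \<cdot> a = \<psi> k \<cdot> b" for k T a b
    by (rule pullbackD[OF pb[OF that(1)] \<phi>H[OF that(1)] \<psi>H[OF that(1)]]) (use that(2-) in blast)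
  have jmono: "w = w'"
    if "k \<le> Suc n" "w \<in> Hom C T (?P k)" "w' \<in> Hom C T (?P k)" "p k \<cdot> w = p k \<cdot> w'" "q k \<cdot> w = q k \<cdot> w'" for k T w w'
    by (rule pullbackD[OF pb[OF that(1)] \<phi>H[OF that(1)] \<psi>H[OF that(1)]]) (use that(2-) in blast)
  have "\<exists>w. w \<in> Hom C (?P k) (?P (Suc k)) \<and> p (Suc k) \<cdot> w = f k \<cdot> p k \<and> q (Suc k) \<cdot> w = x k \<cdot> q k"
    if k: "k \<le> n" for k
  proof (rule univ)
    have k': "k \<le> Suc n" "Suc k \<le> Suc n" using k by auto
    show "Suc k \<le> Suc n" by (rule k')
    show "f k \<cdot> p k \<in> Hom C (?P k) (F (Suc k))" "x k \<cdot> q k \<in> Hom C (?P k) (X (Suc k))"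
      using Comp_Hom pq k' fH[OF k] xH[OF k] by blast+
    have "\<phi> (Suc k) \<cdot> (f k \<cdot> p k) = y k \<cdot> (\<phi> k \<cdot> p k)"
      using Comp_eq_Comp[OF chain_mapD(2)[OF \<phi> k] fH[OF k] \<phi>H[OF k'(2)] \<phi>H[OF k'(1)] y[OF k] pq(1)[OF k'(1)]] .
    also have "\<dots> = \<psi> (Suc k) \<cdot> (x k \<cdot> q k)"
      using Comp_eq_Comp[OF chain_mapD(2)[OF \<psi> k] xH[OF k] \<psi>H[OF k'(2)] \<psi>H[OF k'(1)] y[OF k] pq(2)[OF k'(1)]]
        pq(3)[OF k'(1)] by simp
    finally show "\<phi> (Suc k) \<cdot> (f k \<cdot> p k) = \<psi> (Suc k) \<cdot> (x k \<cdot> q k)" .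
  qed
  then have "\<exists>h. \<forall>k\<le>n. h k \<in> Hom C (?P k) (?P (Suc k)) \<and> p (Suc k) \<cdot> h k = f k \<cdot> p k \<and> q (Suc k) \<cdot> h k = x k \<cdot> q k"
    by (intro choice) blast
  then obtain h where h: "\<And>k. k \<le> n \<Longrightarrow> h k \<in> Hom C (?P k) (?P (Suc k))"
    "\<And>k. k \<le> n \<Longrightarrow> p (Suc k) \<cdot> h k = f k \<cdot> p k" "\<And>k. k \<le> n \<Longrightarrow> q (Suc k) \<cdot> h k = x k \<cdot> q k"
    by blast
  have PO: "?P k \<in> Ob C" if "k \<le> Suc n" for k using Hom_Ob(1)[OF pq(1)[OF that]] .
  have jzero: "w = Zero C T (?P k)"
    if "k \<le> Suc n" "w \<in> Hom C T (?P k)" "p k \<cdot> w = Zero C T (F k)" "q k \<cdot> w = Zero C T (X k)" for k T w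
  proof (rule jmono[OF that(1,2)])
    have TO: "T \<in> Ob C" using Hom_Ob that(2) by blast
    show "Zero C T (?P k) \<in> Hom C T (?P k)" using Zero_Hom TO PO that by blast
    show "p k \<cdot> w = p k \<cdot> Zero C T (?P k)" "q k \<cdot> w = q k \<cdot> Zero C T (?P k)"
      using that(3,4) pq[OF that(1)] TO by (simp_all add: Hom_def)
  qed
  have "right_exact_cx n ?P h"
    unfolding right_exact_cx_def
  proof (intro conjI allI impI ballI)
    fix k assume "k \<le> n" then show "h k \<in> Hom C (?P k) (?P (Suc k))" by (rule h)
  next
    fix k assume k: "k < n"
    then have k': "k \<le> n" "Suc k \<le> n" "k \<le> Suc n" "Suc k \<le> Suc n" "Suc (Suc k) \<le> Suc n" by auto
    note O = PO[OF k'(3)] Hom_Ob[OF fH[OF k'(2)]] Hom_Ob[OF xH[OF k'(2)]]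
    show "h (Suc k) \<cdot> h k = Zero C (?P k) (?P (Suc (Suc k)))"
    proof (rule jzero[OF k'(5)])
      show "h (Suc k) \<cdot> h k \<in> Hom C (?P k) (?P (Suc (Suc k)))" using h(1) k' Comp_Hom by blast
      have "p (Suc (Suc k)) \<cdot> (h (Suc k) \<cdot> h k) = f (Suc k) \<cdot> (f k \<cdot> p k)"
        using Comp_eq_Comp[OF h(2)[OF k'(2)] h(1)[OF k'(2)] pq(1)[OF k'(5)] pq(1)[OF k'(4)] fH[OF k'(2)] h(1)[OF k'(1)]]
          h(2)[OF k'(1)] by simp
      also have "\<dots> = Zero C (?P k) (F (Suc (Suc k)))"
        using Comp_eq_Comp'[OF right_exact_cxD(2)[OF Fr k] fH[OF k'(1)] fH[OF k'(2)] pq(1)[OF k'(3)]] O pq(1)[OF k'(3)]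
        by (simp add: Hom_def)
      finally show "p (Suc (Suc k)) \<cdot> (h (Suc k) \<cdot> h k) = Zero C (?P k) (F (Suc (Suc k)))" .
      have "q (Suc (Suc k)) \<cdot> (h (Suc k) \<cdot> h k) = x (Suc k) \<cdot> (x k \<cdot> q k)"
        using Comp_eq_Comp[OF h(3)[OF k'(2)] h(1)[OF k'(2)] pq(2)[OF k'(5)] pq(2)[OF k'(4)] xH[OF k'(2)] h(1)[OF k'(1)]]
          h(3)[OF k'(1)] by simp
      also have "\<dots> = Zero C (?P k) (X (Suc (Suc k)))"
        using Comp_eq_Comp'[OF right_exact_cxD(2)[OF X k] xH[OF k'(1)] xH[OF k'(2)] pq(2)[OF k'(3)]] O pq(2)[OF k'(3)]
        by (simp add: Hom_def)
      finally show "q (Suc (Suc k)) \<cdot> (h (Suc k) \<cdot> h k) = Zero C (?P k) (X (Suc (Suc k)))" .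
    qed
  next
    fix k T t assume k: "k \<le> n" and t: "t \<in> Hom C T (?P (Suc k))"
      and t0: "k < n \<longrightarrow> h (Suc k) \<cdot> t = Zero C T (?P (Suc (Suc k)))"
    have k': "k \<le> Suc n" "Suc k \<le> Suc n" using k by auto
    have lf: "lifts (f k) (p (Suc k) \<cdot> t)"
    proof (rule right_exact_cxD(3)[OF Fr k Comp_Hom[OF t pq(1)[OF k'(2)]]])
      assume "k < n"
      then have k2: "Suc k \<le> n" "Suc (Suc k) \<le> Suc n" by auto
      show "f (Suc k) \<cdot> (p (Suc k) \<cdot> t) = Zero C T (F (Suc (Suc k)))"
        using Comp_eq_Comp[OF h(2)[OF k2(1)] h(1)[OF k2(1)] pq(1)[OF k2(2)] pq(1)[OF k'(2)] fH[OF k2(1)] t]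
          t0 \<open>k < n\<close> pq(1)[OF k2(2)] Hom_Ob[OF t] by (simp add: Hom_def)
    qed
    have lx: "lifts (x k) (q (Suc k) \<cdot> t)"
    proof (rule right_exact_cxD(3)[OF X k Comp_Hom[OF t pq(2)[OF k'(2)]]])
      assume "k < n"
      then have k2: "Suc k \<le> n" "Suc (Suc k) \<le> Suc n" by auto
      show "x (Suc k) \<cdot> (q (Suc k) \<cdot> t) = Zero C T (X (Suc (Suc k)))"
        using Comp_eq_Comp[OF h(3)[OF k2(1)] h(1)[OF k2(1)] pq(2)[OF k2(2)] pq(2)[OF k'(2)] xH[OF k2(1)] t]
          t0 \<open>k < n\<close> pq(2)[OF k2(2)] Hom_Ob[OF t] by (simp add: Hom_def)
    qed
    show "lifts (h k) t"
      by (rule fiber_product_lift[OF fH[OF k] xH[OF k] \<phi>H[OF k'(1)] \<psi>H[OF k'(1)] \<phi>H[OF k'(2)] \<psi>H[OF k'(2)] y[OF k]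
            chain_mapD(2)[OF \<phi> k] chain_mapD(2)[OF \<psi> k] pb[OF k'(1)] pb[OF k'(2)] h(1)[OF k] h(2)[OF k] h(3)[OF k]
            t lf lx star[OF k]])
  qed
  moreover have "is_mono C (h 0)"
  proof (rule mono_zeroI[OF h(1)[of 0]])
    fix T t assume t: "t \<in> Hom C T (?P 0)" "h 0 \<cdot> t = Zero C T (?P (Suc 0))"
    note O = Hom_Ob[OF t(1)]
    have z: "(0::nat) \<le> n" "(0::nat) \<le> Suc n" "Suc 0 \<le> Suc n" by auto
    note O' = Hom_Ob[OF \<phi>H[OF z(2)]]
    have pt: "p 0 \<cdot> t \<in> Hom C T (F 0)" "q 0 \<cdot> t \<in> Hom C T (X 0)" using t pq z Comp_Hom by blast+
    have "f 0 \<cdot> (p 0 \<cdot> t) = Zero C T (F (Suc 0))"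
      using Comp_eq_Comp[OF h(2)[OF z(1)] h(1)[OF z(1)] pq(1)[OF z(3)] pq(1)[OF z(2)] fH[OF z(1)] t(1)]
        t(2) pq(1)[OF z(3)] O by (simp add: Hom_def)
    then have p0: "p 0 \<cdot> t = Zero C T (F 0)" using mono_zeroD[OF exact_cxD(2)[OF F] fH[OF z(1)] pt(1)] by simp
    have "x 0 \<cdot> (q 0 \<cdot> t) = Zero C T (X (Suc 0))"
      using Comp_eq_Comp[OF h(3)[OF z(1)] h(1)[OF z(1)] pq(2)[OF z(3)] pq(2)[OF z(2)] xH[OF z(1)] t(1)]
        t(2) pq(2)[OF z(3)] O by (simp add: Hom_def)
    moreover have "\<psi> 0 \<cdot> (q 0 \<cdot> t) = Zero C T (Y 0)"
      using Comp_eq_Comp[OF pq(3)[OF z(2)] pq(1)[OF z(2)] \<phi>H[OF z(2)] pq(2)[OF z(2)] \<psi>H[OF z(2)] t(1)]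
        p0 \<phi>H[OF z(2)] O O' by (simp add: Hom_def)
    ultimately have "q 0 \<cdot> t = Zero C T (X 0)" using jm[OF pt(2)] by simp
    then show "t = Zero C T (?P 0)" using jzero[OF z(2) t(1) p0] by simp
  qed simp
  moreover have "chain_map n ?P h F f p" "chain_map n ?P h X x q"
    unfolding chain_map_def using pq h by auto
  ultimately show ?thesis unfolding exact_cx_def by blast
qed

section \<open>Null objects, direct sums and contractible complexes\<close>

lemma zero_object_Hom:
  assumes "is_zero_object C Z"
  shows "Z \<in> Ob C" "f \<in> Hom C X Z \<Longrightarrow> f = Zero C X Z" "f \<in> Hom C Z X \<Longrightarrow> f = Zero C Z X"
proof -
  show Z: "Z \<in> Ob C" using assms by (simp add: is_zero_object_def)
  { assume f: "f \<in> Hom C X Z"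
    then have X: "X \<in> Ob C" using Hom_Ob by blast
    then have "\<exists>!f. f \<in> Hom C X Z" using assms unfolding is_zero_object_def by blast
    then show "f = Zero C X Z" using f Zero_Hom[OF X Z] by auto }
  { assume f: "f \<in> Hom C Z X"
    then have X: "X \<in> Ob C" using Hom_Ob by blast
    then have "\<exists>!f. f \<in> Hom C Z X" using assms unfolding is_zero_object_def by blast
    then show "f = Zero C Z X" using f Zero_Hom[OF Z X] by auto }
qed

text \<open>Nullity is expressed by \<open>Id C Z = Zero C Z Z\<close> because this form passes to
  biproducts by computation.\<close>

lemma into_null:
  assumes "Id C Z = Zero C Z Z" "f \<in> Hom C X Z"
  shows "f = Zero C X Z"
proof -
  have "f = Id C Z \<cdot> f" using Id_Comp[OF assms(2)] by simp
  also have "\<dots> = Zero C X Z" unfolding assms(1) using assms(2) Hom_Ob[OF assms(2)] by (simp add: Hom_def)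
  finally show ?thesis .
qed

lemma biproduct_null:
  assumes "is_biproduct C A B P i j p q" "Id C A = Zero C A A" "Id C B = Zero C B B"
  shows "Id C P = Zero C P P"
proof -
  note b = biproduct_simps[OF assms(1)]
  note O = Hom_Ob[OF b(1)] Hom_Ob[OF b(2)]
  have p: "p = Zero C P A" and q: "q = Zero C P B"
    using into_null[OF assms(2) b(3)] into_null[OF assms(3) b(4)] by simp_all
  have "Add C (i \<cdot> p) (j \<cdot> q) = Zero C P P"
    unfolding p q using b(1,2) O Hom_Ob(2)[OF b(1)] by (simp add: Hom_def)
  then show ?thesis using b(9) by simp
qed

text \<open>The direct sum is the fibre product over the zero complex. Since \<open>G\<close> is
  null at both ends, the pullbacks there may be chosen to be the objects of \<open>F\<close>
  themselves, so the ends are equal, and not merely isomorphic, to those of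
  \<open>F\<close>.\<close>

lemma direct_sum_exact:
  assumes F: "exact_cx n F f" and G: "exact_cx n G g"
    and nz: "Id C (G 0) = Zero C (G 0) (G 0)" "Id C (G (Suc n)) = Zero C (G (Suc n)) (G (Suc n))"
  shows "\<exists>S s p q. exact_cx n S s \<and> S 0 = F 0 \<and> S (Suc n) = F (Suc n) \<and>
    chain_map n S s F f p \<and> p 0 = Id C (F 0) \<and> p (Suc n) = Id C (F (Suc n)) \<and> chain_map n S s G g q \<and>
    (\<forall>k\<le>Suc n. \<forall>T. \<forall>a\<in>Hom C T (F k). \<forall>b\<in>Hom C T (G k). \<exists>w\<in>Hom C T (S k). p k \<cdot> w = a \<and> q k \<cdot> w = b)"
proof -
  obtain Z where Z: "is_zero_object C Z" using ex_zero_object by blast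
  note ZH = zero_object_Hom[OF Z]
  note Fr = exact_cxD(1)[OF F] and Gr = exact_cxD(1)[OF G]
  note fH = right_exact_cxD(1)[OF Fr] and gH = right_exact_cxD(1)[OF Gr]
  have FO: "F k \<in> Ob C" "G k \<in> Ob C" if "k \<le> Suc n" for k
    using that Hom_Ob[OF fH[of "k - 1"]] Hom_Ob[OF gH[of "k - 1"]] Hom_Ob[OF fH[of 0]] Hom_Ob[OF gH[of 0]]
    by (cases k; simp)+
  have pbI: "is_pullback C (Zero C (F k) Z) (Zero C (G k) Z) (Id C (F k)) (Zero C (F k) (G k))"
    if k: "k \<le> Suc n" and null: "Id C (G k) = Zero C (G k) (G k)" for k
  proof (rule pullbackI[where D=Z])
    fix T x y assume xy: "x \<in> Hom C T (F k)" "y \<in> Hom C T (G k)"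
    have "y = Zero C T (G k)" by (rule into_null[OF null xy(2)])
    then show "\<exists>w. w \<in> Hom C T (F k) \<and> Id C (F k) \<cdot> w = x \<and> Zero C (F k) (G k) \<cdot> w = y"
      using xy FO[OF k] by (intro exI[of _ x]) (auto simp: Hom_def)
  next
    fix T w assume "w \<in> Hom C T (F k)" "Id C (F k) \<cdot> w = Zero C T (F k)"
    then show "w = Zero C T (F k)" by (simp add: Hom_def)
  qed (use FO[OF k] ZH(1) in \<open>simp_all add: Zero_Hom Id_Hom Id_Comp'\<close>)
  have "\<exists>p q. is_pullback C (Zero C (F k) Z) (Zero C (G k) Z) p q \<and>
      ((k = 0 \<or> k = Suc n) \<longrightarrow> p = Id C (F k))" if k: "k \<le> Suc n" for k
  proof (cases "k = 0 \<or> k = Suc n")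
    case True
    then show ?thesis using pbI nz k by blast
  next
    case False
    then show ?thesis using ex_pullback[OF Zero_Hom[OF FO(1)[OF k] ZH(1)] Zero_Hom[OF FO(2)[OF k] ZH(1)]] by blast
  qed
  then have "\<exists>p. \<forall>k\<le>Suc n. \<exists>q. is_pullback C (Zero C (F k) Z) (Zero C (G k) Z) (p k) q \<and>
      ((k = 0 \<or> k = Suc n) \<longrightarrow> p k = Id C (F k))"
    by (intro choice) blast
  then obtain p where "\<forall>k\<le>Suc n. \<exists>q. is_pullback C (Zero C (F k) Z) (Zero C (G k) Z) (p k) q \<and>
      ((k = 0 \<or> k = Suc n) \<longrightarrow> p k = Id C (F k))" by blast
  then have "\<exists>q. \<forall>k\<le>Suc n. is_pullback C (Zero C (F k) Z) (Zero C (G k) Z) (p k) (q k) \<and>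
      ((k = 0 \<or> k = Suc n) \<longrightarrow> p k = Id C (F k))"
    by (intro choice) blast
  then obtain q where pb: "\<And>k. k \<le> Suc n \<Longrightarrow> is_pullback C (Zero C (F k) Z) (Zero C (G k) Z) (p k) (q k)"
    and p0: "p 0 = Id C (F 0)" "p (Suc n) = Id C (F (Suc n))" by blast
  have "\<exists>h. exact_cx n (\<lambda>k. Dom C (p k)) h \<and> chain_map n (\<lambda>k. Dom C (p k)) h F f p \<and>
     chain_map n (\<lambda>k. Dom C (p k)) h G g q"
  proof (rule fiber_product_exact[where Y="\<lambda>_. Z" and y="\<lambda>_. Zero C Z Z", OF F Gr])
    show "chain_map n F f (\<lambda>_. Z) (\<lambda>_. Zero C Z Z) (\<lambda>k. Zero C (F k) Z)"
      unfolding chain_map_def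
    proof (intro conjI allI impI)
      fix k assume "k \<le> Suc n" then show "Zero C (F k) Z \<in> Hom C (F k) Z" using FO ZH(1) Zero_Hom by blast
    next
      fix k assume k: "k \<le> n"
      then show "Zero C (F (Suc k)) Z \<cdot> f k = Zero C Z Z \<cdot> Zero C (F k) Z"
        using fH[OF k] FO[of k] ZH(1) by (simp add: Hom_def)
    qed
    show "chain_map n G g (\<lambda>_. Z) (\<lambda>_. Zero C Z Z) (\<lambda>k. Zero C (G k) Z)"
      unfolding chain_map_def
    proof (intro conjI allI impI)
      fix k assume "k \<le> Suc n" then show "Zero C (G k) Z \<in> Hom C (G k) Z" using FO ZH(1) Zero_Hom by blast
    next
      fix k assume k: "k \<le> n"
      then show "Zero C (G (Suc k)) Z \<cdot> g k = Zero C Z Z \<cdot> Zero C (G k) Z"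
        using gH[OF k] FO[of k] ZH(1) by (simp add: Hom_def)
    qed
  next
    \<comment> \<open>Over the zero complex any two lifts agree, so the correction demanded by
      \<open>fiber_product_exact\<close> is trivial.\<close>
    fix k T f' x' assume k: "k \<le> n" and H: "f' \<in> Hom C T (F k)" "x' \<in> Hom C T (G k)"
    note T = Hom_Ob(1)[OF H(1)]
    have "f k \<cdot> f' = f k \<cdot> (f' \<cdot> Id C T)" "g k \<cdot> x' = g k \<cdot> (x' \<cdot> Id C T)"
      "Zero C (F k) Z \<cdot> f' = Zero C (G k) Z \<cdot> x'"
      using H T FO[of k] k ZH(1) by (simp_all add: Hom_def)
    then show "\<exists>T' e f'' x''. is_epi C e \<and> e \<in> Hom C T' T \<and> f'' \<in> Hom C T' (F k) \<and> x'' \<in> Hom C T' (G k) \<and>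
       f k \<cdot> f'' = f k \<cdot> (f' \<cdot> e) \<and> g k \<cdot> x'' = g k \<cdot> (x' \<cdot> e) \<and> Zero C (F k) Z \<cdot> f'' = Zero C (G k) Z \<cdot> x''"
      using H is_epi_Id[OF T] Id_Hom[OF T] by blast
  next
    fix T v assume "v \<in> Hom C T (G 0)"
    then show "v = Zero C T (G 0)" by (rule into_null[OF nz(1)])
  qed (use ZH(1) Zero_Hom pb in auto)
  then obtain h where h: "exact_cx n (\<lambda>k. Dom C (p k)) h" "chain_map n (\<lambda>k. Dom C (p k)) h F f p"
     "chain_map n (\<lambda>k. Dom C (p k)) h G g q" by blast
  have "\<forall>k\<le>Suc n. \<forall>T. \<forall>a\<in>Hom C T (F k). \<forall>b\<in>Hom C T (G k).
    \<exists>w\<in>Hom C T (Dom C (p k)). p k \<cdot> w = a \<and> q k \<cdot> w = b"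
  proof (intro allI impI ballI)
    fix k T a b assume k: "k \<le> Suc n" and ab: "a \<in> Hom C T (F k)" "b \<in> Hom C T (G k)"
    have eq: "Zero C (F k) Z \<cdot> a = Zero C (G k) Z \<cdot> b" using ab ZH(1) by (simp add: Hom_def)
    show "\<exists>w\<in>Hom C T (Dom C (p k)). p k \<cdot> w = a \<and> q k \<cdot> w = b"
      by (rule pullbackD[OF pb[OF k] Zero_Hom[OF FO(1)[OF k] ZH(1)] Zero_Hom[OF FO(2)[OF k] ZH(1)]])
         (use ab eq in blast)
  qed
  moreover have "Dom C (p 0) = F 0" "Dom C (p (Suc n)) = F (Suc n)" using p0 FO by simp_all
  ultimately show ?thesis using h p0 by (intro exI[of _ "\<lambda>k. Dom C (p k)"] exI[of _ h] exI[of _ p] exI[of _ q]) simp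
qed

text \<open>\<open>G\<close> is the contractible complex with \<open>G\<^sub>k = W\<^sub>k \<oplus> W\<^sub>k\<^sub>-\<^sub>1\<close>, mapped to \<open>Y\<close> by \<open>[w\<^sub>k, y\<^sub>k\<^sub>-\<^sub>1 w\<^sub>k\<^sub>-\<^sub>1]\<close>.\<close>

lemma contractible_cover:
  assumes y: "\<And>k. k \<le> n \<Longrightarrow> y k \<in> Hom C (Y k) (Y (Suc k))"
    and yy: "\<And>k. k < n \<Longrightarrow> y (Suc k) \<cdot> y k = Zero C (Y k) (Y (Suc (Suc k)))"
    and w: "\<And>k. k \<le> Suc n \<Longrightarrow> w k \<in> Hom C (W k) (Y k)"
    and null: "\<And>k. k = 0 \<or> k = n \<or> k = Suc n \<Longrightarrow> Id C (W k) = Zero C (W k) (W k)"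
  shows "\<exists>G g \<theta>. exact_cx n G g \<and> chain_map n G g Y y \<theta> \<and> Id C (G 0) = Zero C (G 0) (G 0) \<and>
    Id C (G (Suc n)) = Zero C (G (Suc n)) (G (Suc n)) \<and>
    (\<forall>k\<le>Suc n. \<exists>i\<in>Hom C (W k) (G k). \<theta> k \<cdot> i = w k) \<and>
    (\<forall>k\<le>n. \<exists>j\<in>Hom C (W k) (G (Suc k)). \<theta> (Suc k) \<cdot> j = y k \<cdot> w k)"
proof -
  obtain Z where Z: "is_zero_object C Z" using ex_zero_object by blast
  note ZH = zero_object_Hom[OF Z]
  \<comment> \<open>\<open>V\<close> is \<open>W\<close> shifted by one place; nothing precedes
    degree 0, so a zero object is put there. Accordingly \<open>v\<close> is the shifted
    \<open>w\<close> followed by an arrow of \<open>Y\<close>.\<close>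
  define V where "V k = (case k of 0 \<Rightarrow> Z | Suc l \<Rightarrow> W l)" for k
  define v where "v k = (case k of 0 \<Rightarrow> Zero C Z (Y 0) | Suc l \<Rightarrow> y l \<cdot> w l)" for k
  have YO: "Y k \<in> Ob C" and WO: "W k \<in> Ob C" if "k \<le> Suc n" for k
    using Hom_Ob[OF w[OF that]] by simp_all
  have VO: "V k \<in> Ob C" if "k \<le> Suc n" for k
    using that WO ZH(1) by (auto simp: V_def split: nat.split)
  have vH: "v k \<in> Hom C (V k) (Y k)" if "k \<le> Suc n" for k
  proof (cases k)
    case 0
    then show ?thesis using Zero_Hom[OF ZH(1) YO[of 0]] by (simp add: V_def v_def)
  next
    case (Suc l)
    then show ?thesis using that Comp_Hom[OF w[of l] y[of l]] by (simp add: V_def v_def)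
  qed
  have yv: "y k \<cdot> v k = Zero C (V k) (Y (Suc k))" if k: "k \<le> n" for k
  proof (cases k)
    case 0
    then show ?thesis using y[of 0] ZH(1) by (simp add: V_def v_def Hom_def)
  next
    case (Suc l)
    then have l: "l \<le> n" "l < n" "Suc l \<le> n" "l \<le> Suc n" using k by auto
    have "y (Suc l) \<cdot> (y l \<cdot> w l) = Zero C (W l) (Y (Suc (Suc l)))"
      using Comp_eq_Comp'[OF yy[OF l(2)] y[OF l(1)] y[OF l(3)] w[OF l(4)]] w[OF l(4)] y[OF l(3)] Hom_Ob[OF y[OF l(3)]]
      by (simp add: Hom_def)
    then show ?thesis using Suc by (simp add: V_def v_def)
  qed
  have "\<forall>k. \<exists>B. k \<le> Suc n \<longrightarrow> (case B of (P, i, j, p, q) \<Rightarrow> is_biproduct C (W k) (V k) P i j p q)"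
    using ex_biproduct WO VO by (simp add: split_paired_Ex)
  then have "\<exists>B. \<forall>k. k \<le> Suc n \<longrightarrow> (case B k of (P, i, j, p, q) \<Rightarrow> is_biproduct C (W k) (V k) P i j p q)"
    by (rule choice)
  then obtain B where B: "\<And>k. k \<le> Suc n \<Longrightarrow> (case B k of (P, i, j, p, q) \<Rightarrow> is_biproduct C (W k) (V k) P i j p q)"
    by blast
  define G where "G k = fst (B k)" for k
  define i where "i k = fst (snd (B k))" for k
  define j where "j k = fst (snd (snd (B k)))" for k
  define p where "p k = fst (snd (snd (snd (B k))))" for k
  define q where "q k = snd (snd (snd (snd (B k))))" for k
  have b: "is_biproduct C (W k) (V k) (G k) (i k) (j k) (p k) (q k)" if "k \<le> Suc n" for k
    using B[OF that] by (simp add: G_def i_def j_def p_def q_def split: prod.splits)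
  note bs = biproduct_simps[OF b]
  have VS [simp]: "V (Suc k) = W k" for k by (simp add: V_def)
  have vS [simp]: "v (Suc k) = y k \<cdot> w k" for k by (simp add: v_def)
  \<comment> \<open>The differential carries the first summand of degree \<open>k\<close>
    identically onto the second summand of degree \<open>k + 1\<close>, which makes every cycle a
    boundary.\<close>
  define g where "g k = j (Suc k) \<cdot> p k" for k
  define \<theta> where "\<theta> k = Add C (w k \<cdot> p k) (v k \<cdot> q k)" for k
  have \<theta>: "\<theta> k \<in> Hom C (G k) (Y k)" "\<theta> k \<cdot> i k = w k" "\<theta> k \<cdot> j k = v k" if "k \<le> Suc n" for k
    using biproduct_copair[OF b[OF that] w[OF that] vH[OF that]] by (simp_all add: \<theta>_def)
  have gH: "g k \<in> Hom C (G k) (G (Suc k))" if "k \<le> n" for k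
    using bs(3)[of k] bs(2)[of "Suc k"] that Comp_Hom unfolding g_def by auto
  have gg: "g (Suc k) \<cdot> g k = Zero C (G k) (G (Suc (Suc k)))" if k: "k < n" for k
  proof -
    have k': "k \<le> Suc n" "Suc k \<le> Suc n" "Suc (Suc k) \<le> Suc n" using k by auto
    note O = Hom_Ob[OF bs(1)[OF k'(1)]] Hom_Ob[OF bs(2)[OF k'(2)]] Hom_Ob[OF bs(2)[OF k'(3)]]
    have "p (Suc k) \<cdot> (j (Suc k) \<cdot> p k) = Zero C (G k) (W (Suc k))"
      using Comp_eq_Comp'[OF bs(7)[OF k'(2)] bs(2)[OF k'(2)] bs(3)[OF k'(2)], of "p k" "G k"]
        bs(3)[OF k'(1)] bs(3)[OF k'(2)] O by (simp add: Hom_def)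
    then show ?thesis unfolding g_def
      using bs(2)[OF k'(3)] bs(3)[OF k'(2)] bs(2)[OF k'(2)] bs(3)[OF k'(1)] O by (simp add: Hom_def)
  qed
  have null0: "Id C (G 0) = Zero C (G 0) (G 0)"
    by (rule biproduct_null[OF b]) (use null ZH Id_Hom[OF ZH(1)] in \<open>auto simp: V_def\<close>)
  \<comment> \<open>Degree \<open>n + 1\<close> is the biproduct of \<open>W (n + 1)\<close> and
    \<open>W n\<close>, which is why nullity is also required at the index \<open>n\<close>.\<close>
  have nulln: "Id C (G (Suc n)) = Zero C (G (Suc n)) (G (Suc n))"
    by (rule biproduct_null[OF b]) (use null in auto)
  have lift: "lifts (g k) t"
    if k: "k \<le> n" and t: "t \<in> Hom C T (G (Suc k))" and t0: "k < n \<longrightarrow> g (Suc k) \<cdot> t = Zero C T (G (Suc (Suc k)))" for k T t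
  proof -
    have k': "k \<le> Suc n" "Suc k \<le> Suc n" using k by auto
    note O = Hom_Ob[OF t] Hom_Ob[OF bs(1)[OF k'(1)]] Hom_Ob[OF bs(2)[OF k'(2)]] WO[OF k'(2)]
    have pt: "p (Suc k) \<cdot> t \<in> Hom C T (W (Suc k))" and qt: "q (Suc k) \<cdot> t \<in> Hom C T (W k)"
      using bs(3,4)[OF k'(2)] t Comp_Hom by auto
    \<comment> \<open>A cycle has no component in the first summand: below the top degree the
      differential is split mono on that summand, and in the top degree the summand is null.\<close>
    have "p (Suc k) \<cdot> t = Zero C T (W (Suc k))"
    proof (cases "k = n")
      case True
      then show ?thesis using into_null[OF null pt] by simp
    next
      case False
      then have k2: "k < n" "Suc (Suc k) \<le> Suc n" using k by auto
      have j: "j (Suc (Suc k)) \<in> Hom C (W (Suc k)) (G (Suc (Suc k)))"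
        and q: "q (Suc (Suc k)) \<in> Hom C (G (Suc (Suc k))) (W (Suc k))"
        and qj: "q (Suc (Suc k)) \<cdot> j (Suc (Suc k)) = Id C (W (Suc k))"
        using bs(2,4,6)[OF k2(2)] by simp_all
      have "p (Suc k) \<cdot> t = q (Suc (Suc k)) \<cdot> (j (Suc (Suc k)) \<cdot> (p (Suc k) \<cdot> t))"
        using Comp_eq_Comp'[OF qj j q pt] pt by (simp add: Hom_def)
      also have "j (Suc (Suc k)) \<cdot> (p (Suc k) \<cdot> t) = Zero C T (G (Suc (Suc k)))"
        using t0 k2(1) j bs(3)[OF k'(2)] t by (simp add: Hom_def g_def)
      also have "q (Suc (Suc k)) \<cdot> \<dots> = Zero C T (W (Suc k))" using q O by (simp add: Hom_def)
      finally show ?thesis .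
    qed
    then have "t = j (Suc k) \<cdot> (q (Suc k) \<cdot> t)"
      using biproduct_expand[OF b[OF k'(2)] t] bs(1,2)[OF k'(2)] qt O by (simp add: Hom_def)
    also have "\<dots> = g k \<cdot> (i k \<cdot> (q (Suc k) \<cdot> t))"
      using Comp_eq_Comp'[OF bs(5,1,3)[OF k'(1)] qt] bs(1,3)[OF k'(1)] bs(2)[OF k'(2)] qt unfolding g_def by (simp add: Hom_def)
    finally have e: "t = g k \<cdot> (i k \<cdot> (q (Suc k) \<cdot> t))" .
    have "lifts (g k) (g k \<cdot> (i k \<cdot> (q (Suc k) \<cdot> t)))"
      by (rule lifts_self[OF gH[OF k] Comp_Hom[OF qt bs(1)[OF k'(1)]]])
    then show ?thesis using e by simp
  qed
  have "is_mono C (g 0)"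
    by (rule mono_zeroI[OF gH[of 0]]) (use into_null[OF null0] in auto)
  then have ex: "exact_cx n G g"
    unfolding exact_cx_def right_exact_cx_def using gH gg lift by blast
  have "\<theta> (Suc k) \<cdot> g k = y k \<cdot> \<theta> k" if k: "k \<le> n" for k
  proof -
    have k': "k \<le> Suc n" "Suc k \<le> Suc n" using k by auto
    have jH: "j (Suc k) \<in> Hom C (W k) (G (Suc k))" using bs(2)[OF k'(2)] by simp
    have "\<theta> (Suc k) \<cdot> g k = (y k \<cdot> w k) \<cdot> p k" unfolding g_def
      using Comp_eq_Comp'[OF \<theta>(3)[OF k'(2)] bs(2)[OF k'(2)] \<theta>(1)[OF k'(2)], of "p k"] bs(3)[OF k'(1)] by simp
    moreover have "y k \<cdot> (v k \<cdot> q k) = Zero C (G k) (Y (Suc k))"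
      using Comp_eq_Comp'[OF yv[OF k] vH[OF k'(1)] y[OF k] bs(4)[OF k'(1)]] bs(4)[OF k'(1)] YO[OF k'(2)]
      by (simp add: Hom_def)
    ultimately show ?thesis unfolding \<theta>_def[of k]
      using y[OF k] w[OF k'(1)] vH[OF k'(1)] bs(3,4)[OF k'(1)] by (simp add: Hom_def)
  qed
  then have cm: "chain_map n G g Y y \<theta>" unfolding chain_map_def using \<theta>(1) by blast
  have "\<forall>k\<le>Suc n. \<exists>i\<in>Hom C (W k) (G k). \<theta> k \<cdot> i = w k" using \<theta>(2) bs(1) by blast
  moreover have "\<forall>k\<le>n. \<exists>j\<in>Hom C (W k) (G (Suc k)). \<theta> (Suc k) \<cdot> j = y k \<cdot> w k"
    using \<theta>(3) bs(2) by (metis Suc_le_mono VS vS)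
  ultimately show ?thesis using ex cm null0 nulln by blast
qed

section \<open>Making a chain map epi in all degrees up to \<open>n\<close>\<close>

lemma split_epi:
  assumes "f \<in> Hom C X Y" "s \<in> Hom C Y X" "f \<cdot> s = Id C Y"
  shows "is_epi C f"
  using epi_if_lifts[OF assms(1)] lifts_self[OF assms(1,2)] assms(3) by simp

lemma right_exact_cx_Ob:
  assumes "right_exact_cx n X x" "k \<le> Suc n"
  shows "X k \<in> Ob C"
  using assms Hom_Ob(2)[OF right_exact_cxD(1)[OF assms(1), of "k - 1"]]
    Hom_Ob(1)[OF right_exact_cxD(1)[OF assms(1), of 0]]
  by (cases k) simp_all

text \<open>An argument of four-lemma type, applied to the generic element of \<open>Y\<close>: lift
  its image in \<open>Y'\<close> along the epi \<open>f\<close>. The error in \<open>Y\<close> lies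
  in the kernel of \<open>y\<close>, so it lifts along \<open>\<phi>\<close> too, and the two lifts
  are added.\<close>

lemma epi_if_kernel_lifts:
  assumes f: "f \<in> Hom C F Y'" and x: "\<phi> \<in> Hom C F Y" and y: "y \<in> Hom C Y Y'" and sq: "f = y \<cdot> \<phi>"
    and z: "\<And>T d. \<lbrakk>d \<in> Hom C T Y; y \<cdot> d = Zero C T Y'\<rbrakk> \<Longrightarrow> lifts \<phi> d" and fe: "is_epi C f"
  shows "is_epi C \<phi>"
proof (rule epi_if_lifts[OF x])
  have YO: "Y \<in> Ob C" using Hom_Ob x by blast
  obtain T e a where a: "is_epi C e" "e \<in> Hom C T Y" "a \<in> Hom C T F" "f \<cdot> a = y \<cdot> e"
    by (rule liftsE[OF lifts_epi[OF fe f y] y f])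
  have d: "sub e (\<phi> \<cdot> a) \<in> Hom C T Y" using a x by (simp add: Hom_def)
  have "y \<cdot> sub e (\<phi> \<cdot> a) = Zero C T Y'" using a x y sq by (simp add: Hom_def)
  from liftsE[OF z[OF d this] d x] obtain T' e' b where
    b: "is_epi C e'" "e' \<in> Hom C T' T" "b \<in> Hom C T' F" "\<phi> \<cdot> b = sub e (\<phi> \<cdot> a) \<cdot> e'" .
  show "lifts \<phi> (Id C Y)"
  proof (rule liftsI[OF _ _ _ _ Id_Hom[OF YO] x])
    show "is_epi C (e \<cdot> e')" using is_epi_comp[OF b(1) a(1)] a b by (simp add: Hom_def)
    show "e \<cdot> e' \<in> Hom C T' Y" using a b by (simp add: Hom_def)
    show "Add C (a \<cdot> e') b \<in> Hom C T' F" using a b by (simp add: Hom_def)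
    have "\<phi> \<cdot> Add C (a \<cdot> e') b = Add C ((\<phi> \<cdot> a) \<cdot> e') (\<phi> \<cdot> b)" using a b(2,3) x by (simp add: Hom_def)
    also have "\<dots> = Add C (\<phi> \<cdot> a) (sub e (\<phi> \<cdot> a)) \<cdot> e'" unfolding b(4)
      using a b(2) x by (simp add: Hom_def)
    also have "\<dots> = e \<cdot> e'" using Add_sub_cancel[OF a(2) Comp_Hom[OF a(3) x]] by simp
    finally show "\<phi> \<cdot> Add C (a \<cdot> e') b = Id C Y \<cdot> (e \<cdot> e')" using a b by (simp add: Hom_def)
  qed
qed

text \<open>For each \<open>k\<close> strictly between 0 and \<open>n\<close> a copy of
  \<open>Y k\<close> is added in degrees \<open>k\<close> and \<open>k + 1\<close>. Degree 0 is epi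
  by assumption, the degrees in between contain a split copy of \<open>Y k\<close>, and degree
  \<open>n\<close> follows from \<open>epi_if_kernel_lifts\<close> because both complexes have the
  same right end.\<close>

lemma enlarge_to_epi:
  assumes F: "exact_cx n F f" and Y: "right_exact_cx n Y y" and \<phi>: "chain_map n F f Y y \<phi>"
    and epi: "is_epi C (\<phi> 0)" and n: "n \<ge> 1" and FY: "F (Suc n) = Y (Suc n)" "\<phi> (Suc n) = Id C (Y (Suc n))"
  shows "\<exists>S s \<pi> \<phi>'. exact_cx n S s \<and> S 0 = F 0 \<and> S (Suc n) = F (Suc n) \<and> chain_map n S s F f \<pi> \<and>
    \<pi> 0 = Id C (F 0) \<and> \<pi> (Suc n) = Id C (F (Suc n)) \<and> chain_map n S s Y y \<phi>' \<and> \<phi>' 0 = \<phi> 0 \<and>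
    \<phi>' (Suc n) = Id C (Y (Suc n)) \<and> (\<forall>k\<le>n. is_epi C (\<phi>' k))"
proof -
  obtain Z where Z: "is_zero_object C Z" using ex_zero_object by blast
  note ZH = zero_object_Hom[OF Z]
  note Fr = exact_cxD(1)[OF F]
  note yH = right_exact_cxD(1)[OF Y] and fH = right_exact_cxD(1)[OF Fr] and \<phi>H = chain_mapD(1)[OF \<phi>]
  note FO = right_exact_cx_Ob[OF Fr] and YO = right_exact_cx_Ob[OF Y]
  \<comment> \<open>A copy of \<open>Y 0\<close> would change the left end, and a copy of
    \<open>Y n\<close> would reappear in degree \<open>n + 1\<close> and change the right end; hence
    the bounds on \<open>k\<close>.\<close>
  define W where "W k = (if 1 \<le> k \<and> k < n then Y k else Z)" for k
  define w where "w k = (if 1 \<le> k \<and> k < n then Id C (Y k) else Zero C Z (Y k))" for k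
  have wH: "w k \<in> Hom C (W k) (Y k)" if "k \<le> Suc n" for k
    using YO[OF that] ZH(1) Id_Hom Zero_Hom by (simp add: w_def W_def)
  have "\<exists>G g \<theta>. exact_cx n G g \<and> chain_map n G g Y y \<theta> \<and> Id C (G 0) = Zero C (G 0) (G 0) \<and>
    Id C (G (Suc n)) = Zero C (G (Suc n)) (G (Suc n)) \<and>
    (\<forall>k\<le>Suc n. \<exists>i\<in>Hom C (W k) (G k). \<theta> k \<cdot> i = w k) \<and>
    (\<forall>k\<le>n. \<exists>j\<in>Hom C (W k) (G (Suc k)). \<theta> (Suc k) \<cdot> j = y k \<cdot> w k)"
  proof (rule contractible_cover[where y=y and Y=Y])
    fix k assume "k = 0 \<or> k = n \<or> k = Suc n"
    then have "W k = Z" by (auto simp: W_def)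
    then show "Id C (W k) = Zero C (W k) (W k)" using ZH(2)[OF Id_Hom[OF ZH(1)]] by simp
  qed (use yH right_exact_cxD(2)[OF Y] wH in auto)
  then obtain G g \<theta> where G: "exact_cx n G g" "chain_map n G g Y y \<theta>" "Id C (G 0) = Zero C (G 0) (G 0)"
    "Id C (G (Suc n)) = Zero C (G (Suc n)) (G (Suc n))"
    "\<And>k. k \<le> Suc n \<Longrightarrow> \<exists>i\<in>Hom C (W k) (G k). \<theta> k \<cdot> i = w k"
    "\<And>k. k \<le> n \<Longrightarrow> \<exists>j\<in>Hom C (W k) (G (Suc k)). \<theta> (Suc k) \<cdot> j = y k \<cdot> w k"
    by blast
  note Gr = exact_cxD(1)[OF G(1)]
  note gH = right_exact_cxD(1)[OF Gr] and \<theta>H = chain_mapD(1)[OF G(2)]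
  from direct_sum_exact[OF F G(1,3,4)] obtain S s p q where S: "exact_cx n S s" "S 0 = F 0" "S (Suc n) = F (Suc n)"
    "chain_map n S s F f p" "p 0 = Id C (F 0)" "p (Suc n) = Id C (F (Suc n))" "chain_map n S s G g q"
    "\<And>k T a b. \<lbrakk>k\<le>Suc n; a\<in>Hom C T (F k); b\<in>Hom C T (G k)\<rbrakk> \<Longrightarrow> \<exists>w\<in>Hom C T (S k). p k \<cdot> w = a \<and> q k \<cdot> w = b"
    by blast
  note Sr = exact_cxD(1)[OF S(1)]
  note sH = right_exact_cxD(1)[OF Sr] and pH = chain_mapD(1)[OF S(4)] and qH = chain_mapD(1)[OF S(7)]
  have q0: "q 0 = Zero C (S 0) (G 0)" "q (Suc n) = Zero C (S (Suc n)) (G (Suc n))"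
    using into_null[OF G(3) qH] into_null[OF G(4) qH] by simp_all
  define \<phi>' where "\<phi>' k = Add C (\<phi> k \<cdot> p k) (\<theta> k \<cdot> q k)" for k
  have \<phi>'H: "\<phi>' k \<in> Hom C (S k) (Y k)" if "k \<le> Suc n" for k
    unfolding \<phi>'_def using \<phi>H[OF that] pH[OF that] \<theta>H[OF that] qH[OF that] by (intro Add_Hom Comp_Hom)
  have sq: "\<phi>' (Suc k) \<cdot> s k = y k \<cdot> \<phi>' k" if k: "k \<le> n" for k
  proof -
    have k': "k \<le> Suc n" "Suc k \<le> Suc n" using k by auto
    have "\<phi> (Suc k) \<cdot> (p (Suc k) \<cdot> s k) = y k \<cdot> (\<phi> k \<cdot> p k)"
      unfolding chain_mapD(2)[OF S(4) k]
      by (rule Comp_eq_Comp[OF chain_mapD(2)[OF \<phi> k] fH[OF k] \<phi>H[OF k'(2)] \<phi>H[OF k'(1)] yH[OF k] pH[OF k'(1)]])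
    moreover have "\<theta> (Suc k) \<cdot> (q (Suc k) \<cdot> s k) = y k \<cdot> (\<theta> k \<cdot> q k)"
      unfolding chain_mapD(2)[OF S(7) k]
      by (rule Comp_eq_Comp[OF chain_mapD(2)[OF G(2) k] gH[OF k] \<theta>H[OF k'(2)] \<theta>H[OF k'(1)] yH[OF k] qH[OF k'(1)]])
    ultimately show ?thesis unfolding \<phi>'_def
      using \<phi>H[OF k'(1)] \<phi>H[OF k'(2)] pH[OF k'(1)] pH[OF k'(2)] \<theta>H[OF k'(1)] \<theta>H[OF k'(2)] qH[OF k'(1)] qH[OF k'(2)]
        yH[OF k] sH[OF k]
      by (simp add: Hom_def)
  qed
  have cm: "chain_map n S s Y y \<phi>'" unfolding chain_map_def using \<phi>'H sq by blast
  have ends: "\<phi>' 0 = \<phi> 0" "\<phi>' (Suc n) = Id C (Y (Suc n))"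
    unfolding \<phi>'_def S(5,6) q0 using S(2,3) FY \<phi>H[of 0] \<theta>H[of 0] \<theta>H[of "Suc n"] FO[of 0] FO[of "Suc n"] YO[of 0] YO[of "Suc n"]
    by (simp_all add: Hom_def)
  have pair: "\<exists>v\<in>Hom C T (S k). p k \<cdot> v = a \<and> \<phi>' k \<cdot> v = Add C (\<phi> k \<cdot> a) (\<theta> k \<cdot> b)"
    if kab: "k \<le> Suc n" "a \<in> Hom C T (F k)" "b \<in> Hom C T (G k)" for k T a b
  proof -
    obtain v where v: "v \<in> Hom C T (S k)" "p k \<cdot> v = a" "q k \<cdot> v = b" using S(8)[OF kab] by blast
    then have "\<phi>' k \<cdot> v = Add C (\<phi> k \<cdot> a) (\<theta> k \<cdot> b)"
      unfolding \<phi>'_def using \<phi>H[OF kab(1)] pH[OF kab(1)] \<theta>H[OF kab(1)] qH[OF kab(1)] by (auto simp: Hom_def)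
    then show ?thesis using v by blast
  qed
  \<comment> \<open>The copy of \<open>Y k\<close> inside degree \<open>k + 1\<close> is mapped by
    \<open>y k\<close>, so it covers all boundaries; by exactness these include, after an epi,
    everything killed by \<open>y (k + 1)\<close>.\<close>
  have lift_y: "lifts (\<phi>' (Suc k)) d"
    if kn: "k < n" "w k = Id C (Y k)" "W k = Y k" and d: "d \<in> Hom C T (Y (Suc k))" "y (Suc k) \<cdot> d = Zero C T (Y (Suc (Suc k)))" for k T d
  proof -
    have k: "k \<le> n" "k \<le> Suc n" "Suc k \<le> Suc n" using kn by auto
    have l: "lifts (y k) d" using right_exact_cxD(3)[OF Y k(1) d(1)] d(2) by simp
    obtain T' e b where b: "is_epi C e" "e \<in> Hom C T' T" "b \<in> Hom C T' (Y k)" "y k \<cdot> b = d \<cdot> e"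
      by (rule liftsE[OF l d(1) yH[OF k(1)]])
    obtain j where j: "j \<in> Hom C (Y k) (G (Suc k))" "\<theta> (Suc k) \<cdot> j = y k"
      using G(6)[OF k(1)] kn(2,3) yH[OF k(1)] by (auto simp: Hom_def)
    note O = Hom_Ob[OF b(2)] FO[OF k(3)]
    obtain v where v: "v \<in> Hom C T' (S (Suc k))"
      "\<phi>' (Suc k) \<cdot> v = Add C (\<phi> (Suc k) \<cdot> Zero C T' (F (Suc k))) (\<theta> (Suc k) \<cdot> (j \<cdot> b))"
      using pair[OF k(3) Zero_Hom[OF O(1) O(3)] Comp_Hom[OF b(3) j(1)]] by blast
    have "\<theta> (Suc k) \<cdot> (j \<cdot> b) = d \<cdot> e"
      using Comp_eq_Comp'[OF j(2,1) \<theta>H[OF k(3)] b(3)] b(4) by simp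
    then have "\<phi>' (Suc k) \<cdot> v = d \<cdot> e"
      using v(2) \<phi>H[OF k(3)] O b(2) d(1) by (simp add: Hom_def)
    then show ?thesis by (rule liftsI[OF b(1,2) v(1) _ d(1) \<phi>'H[OF k(3)]])
  qed
  have epi_n: "is_epi C (\<phi>' n)"
  proof (rule epi_if_kernel_lifts[OF _ \<phi>'H[of n] yH[of n]])
    show "s n = y n \<cdot> \<phi>' n" using sq[of n] ends(2) sH[of n] S(3) FY(1) by (simp add: Hom_def)
    show "is_epi C (s n)"
      by (rule epi_if_lifts[OF sH], simp, rule right_exact_cxD(3)[OF Sr]) (use Id_Hom right_exact_cx_Ob[OF Sr] in auto)
    show "s n \<in> Hom C (S n) (Y (Suc n))" using sH[of n] FY S by simp
    show "lifts (\<phi>' n) d" if d: "d \<in> Hom C T (Y n)" "y n \<cdot> d = Zero C T (Y (Suc n))" for T d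
    proof (cases "n = 1")
      case False
      then obtain m where m: "n = Suc m" "m \<ge> 1" using n by (cases n) auto
      then show ?thesis using lift_y[of m d T] d by (simp add: w_def W_def)
    next
      \<comment> \<open>For \<open>n = 1\<close> only zero objects are added in degree 0, so no copy
        of \<open>Y 0\<close> is available; the boundaries from \<open>Y 0\<close> are covered
        because \<open>\<phi>' 0\<close> is epi.\<close>
      case True
      have l: "lifts (y 0) d" using right_exact_cxD(3)[OF Y, of 0] d True by simp
      have d': "d \<in> Hom C T (Y (Suc 0))" using d True by simp
      obtain T' e b where b: "is_epi C e" "e \<in> Hom C T' T" "b \<in> Hom C T' (Y 0)" "y 0 \<cdot> b = d \<cdot> e"
        by (rule liftsE[OF l d' yH[of 0]]) auto
      have e0: "is_epi C (\<phi>' 0)" using epi ends by simp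
      obtain T'' e' a where a: "is_epi C e'" "e' \<in> Hom C T'' T'" "a \<in> Hom C T'' (S 0)" "\<phi>' 0 \<cdot> a = b \<cdot> e'"
        by (rule liftsE[OF lifts_epi[OF e0 \<phi>'H[of 0] b(3)] b(3) \<phi>'H[of 0]]) auto
      have h: "s 0 \<in> Hom C (S 0) (S 1)" "y 0 \<in> Hom C (Y 0) (Y 1)" "\<phi>' 0 \<in> Hom C (S 0) (Y 0)" "\<phi>' 1 \<in> Hom C (S 1) (Y 1)"
        "\<phi>' 1 \<cdot> s 0 = y 0 \<cdot> \<phi>' 0"
        using sH[of 0] yH[of 0] \<phi>'H[of 0] \<phi>'H[of 1] sq[of 0] by simp_all
      show ?thesis unfolding True
      proof (rule liftsI[OF _ _ _ _ d'[folded One_nat_def] h(4)])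
        show "is_epi C (e \<cdot> e')" using is_epi_comp[OF a(1) b(1)] a b by (simp add: Hom_def)
        show "e \<cdot> e' \<in> Hom C T'' T" using Comp_Hom a b by blast
        show "s 0 \<cdot> a \<in> Hom C T'' (S 1)" using Comp_Hom a(3) h(1) by blast
        have "\<phi>' 1 \<cdot> (s 0 \<cdot> a) = y 0 \<cdot> (\<phi>' 0 \<cdot> a)" by (rule Comp_eq_Comp[OF h(5,1,4,3,2) a(3)])
        also have "\<dots> = d \<cdot> (e \<cdot> e')" unfolding a(4)
          by (rule Comp_eq_Comp[OF b(4,3) h(2) b(2) d'[folded One_nat_def] a(2)])
        finally show "\<phi>' 1 \<cdot> (s 0 \<cdot> a) = d \<cdot> (e \<cdot> e')" .
      qed
    qed
  qed auto
  have "is_epi C (\<phi>' k)" if k: "k \<le> n" for k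
  proof -
    consider "k = 0" | "k = n" | "1 \<le> k" "k < n" using k by linarith
    then show ?thesis
    proof cases
      case 1 then show ?thesis using epi ends by simp
    next
      case 2 then show ?thesis using epi_n by simp
    next
      case 3
      then have k': "k \<le> Suc n" by simp
      obtain i where i: "i \<in> Hom C (Y k) (G k)" "\<theta> k \<cdot> i = Id C (Y k)"
        using G(5)[OF k'] 3 by (auto simp: w_def W_def)
      note O = YO[OF k'] FO[OF k']
      obtain v where v: "v \<in> Hom C (Y k) (S k)" "\<phi>' k \<cdot> v = Add C (\<phi> k \<cdot> Zero C (Y k) (F k)) (\<theta> k \<cdot> i)"
        using pair[OF k' Zero_Hom[OF O] i(1)] by blast
      have "\<phi>' k \<cdot> v = Id C (Y k)" using v(2) i(2) \<phi>H[OF k'] O by (simp add: Hom_def)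
      then show ?thesis by (rule split_epi[OF \<phi>'H[OF k'] v(1)])
    qed
  qed
  then show ?thesis using S(1-6) cm ends by blast
qed

text \<open>\<open>F\<close> is enlarged by a contractible complex until it maps onto \<open>Y\<close> in every degree \<open>\<le> n\<close>;
  then the degreewise fibre product is exact.\<close>

lemma homotopy_fiber_product:
  assumes F: "exact_cx n F f" and X: "right_exact_cx n X x" and Y: "right_exact_cx n Y y"
    and \<phi>: "chain_map n F f Y y \<phi>" and \<psi>: "chain_map n X x Y y \<psi>"
    and epi: "is_epi C (\<phi> 0)" and n: "n \<ge> 1"
    and M: "F (Suc n) = M" "X (Suc n) = M" "Y (Suc n) = M" "\<phi> (Suc n) = Id C M" "\<psi> (Suc n) = Id C M"
    and pb: "is_pullback C (\<phi> 0) (\<psi> 0) p0 q0" and H0: "H0 = Dom C p0"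
    and ker: "\<And>T d. \<lbrakk>d \<in> Hom C T (Y 0); y 0 \<cdot> d = Zero C T (Y 1)\<rbrakk> \<Longrightarrow>
       \<exists>T' e v. is_epi C e \<and> e \<in> Hom C T' T \<and> v \<in> Hom C T' (X 0) \<and> x 0 \<cdot> v = Zero C T' (X 1) \<and> \<psi> 0 \<cdot> v = d \<cdot> e"
    and jm: "\<And>T v. \<lbrakk>v \<in> Hom C T (X 0); x 0 \<cdot> v = Zero C T (X 1); \<psi> 0 \<cdot> v = Zero C T (Y 0)\<rbrakk> \<Longrightarrow> v = Zero C T (X 0)"
  shows "\<exists>H h \<pi> \<rho>. exact_cx n H h \<and> H 0 = H0 \<and> H (Suc n) = M \<and>
     chain_map n H h F f \<pi> \<and> \<pi> 0 = p0 \<and> \<pi> (Suc n) = Id C M \<and>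
     chain_map n H h X x \<rho> \<and> \<rho> 0 = q0 \<and> \<rho> (Suc n) = Id C M"
proof -
  have "\<phi> (Suc n) = Id C (Y (Suc n))" "F (Suc n) = Y (Suc n)" using M by simp_all
  from enlarge_to_epi[OF F Y \<phi> epi n this(2,1)] obtain S s \<pi> \<chi> where
    S: "exact_cx n S s" "S 0 = F 0" "S (Suc n) = F (Suc n)" "chain_map n S s F f \<pi>"
    "\<pi> 0 = Id C (F 0)" "\<pi> (Suc n) = Id C (F (Suc n))" "chain_map n S s Y y \<chi>" "\<chi> 0 = \<phi> 0"
    "\<chi> (Suc n) = Id C (Y (Suc n))" "\<And>k. k\<le>n \<Longrightarrow> is_epi C (\<chi> k)"
    by blast
  note Sr = exact_cxD(1)[OF S(1)] and Fr = exact_cxD(1)[OF F]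
  note yH = right_exact_cxD(1)[OF Y] and sH = right_exact_cxD(1)[OF Sr] and xH = right_exact_cxD(1)[OF X]
    and \<chi>H = chain_mapD(1)[OF S(7)] and \<psi>H = chain_mapD(1)[OF \<psi>]
  have MO: "M \<in> Ob C" using right_exact_cx_Ob[OF X, of "Suc n"] M by simp
  have pbn: "is_pullback C (Id C M) (Id C M) (Id C M) (Id C M)"
    by (rule pullbackI[where B=M and D=M and P=M and X=M]) (use MO in \<open>auto simp: Hom_def\<close>)
  \<comment> \<open>At both ends the pullback is prescribed, so that the resulting complex has the
    required ends on the nose.\<close>
  have "\<exists>p q. is_pullback C (\<chi> k) (\<psi> k) p q \<and> (k = 0 \<longrightarrow> p = p0 \<and> q = q0) \<and>
      (k = Suc n \<longrightarrow> p = Id C M \<and> q = Id C M)" if k: "k \<le> Suc n" for k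
  proof -
    consider "k = 0" | "k = Suc n" | "k \<noteq> 0" "k \<noteq> Suc n" by blast
    then show ?thesis
    proof cases
      case 1 then show ?thesis using pb S(8) by auto
    next
      case 2 then show ?thesis using pbn S(9) M by auto
    next
      case 3 then show ?thesis using ex_pullback[OF \<chi>H[OF k] \<psi>H[OF k]] by auto
    qed
  qed
  then have "\<exists>p. \<forall>k\<le>Suc n. \<exists>q. is_pullback C (\<chi> k) (\<psi> k) (p k) q \<and> (k = 0 \<longrightarrow> p k = p0 \<and> q = q0) \<and>
      (k = Suc n \<longrightarrow> p k = Id C M \<and> q = Id C M)"
    by (intro choice) blast
  then obtain p where "\<forall>k\<le>Suc n. \<exists>q. is_pullback C (\<chi> k) (\<psi> k) (p k) q \<and> (k = 0 \<longrightarrow> p k = p0 \<and> q = q0) \<and>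
      (k = Suc n \<longrightarrow> p k = Id C M \<and> q = Id C M)" by blast
  then have "\<exists>q. \<forall>k\<le>Suc n. is_pullback C (\<chi> k) (\<psi> k) (p k) (q k) \<and> (k = 0 \<longrightarrow> p k = p0 \<and> q k = q0) \<and>
      (k = Suc n \<longrightarrow> p k = Id C M \<and> q k = Id C M)"
    by (intro choice) blast
  then obtain q where pq: "\<And>k. k \<le> Suc n \<Longrightarrow> is_pullback C (\<chi> k) (\<psi> k) (p k) (q k)"
    and ends: "p 0 = p0" "q 0 = q0" "p (Suc n) = Id C M" "q (Suc n) = Id C M" by auto
  have "\<exists>h. exact_cx n (\<lambda>k. Dom C (p k)) h \<and> chain_map n (\<lambda>k. Dom C (p k)) h S s p \<and>
     chain_map n (\<lambda>k. Dom C (p k)) h X x q"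
  proof (rule fiber_product_exact[OF S(1) X yH S(7) \<psi> pq _ jm])
    fix k T f' x' assume k: "k \<le> n" and fx: "f' \<in> Hom C T (S k)" "x' \<in> Hom C T (X k)"
      and eq: "y k \<cdot> (\<chi> k \<cdot> f') = y k \<cdot> (\<psi> k \<cdot> x')"
    have k': "k \<le> Suc n" "Suc k \<le> Suc n" using k by auto
    note O = Hom_Ob[OF fx(1)] Hom_Ob[OF xH[OF k]] Hom_Ob[OF sH[OF k]]
    have c: "\<chi> k \<cdot> f' \<in> Hom C T (Y k)" "\<psi> k \<cdot> x' \<in> Hom C T (Y k)"
      using Comp_Hom[OF fx(1) \<chi>H[OF k'(1)]] Comp_Hom[OF fx(2) \<psi>H[OF k'(1)]] by simp_all
    \<comment> \<open>The disagreement of the two lifts in \<open>Y\<close>, which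
      \<open>y k\<close> kills.\<close>
    define d where "d = sub (\<chi> k \<cdot> f') (\<psi> k \<cdot> x')"
    have d: "d \<in> Hom C T (Y k)" unfolding d_def using c by (simp add: Hom_def)
    have yd: "y k \<cdot> d = Zero C T (Y (Suc k))" unfolding d_def using c eq yH[OF k] by (simp add: Hom_def)
    show "\<exists>T' e f'' x''. is_epi C e \<and> e \<in> Hom C T' T \<and> f'' \<in> Hom C T' (S k) \<and> x'' \<in> Hom C T' (X k) \<and>
         s k \<cdot> f'' = s k \<cdot> (f' \<cdot> e) \<and> x k \<cdot> x'' = x k \<cdot> (x' \<cdot> e) \<and> \<chi> k \<cdot> f'' = \<psi> k \<cdot> x''"
    proof (cases k)
      \<comment> \<open>In degree 0 there is no boundary with which to correct \<open>f'\<close>;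
        \<open>ker\<close> writes the disagreement as the image of an element killed by
        \<open>x 0\<close>, and this is added to \<open>x'\<close>.\<close>
      case 0
      from ker[of d T] d yd 0 obtain T' e v where v: "is_epi C e" "e \<in> Hom C T' T" "v \<in> Hom C T' (X k)"
        "x k \<cdot> v = Zero C T' (X (Suc k))" "\<psi> k \<cdot> v = d \<cdot> e" by auto
      have f'': "f' \<cdot> e \<in> Hom C T' (S k)" and x'': "Add C (x' \<cdot> e) v \<in> Hom C T' (X k)"
        using fx v by (simp_all add: Hom_def)
      have "x k \<cdot> Add C (x' \<cdot> e) v = x k \<cdot> (x' \<cdot> e)"
        using fx v O xH[OF k] by (simp add: Hom_def)
      moreover have "\<psi> k \<cdot> Add C (x' \<cdot> e) v = Add C (\<psi> k \<cdot> x') d \<cdot> e"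
        using fx v \<psi>H[OF k'(1)] d by (simp add: Hom_def)
      moreover have "Add C (\<psi> k \<cdot> x') d = \<chi> k \<cdot> f'" unfolding d_def by (rule Add_sub_cancel[OF c])
      moreover have "(\<chi> k \<cdot> f') \<cdot> e = \<chi> k \<cdot> (f' \<cdot> e)" using \<chi>H[OF k'(1)] fx v by (simp add: Hom_def)
      ultimately show ?thesis using v(1,2) f'' x''
        by (intro exI[of _ T'] exI[of _ e] exI[of _ "f' \<cdot> e"] exI[of _ "Add C (x' \<cdot> e) v"]) simp
    next
      \<comment> \<open>In positive degree the disagreement is a boundary
        \<open>y m \<cdot> b\<close> after an epi. Since \<open>\<chi> m\<close> is epi,
        \<open>b\<close> lifts to some \<open>a\<close> in \<open>S m\<close>, and subtracting
        \<open>s m \<cdot> a\<close> from \<open>f'\<close> leaves its image under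
        \<open>s k\<close> unchanged.\<close>
      case (Suc m)
      have m: "m \<le> n" "m \<le> Suc n" "m < n" using Suc k by auto
      have d': "d \<in> Hom C T (Y (Suc m))" using d Suc by simp
      have l: "lifts (y m) d" using right_exact_cxD(3)[OF Y m(1) d'] yd Suc by simp
      obtain T1 e1 b where b: "is_epi C e1" "e1 \<in> Hom C T1 T" "b \<in> Hom C T1 (Y m)" "y m \<cdot> b = d \<cdot> e1"
        by (rule liftsE[OF l d' yH[OF m(1)]])
      obtain T2 e2 a where a: "is_epi C e2" "e2 \<in> Hom C T2 T1" "a \<in> Hom C T2 (S m)" "\<chi> m \<cdot> a = b \<cdot> e2"
        by (rule liftsE[OF lifts_epi[OF S(10)[OF m(1)] \<chi>H[OF m(2)] b(3)] b(3) \<chi>H[OF m(2)]])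
      let ?e = "e1 \<cdot> e2"
      have e: "is_epi C ?e" "?e \<in> Hom C T2 T"
        using is_epi_comp[OF a(1) b(1)] a b by (simp_all add: Hom_def)
      have sm: "s m \<in> Hom C (S m) (S k)" using sH[OF m(1)] Suc by simp
      have sa: "s m \<cdot> a \<in> Hom C T2 (S k)" by (rule Comp_Hom[OF a(3) sm])
      have f'': "sub (f' \<cdot> ?e) (s m \<cdot> a) \<in> Hom C T2 (S k)" using sa fx(1) e(2) by (simp add: Hom_def)
      have x'': "x' \<cdot> ?e \<in> Hom C T2 (X k)" using fx(2) e(2) by (rule Comp_Hom[rotated])
      have ssa: "s k \<cdot> (s m \<cdot> a) = Zero C T2 (S (Suc k))"
        using Comp_eq_Comp'[OF right_exact_cxD(2)[OF Sr m(3)] sH[OF m(1)] sH, of a T2] k Suc a(3) O by (simp add: Hom_def)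
      have ca: "\<chi> k \<cdot> (s m \<cdot> a) = d \<cdot> ?e"
      proof -
        have "\<chi> k \<cdot> (s m \<cdot> a) = y m \<cdot> (\<chi> m \<cdot> a)"
          using Comp_eq_Comp[OF chain_mapD(2)[OF S(7) m(1)] sH[OF m(1)] \<chi>H[of "Suc m"] \<chi>H[OF m(2)] yH[OF m(1)] a(3)] k' Suc
          by simp
        also have "\<dots> = d \<cdot> ?e" unfolding a(4)
          by (rule Comp_eq_Comp[OF b(4,3) yH[OF m(1)] b(2) d' a(2)])
        finally show ?thesis .
      qed
      have "s k \<cdot> sub (f' \<cdot> ?e) (s m \<cdot> a) = sub (s k \<cdot> (f' \<cdot> ?e)) (s k \<cdot> (s m \<cdot> a))"
        using sH[OF k] fx(1) e(2) sa by (intro Comp_sub) (simp_all add: Hom_def)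
      also have "\<dots> = s k \<cdot> (f' \<cdot> ?e)" unfolding ssa using sH[OF k] fx(1) e(2) by (simp add: Hom_def)
      finally have 1: "s k \<cdot> sub (f' \<cdot> ?e) (s m \<cdot> a) = s k \<cdot> (f' \<cdot> ?e)" .
      have "\<chi> k \<cdot> sub (f' \<cdot> ?e) (s m \<cdot> a) = sub (\<chi> k \<cdot> (f' \<cdot> ?e)) (\<chi> k \<cdot> (s m \<cdot> a))"
        using \<chi>H[OF k'(1)] fx(1) e(2) sa by (intro Comp_sub) (simp_all add: Hom_def)
      also have "\<dots> = sub (\<chi> k \<cdot> f') d \<cdot> ?e" unfolding ca using \<chi>H[OF k'(1)] fx(1) e(2) d by (simp add: Hom_def)
      also have "sub (\<chi> k \<cdot> f') d = \<psi> k \<cdot> x'" unfolding d_def by (rule sub_sub_cancel[OF c])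
      also have "(\<psi> k \<cdot> x') \<cdot> ?e = \<psi> k \<cdot> (x' \<cdot> ?e)" using \<psi>H[OF k'(1)] fx(2) e(2) by (simp add: Hom_def)
      finally have 2: "\<chi> k \<cdot> sub (f' \<cdot> ?e) (s m \<cdot> a) = \<psi> k \<cdot> (x' \<cdot> ?e)" .
      show ?thesis using e f'' x'' 1 2 by blast
    qed
  qed
  then obtain h where h: "exact_cx n (\<lambda>k. Dom C (p k)) h" "chain_map n (\<lambda>k. Dom C (p k)) h S s p"
     "chain_map n (\<lambda>k. Dom C (p k)) h X x q" by blast
  \<comment> \<open>The projection of the enlarged complex back to \<open>F\<close> is the identity
    at both ends, so composing with it keeps the prescribed end components.\<close>
  have "chain_map n (\<lambda>k. Dom C (p k)) h F f (\<lambda>k. \<pi> k \<cdot> p k)"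
    by (rule chain_map_comp[OF h(2) S(4), OF right_exact_cxD(1)[OF exact_cxD(1)[OF h(1)]] sH right_exact_cxD(1)[OF Fr]])
  moreover have "\<pi> 0 \<cdot> p 0 = p0" "\<pi> (Suc n) \<cdot> p (Suc n) = Id C M"
    using chain_mapD(1)[OF h(2), of 0] S(2,5,6) ends MO M by (simp_all add: Hom_def)
  moreover have "Dom C (p (Suc n)) = M" using ends MO by simp
  ultimately show ?thesis using h(1,3) ends H0
    by (intro exI[of _ "\<lambda>k. Dom C (p k)"] exI[of _ h] exI[of _ "\<lambda>k. \<pi> k \<cdot> p k"] exI[of _ q]) simp
qed

subsection \<open>Pushouts\<close>

lemma pushoutD:
  assumes "is_pushout C f d e u" "f \<in> Hom C A X" "d \<in> Hom C A B"
  obtains P where "e \<in> Hom C X P" "u \<in> Hom C B P" "e \<cdot> f = u \<cdot> d" "P = Cod C e"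
    "\<And>T x y. \<lbrakk>x \<in> Hom C X T; y \<in> Hom C B T; x \<cdot> f = y \<cdot> d\<rbrakk> \<Longrightarrow> \<exists>w. w \<in> Hom C P T \<and> w \<cdot> e = x \<and> w \<cdot> u = y"
    "\<And>T w w'. \<lbrakk>w \<in> Hom C P T; w' \<in> Hom C P T; w \<cdot> e = w' \<cdot> e; w \<cdot> u = w' \<cdot> u\<rbrakk> \<Longrightarrow> w = w'"
proof -
  have e: "e \<in> Hom C X (Cod C e)" "u \<in> Hom C B (Cod C e)" "e \<cdot> f = u \<cdot> d"
    using assms by (auto simp: is_pushout_def Hom_def)
  have ex1: "\<exists>!w. w \<in> Hom C (Cod C e) T \<and> w \<cdot> e = x \<and> w \<cdot> u = y"
    if "x \<in> Hom C X T" "y \<in> Hom C B T" "x \<cdot> f = y \<cdot> d" for T x y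
    using assms(1) that unfolding is_pushout_def HomD(2,3)[OF assms(2)] HomD(2,3)[OF assms(3)] by blast
  have "w = w'" if w: "w \<in> Hom C (Cod C e) T" "w' \<in> Hom C (Cod C e) T" "w \<cdot> e = w' \<cdot> e" "w \<cdot> u = w' \<cdot> u" for T w w'
  proof -
    have "\<exists>!v. v \<in> Hom C (Cod C e) T \<and> v \<cdot> e = w \<cdot> e \<and> v \<cdot> u = w \<cdot> u"
    proof (rule ex1)
      show "w \<cdot> e \<in> Hom C X T" "w \<cdot> u \<in> Hom C B T" using e w Comp_Hom by blast+
      have "(w \<cdot> e) \<cdot> f = w \<cdot> (e \<cdot> f)" by (rule Comp_assoc[OF assms(2) e(1) w(1)])
      also have "\<dots> = (w \<cdot> u) \<cdot> d" unfolding e(3)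
        by (rule Comp_assoc[OF assms(3) e(2) w(1), symmetric])
      finally show "(w \<cdot> e) \<cdot> f = (w \<cdot> u) \<cdot> d" .
    qed
    then show ?thesis using w by auto
  qed
  then show ?thesis using that e ex1 by blast
qed

text \<open>Dual to \<open>ex_pullback\<close>: the cokernel of
  \<open>i \<cdot> f - j \<cdot> d\<close>.\<close>

lemma ex_pushout:
  assumes f: "f \<in> Hom C A X" and d: "d \<in> Hom C A B"
  shows "\<exists>e u. is_pushout C f d e u"
proof -
  obtain S i j p q where b: "is_biproduct C X B S i j p q"
    using ex_biproduct[OF Hom_Ob(2)[OF f] Hom_Ob(2)[OF d]] by blast
  note bs = biproduct_simps[OF b]
  have s: "sub (i \<cdot> f) (j \<cdot> d) \<in> Hom C A S" using bs(1,2) f d by (simp add: Hom_def)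
  obtain P c where c: "c \<in> Hom C S P" "c \<cdot> sub (i \<cdot> f) (j \<cdot> d) = Zero C A P" "is_epi C c"
    "\<And>T t. \<lbrakk>t \<in> Hom C S T; t \<cdot> sub (i \<cdot> f) (j \<cdot> d) = Zero C A T\<rbrakk> \<Longrightarrow> \<exists>u. u \<in> Hom C P T \<and> u \<cdot> c = t"
    by (rule obtain_cokernel[OF s]) (rule that; blast)
  have e: "c \<cdot> i \<in> Hom C X P" "c \<cdot> j \<in> Hom C B P" using bs(1,2) c(1) by (simp_all add: Hom_def)
  have sq: "(c \<cdot> i) \<cdot> f = (c \<cdot> j) \<cdot> d"
  proof (rule sub_eq_ZeroD)
    show "(c \<cdot> i) \<cdot> f \<in> Hom C A P" "(c \<cdot> j) \<cdot> d \<in> Hom C A P" using e f d Comp_Hom by blast+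
    show "sub ((c \<cdot> i) \<cdot> f) ((c \<cdot> j) \<cdot> d) = Zero C A P"
      using c(1,2) bs(1,2) f d by (simp add: Hom_def)
  qed
  have ex: "\<exists>w. w \<in> Hom C P T \<and> w \<cdot> (c \<cdot> i) = x \<and> w \<cdot> (c \<cdot> j) = y"
    if xy: "x \<in> Hom C X T" "y \<in> Hom C B T" "x \<cdot> f = y \<cdot> d" for T x y
  proof -
    define t where "t = Add C (x \<cdot> p) (y \<cdot> q)"
    have t: "t \<in> Hom C S T" "t \<cdot> i = x" "t \<cdot> j = y"
      using biproduct_copair[OF b xy(1,2)] by (simp_all add: t_def)
    have "t \<cdot> sub (i \<cdot> f) (j \<cdot> d) = sub ((t \<cdot> i) \<cdot> f) ((t \<cdot> j) \<cdot> d)"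
      using t(1) bs(1,2) f d by (simp add: Hom_def)
    also have "\<dots> = Zero C A T" unfolding t xy(3) using xy(2) d by (simp add: Hom_def)
    finally obtain w where w: "w \<in> Hom C P T" "w \<cdot> c = t" using c(4) t(1) by blast
    have "w \<cdot> (c \<cdot> i) = x" "w \<cdot> (c \<cdot> j) = y"
      using Comp_eq_Comp'[OF w(2) c(1) w(1) bs(1)] Comp_eq_Comp'[OF w(2) c(1) w(1) bs(2)] t by simp_all
    then show ?thesis using w by blast
  qed
  have un: "w = w'"
    if w: "w \<in> Hom C P T" "w' \<in> Hom C P T" "w \<cdot> (c \<cdot> i) = w' \<cdot> (c \<cdot> i)" "w \<cdot> (c \<cdot> j) = w' \<cdot> (c \<cdot> j)" for T w w'
  proof (rule epi_cancel[OF c(3,1) w(1,2)], rule biproduct_joint_epi[OF b])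
    show "w \<cdot> c \<in> Hom C S T" "w' \<cdot> c \<in> Hom C S T" using w c Comp_Hom by blast+
    show "(w \<cdot> c) \<cdot> i = (w' \<cdot> c) \<cdot> i" "(w \<cdot> c) \<cdot> j = (w' \<cdot> c) \<cdot> j"
      using w c(1) bs(1,2) by (simp_all add: Hom_def)
  qed
  have ex1: "\<exists>!w. w \<in> Hom C P T \<and> w \<cdot> (c \<cdot> i) = x \<and> w \<cdot> (c \<cdot> j) = y"
    if xy: "x \<in> Hom C X T" "y \<in> Hom C B T" "x \<cdot> f = y \<cdot> d" for T x y
  proof -
    obtain w where w: "w \<in> Hom C P T \<and> w \<cdot> (c \<cdot> i) = x \<and> w \<cdot> (c \<cdot> j) = y" using ex[OF xy] by blast
    moreover have "v = w" if "v \<in> Hom C P T \<and> v \<cdot> (c \<cdot> i) = x \<and> v \<cdot> (c \<cdot> j) = y" for v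
      by (rule un[of v T w]) (use w that in simp_all)
    ultimately show ?thesis by (rule ex1I)
  qed
  have "is_pushout C f d (c \<cdot> i) (c \<cdot> j)" unfolding is_pushout_def
    using HomD[OF f] HomD[OF d] HomD[OF e(1)] HomD[OF e(2)] sq ex1 by auto
  then show ?thesis by blast
qed

text \<open>A pushout square along a mono is also a pullback square. The pair formed by
  \<open>f\<close> and \<open>d\<close> is mono, hence the kernel of some \<open>r\<close>. The
  components of \<open>r\<close>, one of them negated, factor through the pushout, so
  \<open>r\<close> kills every pair of \<open>x\<close> and \<open>y\<close> with
  \<open>e \<cdot> x = u \<cdot> y\<close>.\<close>

lemma pushout_mono_pullback:
  assumes po: "is_pushout C f d e u" and f: "f \<in> Hom C A X" and d: "d \<in> Hom C A B" and m: "is_mono C d"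
    and xy: "x \<in> Hom C T X" "y \<in> Hom C T B" "e \<cdot> x = u \<cdot> y"
  shows "\<exists>s. s \<in> Hom C T A \<and> f \<cdot> s = x \<and> d \<cdot> s = y"
proof -
  obtain P where P: "e \<in> Hom C X P" "u \<in> Hom C B P"
    "\<And>T x y. \<lbrakk>x \<in> Hom C X T; y \<in> Hom C B T; x \<cdot> f = y \<cdot> d\<rbrakk> \<Longrightarrow> \<exists>w. w \<in> Hom C P T \<and> w \<cdot> e = x \<and> w \<cdot> u = y"
    by (rule pushoutD[OF po f d]) (rule that; blast)
  obtain S i j p q where b: "is_biproduct C X B S i j p q"
    using ex_biproduct[OF Hom_Ob(2)[OF f] Hom_Ob(2)[OF d]] by blast
  note bs = biproduct_simps[OF b]
  define k where "k = Add C (i \<cdot> f) (j \<cdot> d)"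
  have k: "k \<in> Hom C A S" "p \<cdot> k = f" "q \<cdot> k = d" using biproduct_pair[OF b f d] by (simp_all add: k_def)
  have "is_mono C k"
  proof (rule mono_zeroI[OF k(1)])
    fix V g assume g: "g \<in> Hom C V A" "k \<cdot> g = Zero C V S"
    have "d \<cdot> g = Zero C V B"
      using Comp_eq_Comp'[OF k(3,1) bs(4) g(1)] g(2) bs(4) Hom_Ob[OF g(1)] by (simp add: Hom_def)
    then show "g = Zero C V A" by (rule mono_zeroD[OF m d g(1)])
  qed
  then obtain r where r: "is_kernel C r k" using mono_is_kernel by blast
  then have rH: "r \<in> Hom C S (Cod C r)" using k(1) by (auto simp: is_kernel_def Hom_def)
  obtain K where K: "k \<in> Hom C K S" "r \<cdot> k = Zero C K (Cod C r)"
    "\<And>T t. \<lbrakk>t \<in> Hom C T S; r \<cdot> t = Zero C T (Cod C r)\<rbrakk> \<Longrightarrow> \<exists>u. u \<in> Hom C T K \<and> k \<cdot> u = t"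
    by (rule kernelD[OF r rH]) (rule that; blast)
  have KA: "K = A" using K(1) k(1) by (simp add: Hom_def)
  let ?R = "Cod C r"
  have ri: "r \<cdot> i \<in> Hom C X ?R" "neg (r \<cdot> j) \<in> Hom C B ?R" using rH bs(1,2) by (simp_all add: Hom_def)
  have rif: "r \<cdot> (i \<cdot> f) \<in> Hom C A ?R" "r \<cdot> (j \<cdot> d) \<in> Hom C A ?R" using rH bs(1,2) f d by (simp_all add: Hom_def)
  have "Add C (r \<cdot> (j \<cdot> d)) (r \<cdot> (i \<cdot> f)) = Zero C A ?R"
    unfolding Add_commute[OF rif(2,1)]
    using K(2) unfolding k_def KA using rH bs(1,2) f d by (simp add: Hom_def)
  then have "r \<cdot> (i \<cdot> f) = neg (r \<cdot> (j \<cdot> d))" by (rule neg_unique[OF rif(2,1)])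
  then have "(r \<cdot> i) \<cdot> f = neg (r \<cdot> j) \<cdot> d" using rH bs(1,2) f d by (simp add: Hom_def)
  from P(3)[OF ri this] obtain w where w: "w \<in> Hom C P ?R" "w \<cdot> e = r \<cdot> i" "w \<cdot> u = neg (r \<cdot> j)" by blast
  define t where "t = Add C (i \<cdot> x) (j \<cdot> y)"
  have t: "t \<in> Hom C T S" "p \<cdot> t = x" "q \<cdot> t = y" using biproduct_pair[OF b xy(1,2)] by (simp_all add: t_def)
  have "w \<cdot> (e \<cdot> x) = r \<cdot> (i \<cdot> x)" by (rule Comp_eq_Comp[OF w(2) P(1) w(1) bs(1) rH xy(1)])
  moreover have "w \<cdot> (u \<cdot> y) = neg (r \<cdot> (j \<cdot> y))"
    using Comp_eq_Comp'[OF w(3) P(2) w(1) xy(2)] rH bs(2) xy(2) by (simp add: Hom_def)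
  ultimately have "r \<cdot> (i \<cdot> x) = neg (r \<cdot> (j \<cdot> y))" using xy(3) by simp
  moreover have "r \<cdot> t = Add C (r \<cdot> (i \<cdot> x)) (r \<cdot> (j \<cdot> y))"
    unfolding t_def using rH bs(1,2) xy(1,2) by (simp add: Hom_def)
  ultimately have "r \<cdot> t = Zero C T ?R" using rH bs(2) xy(2) by (simp add: Hom_def)
  then obtain s where s: "s \<in> Hom C T A" "k \<cdot> s = t" using K(3)[OF t(1)] KA by blast
  have "f \<cdot> s = x" "d \<cdot> s = y"
    using Comp_eq_Comp'[OF k(2,1) bs(3) s(1)] Comp_eq_Comp'[OF k(3,1) bs(4) s(1)] s t by simp_all
  then show ?thesis using s by blast
qed

text \<open>The copairing of \<open>e\<close> and \<open>u\<close> on the biproduct is epi, because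
  arrows out of a pushout are determined by their restrictions.\<close>

lemma pushout_generated:
  assumes po: "is_pushout C f d e u" and f: "f \<in> Hom C A X" and d: "d \<in> Hom C A B"
    and t: "t \<in> Hom C T (Cod C e)"
  shows "\<exists>T' c x y. is_epi C c \<and> c \<in> Hom C T' T \<and> x \<in> Hom C T' X \<and> y \<in> Hom C T' B \<and>
    t \<cdot> c = Add C (e \<cdot> x) (u \<cdot> y)"
proof -
  obtain P where P: "e \<in> Hom C X P" "u \<in> Hom C B P" "P = Cod C e"
    "\<And>T w w'. \<lbrakk>w \<in> Hom C P T; w' \<in> Hom C P T; w \<cdot> e = w' \<cdot> e; w \<cdot> u = w' \<cdot> u\<rbrakk> \<Longrightarrow> w = w'"
    by (rule pushoutD[OF po f d]) (rule that; blast)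
  obtain S i j p q where b: "is_biproduct C X B S i j p q"
    using ex_biproduct[OF Hom_Ob(2)[OF f] Hom_Ob(2)[OF d]] by blast
  note bs = biproduct_simps[OF b]
  define s where "s = Add C (e \<cdot> p) (u \<cdot> q)"
  have s: "s \<in> Hom C S P" "s \<cdot> i = e" "s \<cdot> j = u" using biproduct_copair[OF b P(1,2)] by (simp_all add: s_def)
  have epi: "is_epi C s"
  proof (rule epi_zeroI[OF s(1)])
    fix Z g assume g: "g \<in> Hom C P Z" "g \<cdot> s = Zero C S Z"
    note O = Hom_Ob[OF g(1)]
    show "g = Zero C P Z"
    proof (rule P(4)[OF g(1) Zero_Hom[OF O]])
      show "g \<cdot> e = Zero C P Z \<cdot> e" "g \<cdot> u = Zero C P Z \<cdot> u"
        using Comp_eq_Comp'[OF g(2) s(1) g(1) bs(1)] Comp_eq_Comp'[OF g(2) s(1) g(1) bs(2)] s(2,3) O P(1,2) bs(1,2)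
        by (simp_all add: Hom_def)
    qed
  qed
  have t': "t \<in> Hom C T P" using t P by simp
  obtain T' c v where c: "is_epi C c" "c \<in> Hom C T' T" "v \<in> Hom C T' S" "s \<cdot> v = t \<cdot> c"
    by (rule liftsE[OF lifts_epi[OF epi s(1) t'] t' s(1)])
  have "t \<cdot> c = Add C (e \<cdot> (p \<cdot> v)) (u \<cdot> (q \<cdot> v))"
    unfolding c(4)[symmetric] s_def using P(1,2) bs(3,4) c(3) by (simp add: Hom_def)
  then show ?thesis using c(1,2) Comp_Hom[OF c(3) bs(3)] Comp_Hom[OF c(3) bs(4)] by blast
qed

text \<open>Exactness uses that the pushout of a mono is a pullback. The third claim asks of its
  target only composable arrows and \<open>y 1 \<cdot> y 0 = 0\<close>, so that the tail of an
  extension can be inserted for it.\<close>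

lemma pushout_exact:
  assumes X: "exact_cx n X x" and n: "n \<ge> 1" and h: "h \<in> Hom C (X 0) B"
    and po: "is_pushout C h (x 0) e u" and e1: "e1 \<in> Hom C (Cod C e) (X 2)" "e1 \<cdot> u = x 1" "e1 \<cdot> e = Zero C B (X 2)"
  shows "exact_cx n (X(0 := B, 1 := Cod C e)) (x(0 := e, 1 := e1))" (is "exact_cx n ?X ?x")
    and "chain_map n X x (X(0 := B, 1 := Cod C e)) (x(0 := e, 1 := e1))
      (\<lambda>k. if k = 0 then h else if k = 1 then u else Id C (X k))" (is "chain_map n X x ?X ?x ?\<phi>")
    and "\<lbrakk>chain_map n X x Y y \<psi>; \<And>k. k \<le> n \<Longrightarrow> y k \<in> Hom C (Y k) (Y (Suc k)); y 1 \<cdot> y 0 = Zero C (Y 0) (Y 2);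
        k0 \<in> Hom C B (Y 0); k0 \<cdot> h = \<psi> 0\<rbrakk> \<Longrightarrow>
      \<exists>\<psi>'. chain_map n (X(0 := B, 1 := Cod C e)) (x(0 := e, 1 := e1)) Y y \<psi>' \<and> \<psi>' 0 = k0 \<and> \<psi>' (Suc n) = \<psi> (Suc n)"
proof -
  note Xr = exact_cxD(1)[OF X]
  note XO = right_exact_cx_Ob[OF Xr] and xH = right_exact_cxD(1)[OF Xr]
  have x0: "x 0 \<in> Hom C (X 0) (X 1)" and x1: "x 1 \<in> Hom C (X 1) (X 2)"
    using xH[of 0] xH[of 1] n by (simp_all add: numeral_2_eq_2)
  let ?P = "Cod C e"
  obtain P where P: "e \<in> Hom C B P" "u \<in> Hom C (X 1) P" "e \<cdot> h = u \<cdot> x 0" "P = Cod C e"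
    "\<And>T x' y. \<lbrakk>x' \<in> Hom C B T; y \<in> Hom C (X 1) T; x' \<cdot> h = y \<cdot> x 0\<rbrakk> \<Longrightarrow> \<exists>w. w \<in> Hom C P T \<and> w \<cdot> e = x' \<and> w \<cdot> u = y"
    "\<And>T w w'. \<lbrakk>w \<in> Hom C P T; w' \<in> Hom C P T; w \<cdot> e = w' \<cdot> e; w \<cdot> u = w' \<cdot> u\<rbrakk> \<Longrightarrow> w = w'"
    by (rule pushoutD[OF po h x0]) (rule that; blast)
  have e1': "e1 \<in> Hom C P (X 2)" using e1(1) P(4) by simp
  note BO = Hom_Ob[OF h] Hom_Ob[OF P(1)]
  have me: "is_mono C e"
  proof (rule mono_zeroI[OF P(1)])
    fix T a assume a: "a \<in> Hom C T B" "e \<cdot> a = Zero C T P"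
    note T = Hom_Ob(1)[OF a(1)]
    have "e \<cdot> a = u \<cdot> Zero C T (X 1)" using a(2) P(2) T by (simp add: Hom_def)
    from pushout_mono_pullback[OF po h x0 exact_cxD(2)[OF X] a(1) Zero_Hom this] obtain s
      where s: "s \<in> Hom C T (X 0)" "h \<cdot> s = a" "x 0 \<cdot> s = Zero C T (X 1)" using T XO[of 1] by auto
    have "s = Zero C T (X 0)" by (rule mono_zeroD[OF exact_cxD(2)[OF X] x0 s(1,3)])
    then show "a = Zero C T B" using s(2) h T by (auto simp: Hom_def)
  qed
  \<comment> \<open>After an epi, \<open>t\<close> becomes \<open>e \<cdot> a + u \<cdot> b\<close>.
    Then \<open>x 1\<close> kills \<open>b\<close>, so \<open>b\<close> comes from
    \<open>X 0\<close>, and the relation \<open>e \<cdot> h = u \<cdot> x 0\<close> moves this part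
    into the image of \<open>e\<close>.\<close>
  have lift1: "lifts e t" if t: "t \<in> Hom C T P" "e1 \<cdot> t = Zero C T (X 2)" for T t
  proof -
    obtain T' c a b where c: "is_epi C c" "c \<in> Hom C T' T" "a \<in> Hom C T' B" "b \<in> Hom C T' (X 1)"
      "t \<cdot> c = Add C (e \<cdot> a) (u \<cdot> b)" using pushout_generated[OF po h x0] t(1) P(4) by blast
    note O = Hom_Ob[OF c(2)] XO[of 2]
    have "x 1 \<cdot> b = e1 \<cdot> (u \<cdot> b)" using Comp_eq_Comp'[OF e1(2) P(2) e1' c(4)] by simp
    also have "\<dots> = Add C (e1 \<cdot> (e \<cdot> a)) (e1 \<cdot> (u \<cdot> b))"
      using Comp_eq_Comp'[OF e1(3) P(1) e1' c(3)] c(3,4) P(2) e1' Hom_Ob[OF e1'] by (simp add: Hom_def)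
    also have "\<dots> = e1 \<cdot> (t \<cdot> c)" unfolding c(5) using e1' P(1,2) c(3,4) by (simp add: Hom_def)
    also have "\<dots> = Zero C T' (X 2)"
      using Comp_eq_Comp'[OF t(2,1) e1' c(2)] c(2) Hom_Ob[OF e1'] by (simp add: Hom_def)
    finally have xb: "x 1 \<cdot> b = Zero C T' (X 2)" .
    have l: "lifts (x 0) b" using right_exact_cxD(3)[OF Xr, of 0 b T'] c(4) xb by (simp add: numeral_2_eq_2)
    obtain T'' c' s where s: "is_epi C c'" "c' \<in> Hom C T'' T'" "s \<in> Hom C T'' (X 0)" "x 0 \<cdot> s = b \<cdot> c'"
      by (rule liftsE[OF l c(4) x0])
    show ?thesis
    proof (rule liftsI[OF _ _ _ _ t(1) P(1)])
      show "is_epi C (c \<cdot> c')" using is_epi_comp[OF s(1) c(1)] s c by (simp add: Hom_def)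
      show "c \<cdot> c' \<in> Hom C T'' T" using s c Comp_Hom by blast
      show "Add C (a \<cdot> c') (h \<cdot> s) \<in> Hom C T'' B" using c s h by (simp add: Hom_def)
      have "u \<cdot> (b \<cdot> c') = e \<cdot> (h \<cdot> s)" unfolding s(4)[symmetric]
        by (rule Comp_eq_Comp[OF P(3) h P(1) x0 P(2) s(3), symmetric])
      then have "Add C (e \<cdot> (a \<cdot> c')) (e \<cdot> (h \<cdot> s)) = Add C (e \<cdot> a) (u \<cdot> b) \<cdot> c'"
        using c(3,4) s(2) P(1,2) by (simp add: Hom_def)
      also have "\<dots> = t \<cdot> (c \<cdot> c')" unfolding c(5)[symmetric] using t c(2) s(2) by (simp add: Hom_def)
      finally show "e \<cdot> Add C (a \<cdot> c') (h \<cdot> s) = t \<cdot> (c \<cdot> c')"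
        using c(3) s(2,3) h P(1) by (simp add: Hom_def)
    qed
  qed
  have lift2: "lifts e1 t" if t: "t \<in> Hom C T (X 2)" and l: "lifts (x 1) t" for T t
  proof -
    obtain T' c s where s: "is_epi C c" "c \<in> Hom C T' T" "s \<in> Hom C T' (X 1)" "x 1 \<cdot> s = t \<cdot> c"
      by (rule liftsE[OF l t x1])
    have "e1 \<cdot> (u \<cdot> s) = t \<cdot> c" using Comp_eq_Comp'[OF e1(2) P(2) e1' s(3)] s(4) by simp
    then show ?thesis by (rule liftsI[OF s(1,2) Comp_Hom[OF s(3) P(2)] _ t e1'])
  qed
  have zz: "x 2 \<cdot> e1 = Zero C P (X (Suc 2))" if "1 < n"
  proof (rule P(6))
    have x2: "x 2 \<in> Hom C (X 2) (X (Suc 2))" using xH[of 2] that by simp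
    note O = Hom_Ob[OF x2]
    show "x 2 \<cdot> e1 \<in> Hom C P (X (Suc 2))" using Comp_Hom e1' x2 by blast
    show "Zero C P (X (Suc 2)) \<in> Hom C P (X (Suc 2))" using Zero_Hom BO O by blast
    show "(x 2 \<cdot> e1) \<cdot> e = Zero C P (X (Suc 2)) \<cdot> e" using e1(3) x2 e1' P(1) O BO by (simp add: Hom_def)
    show "(x 2 \<cdot> e1) \<cdot> u = Zero C P (X (Suc 2)) \<cdot> u"
      using e1(2) x2 e1' P(2) O right_exact_cxD(2)[OF Xr that] by (simp add: Hom_def numeral_2_eq_2)
  qed
  have "right_exact_cx n ?X ?x"
    unfolding right_exact_cx_def
  proof (intro conjI allI impI ballI)
    fix k assume k: "k \<le> n"
    show "?x k \<in> Hom C (?X k) (?X (Suc k))"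
      using P e1' xH[OF k] by (auto simp: numeral_2_eq_2)
  next
    fix k assume k: "k < n"
    consider "k = 0" | "k = 1" | "k \<ge> 2" by linarith
    then show "?x (Suc k) \<cdot> ?x k = Zero C (?X k) (?X (Suc (Suc k)))"
    proof cases
      case 1 then show ?thesis using e1(3) by (simp add: numeral_2_eq_2)
    next
      case 2 then show ?thesis using zz k P(4) by (simp add: numeral_2_eq_2)
    next
      case 3 then show ?thesis using right_exact_cxD(2)[OF Xr k] by simp
    qed
  next
    fix k T t assume k: "k \<le> n" and t: "t \<in> Hom C T (?X (Suc k))"
      and t0: "k < n \<longrightarrow> ?x (Suc k) \<cdot> t = Zero C T (?X (Suc (Suc k)))"
    consider "k = 0" | "k = 1" | "k \<ge> 2" by linarith
    then show "lifts (?x k) t"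
    proof cases
      case 1 then show ?thesis using lift1[of t T] t t0 n P(4) by (simp add: numeral_2_eq_2)
    next
      case 2
      have "lifts (x k) t" using right_exact_cxD(3)[OF Xr k, of t T] t t0 2 by (simp add: numeral_2_eq_2)
      then show ?thesis using lift2[of t T] t 2 by (simp add: numeral_2_eq_2)
    next
      case 3 then show ?thesis using right_exact_cxD(3)[OF Xr k, of t T] t t0 by simp
    qed
  qed
  then show ex: "exact_cx n ?X ?x" using me by (simp add: exact_cx_def)
  show "chain_map n X x ?X ?x ?\<phi>"
    unfolding chain_map_def
  proof (intro conjI allI impI)
    fix k assume k: "k \<le> Suc n"
    show "?\<phi> k \<in> Hom C (X k) (?X k)" using h P Id_Hom[OF XO[OF k]] by simp
  next
    fix k assume k: "k \<le> n"
    consider "k = 0" | "k = 1" | "k \<ge> 2" by linarith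
    then show "?\<phi> (Suc k) \<cdot> x k = ?x k \<cdot> ?\<phi> k"
    proof cases
      case 1 then show ?thesis using P(3) by simp
    next
      case 2 then show ?thesis using e1(2) x1 XO[of "Suc 1"] n by (simp add: numeral_2_eq_2 Hom_def)
    next
      case 3 then show ?thesis using xH[OF k] XO[of k] XO[of "Suc k"] k by (simp add: Hom_def)
    qed
  qed
  show "\<exists>\<psi>'. chain_map n ?X ?x Y y \<psi>' \<and> \<psi>' 0 = k0 \<and> \<psi>' (Suc n) = \<psi> (Suc n)"
    if \<psi>: "chain_map n X x Y y \<psi>" and y: "\<And>k. k \<le> n \<Longrightarrow> y k \<in> Hom C (Y k) (Y (Suc k))"
      and yy: "y 1 \<cdot> y 0 = Zero C (Y 0) (Y 2)" and k0: "k0 \<in> Hom C B (Y 0)" "k0 \<cdot> h = \<psi> 0"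
  proof -
    note \<psi>H = chain_mapD(1)[OF \<psi>]
    have \<psi>': "\<psi> 0 \<in> Hom C (X 0) (Y 0)" "\<psi> 1 \<in> Hom C (X 1) (Y 1)" "\<psi> 2 \<in> Hom C (X 2) (Y 2)"
      using \<psi>H n by simp_all
    have y0: "y 0 \<in> Hom C (Y 0) (Y 1)" and y1: "y 1 \<in> Hom C (Y 1) (Y 2)"
      using y[of 0] y[of 1] n by (simp_all add: numeral_2_eq_2)
    note YO = Hom_Ob[OF y0] Hom_Ob[OF y1]
    have sq0: "\<psi> 1 \<cdot> x 0 = y 0 \<cdot> \<psi> 0" and sq1: "\<psi> 2 \<cdot> x 1 = y 1 \<cdot> \<psi> 1"
      using chain_mapD(2)[OF \<psi>, of 0] chain_mapD(2)[OF \<psi>, of 1] n by (simp_all add: numeral_2_eq_2)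
    have "(y 0 \<cdot> k0) \<cdot> h = \<psi> 1 \<cdot> x 0" using sq0 k0 y0 h by (simp add: Hom_def)
    from P(5)[OF Comp_Hom[OF k0(1) y0] \<psi>'(2) this] obtain w where
      w: "w \<in> Hom C P (Y 1)" "w \<cdot> e = y 0 \<cdot> k0" "w \<cdot> u = \<psi> 1" by blast
    have sq1': "\<psi> 2 \<cdot> e1 = y 1 \<cdot> w"
    proof (rule P(6))
      show "\<psi> 2 \<cdot> e1 \<in> Hom C P (Y 2)" "y 1 \<cdot> w \<in> Hom C P (Y 2)" using Comp_Hom \<psi>' e1' y1 w by blast+
      have "(y 1 \<cdot> w) \<cdot> e = y 1 \<cdot> (y 0 \<cdot> k0)" using w y1 P(1) by (simp add: Hom_def)
      also have "\<dots> = Zero C B (Y 2)" using Comp_eq_Comp'[OF yy y0 y1 k0(1)] k0(1) YO by (simp add: Hom_def)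
      also have "\<dots> = (\<psi> 2 \<cdot> e1) \<cdot> e" using e1(3) \<psi>'(3) e1' P(1) BO by (simp add: Hom_def)
      finally show "(\<psi> 2 \<cdot> e1) \<cdot> e = (y 1 \<cdot> w) \<cdot> e" by simp
      show "(\<psi> 2 \<cdot> e1) \<cdot> u = (y 1 \<cdot> w) \<cdot> u" using e1(2) sq1 w \<psi>'(3) e1' y1 P(2) by (simp add: Hom_def)
    qed
    let ?\<psi> = "\<psi>(0 := k0, 1 := w)"
    have "chain_map n ?X ?x Y y ?\<psi>"
      unfolding chain_map_def
    proof (intro conjI allI impI)
      fix k assume k: "k \<le> Suc n"
      show "?\<psi> k \<in> Hom C (?X k) (Y k)" using k0 w P \<psi>H[OF k] by simp
    next
      fix k assume k: "k \<le> n"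
      consider "k = 0" | "k = 1" | "k \<ge> 2" by linarith
      then show "?\<psi> (Suc k) \<cdot> ?x k = y k \<cdot> ?\<psi> k"
      proof cases
        case 1 then show ?thesis using w(2) by simp
      next
        case 2 then show ?thesis using sq1' by (simp add: numeral_2_eq_2)
      next
        case 3 then show ?thesis using chain_mapD(2)[OF \<psi> k] by simp
      qed
    qed
    then show ?thesis using n by (intro exI[of _ ?\<psi>]) simp
  qed
qed

subsection \<open>Morphisms of extensions\<close>

abbreviation ob :: "'b list \<Rightarrow> nat \<Rightarrow> 'a" where
  "ob \<equiv> seq_object C"

lemma exact_at_Hom:
  assumes "exact_at C f g"
  shows "f \<in> Arr C" "g \<in> Arr C" "Cod C f = Dom C g"
  using assms by (auto simp: exact_at_def is_image_def is_cokernel_def is_kernel_def)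

lemma lifts_zero:
  assumes "f \<in> Hom C X Y" "T \<in> Ob C"
  shows "lifts f (Zero C T Y)"
  using lifts_self[OF assms(1) Zero_Hom[OF assms(2) Hom_Ob(1)[OF assms(1)]]] assms by (simp add: Hom_def)

lemma exact_at_zero_left:
  assumes Z: "is_zero_object C Z" and f: "f \<in> Hom C A X"
  shows "exact_at C (Zero C Z A) f \<longleftrightarrow> is_mono C f"
proof -
  note O = Hom_Ob[OF f] zero_object_Hom(1)[OF Z]
  have z: "Zero C Z A \<in> Hom C Z A" using Zero_Hom O by blast
  have fz: "f \<cdot> Zero C Z A = Zero C Z X" using f O by (simp add: Hom_def)
  have l: "lifts (Zero C Z A) t \<longleftrightarrow> t = Zero C T A" if t: "t \<in> Hom C T A" for T t
  proof
    assume "lifts (Zero C Z A) t"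
    from liftsE[OF this t z] obtain T' e s
      where e: "is_epi C e" "e \<in> Hom C T' T" "s \<in> Hom C T' Z" "Zero C Z A \<cdot> s = t \<cdot> e" .
    show "t = Zero C T A" using epi_zeroD[OF e(1,2) t] e(3,4) O by (simp add: Hom_def)
  next
    assume "t = Zero C T A" then show "lifts (Zero C Z A) t" using lifts_zero[OF z Hom_Ob(1)[OF t]] by simp
  qed
  show ?thesis
  proof
    assume "exact_at C (Zero C Z A) f"
    then show "is_mono C f" using exact_at_iff[OF z f] l by (intro mono_zeroI[OF f]) blast
  next
    assume "is_mono C f"
    then show "exact_at C (Zero C Z A) f" using exact_at_iff[OF z f] l fz mono_zeroD[OF _ f] by blast
  qed
qed

lemma exact_at_zero_right:
  assumes Z: "is_zero_object C Z" and f: "f \<in> Hom C X M"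
  shows "exact_at C f (Zero C M Z) \<longleftrightarrow> (\<forall>T. \<forall>t\<in>Hom C T M. lifts f t)"
proof -
  note O = Hom_Ob[OF f] zero_object_Hom(1)[OF Z]
  have z: "Zero C M Z \<in> Hom C M Z" using Zero_Hom O by blast
  have "Zero C M Z \<cdot> t = Zero C T Z" if "t \<in> Hom C T M" for T t using that O by (simp add: Hom_def)
  then show ?thesis using exact_at_iff[OF f z] f by blast
qed

lemma extensions_nth:
  "E \<in> extensions C n M A \<longleftrightarrow> length E = Suc n \<and> Dom C (E ! 0) = A \<and> Cod C (E ! n) = M \<and>
    (\<exists>Z. is_zero_object C Z \<and> exact_at C (Zero C Z A) (E ! 0) \<and> (\<forall>k<n. exact_at C (E ! k) (E ! Suc k)) \<and>
       exact_at C (E ! n) (Zero C M Z))"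
proof (cases "length E = Suc n")
  case True
  have "E \<noteq> []" using True by auto
  then have hl: "hd E = E ! 0" "last E = E ! n" using True by (simp_all add: hd_conv_nth last_conv_nth)
  have "successively P (a # E @ [b]) \<longleftrightarrow> P a (E ! 0) \<and> (\<forall>k<n. P (E ! k) (E ! Suc k)) \<and> P (E ! n) b"
    (is "?L \<longleftrightarrow> ?R") for P :: "'b \<Rightarrow> 'b \<Rightarrow> bool" and a b
  proof
    assume ?L
    then have L: "P ((a # E @ [b]) ! i) ((a # E @ [b]) ! Suc i)" if "i < Suc (Suc n)" for i
      using that True by (simp add: successively_conv_nth)
    show ?R
    proof (intro conjI allI impI)
      show "P a (E ! 0)" using L[of 0] True by (simp add: nth_append)
      show "P (E ! n) b" using L[of "Suc n"] True by (simp add: nth_append)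
      fix k assume "k < n" then show "P (E ! k) (E ! Suc k)" using L[of "Suc k"] True by (simp add: nth_append)
    qed
  next
    assume R: ?R
    show ?L unfolding successively_conv_nth
    proof (intro allI impI)
      fix i assume i: "Suc i < length (a # E @ [b])"
      consider "i = 0" | k where "i = Suc k" "k < n" | "i = Suc n" using i True by (cases i) fastforce+
      then show "P ((a # E @ [b]) ! i) ((a # E @ [b]) ! Suc i)"
        using R True by cases (auto simp: nth_append)
    qed
  qed
  then show ?thesis unfolding extensions_def mem_Collect_eq hl using True by simp
qed (simp add: extensions_def)

lemma seq_object_simps [simp]:
  "ob E (Suc k) = Cod C (E ! k)" "E \<noteq> [] \<Longrightarrow> ob E 0 = Dom C (E ! 0)"
  by (simp_all add: seq_object_def hd_conv_nth)

text \<open>Extensions are lists, whereas the results on complexes speak of indexed families. The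
  two zero arrows in the definition account for monicity of the first arrow and for the lifting
  condition at the last index.\<close>

lemma extensions_iff:
  "E \<in> extensions C n M A \<longleftrightarrow> length E = Suc n \<and> exact_cx n (ob E) ((!) E) \<and>
     ob E 0 = A \<and> ob E (Suc n) = M" (is "?L \<longleftrightarrow> ?R")
proof
  assume L: ?L
  then have len: "length E = Suc n" and A: "Dom C (E ! 0) = A" and M: "Cod C (E ! n) = M" by (auto simp: extensions_nth)
  from L obtain Z where Z: "is_zero_object C Z" "exact_at C (Zero C Z A) (E ! 0)"
    "\<And>k. k < n \<Longrightarrow> exact_at C (E ! k) (E ! Suc k)" "exact_at C (E ! n) (Zero C M Z)"
    by (auto simp: extensions_nth)
  have ne: "E \<noteq> []" using len by auto
  have arr: "E ! k \<in> Arr C" if "k \<le> n" for k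
    using that exact_at_Hom(2)[OF Z(2)] exact_at_Hom(2)[OF Z(3)[of "k - 1"]] by (cases k) auto
  have H: "E ! k \<in> Hom C (ob E k) (ob E (Suc k))" if "k \<le> n" for k
    using that arr[OF that] ne exact_at_Hom(3)[OF Z(3)[of "k - 1"]] by (cases k) (auto simp: Hom_def)
  have H0: "E ! 0 \<in> Hom C A (ob E (Suc 0))" using H[of 0] A ne by simp
  have Hn: "E ! n \<in> Hom C (ob E n) M" using H[of n] M by simp
  have "is_mono C (E ! 0)" using exact_at_zero_left[OF Z(1) H0] Z(2) by simp
  moreover have "right_exact_cx n (ob E) ((!) E)"
    unfolding right_exact_cx_def
  proof (intro conjI allI impI ballI)
    fix k assume "k \<le> n" then show "E ! k \<in> Hom C (ob E k) (ob E (Suc k))" by (rule H)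
  next
    fix k assume k: "k < n"
    then show "E ! Suc k \<cdot> E ! k = Zero C (ob E k) (ob E (Suc (Suc k)))"
      using exact_at_iff[OF H[of k] H[of "Suc k"]] Z(3) by auto
  next
    fix k T t assume k: "k \<le> n" and t: "t \<in> Hom C T (ob E (Suc k))"
      "k < n \<longrightarrow> E ! Suc k \<cdot> t = Zero C T (ob E (Suc (Suc k)))"
    show "lifts (E ! k) t"
    proof (cases "k = n")
      case True
      then show ?thesis using exact_at_zero_right[OF Z(1) Hn] Z(4) t(1) M by auto
    next
      case False
      then have "k < n" using k by simp
      then show ?thesis using exact_at_iff[OF H[of k] H[of "Suc k"]] Z(3) t by auto
    qed
  qed
  ultimately show ?R using len A M ne by (simp add: exact_cx_def)
next
  assume R: ?R
  then have len: "length E = Suc n" and ex: "exact_cx n (ob E) ((!) E)" and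
    A: "ob E 0 = A" and M: "ob E (Suc n) = M" by auto
  have ne: "E \<noteq> []" using len by auto
  obtain Z where Z: "is_zero_object C Z" using ex_zero_object by blast
  note r = exact_cxD(1)[OF ex]
  note H = right_exact_cxD(1)[OF r]
  have H0: "E ! 0 \<in> Hom C A (ob E (Suc 0))" using H[of 0] A ne by simp
  have Hn: "E ! n \<in> Hom C (ob E n) M" using H[of n] M by simp
  have "exact_at C (Zero C Z A) (E ! 0)" using exact_at_zero_left[OF Z H0] exact_cxD(2)[OF ex] by simp
  moreover have "exact_at C (E ! k) (E ! Suc k)" if k: "k < n" for k
    unfolding exact_at_iff[OF H[OF less_imp_le[OF k]] H[OF Suc_leI[OF k]]]
    using right_exact_cxD(2)[OF r k] right_exact_cxD(3)[OF r less_imp_le[OF k]] by blast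
  moreover have "exact_at C (E ! n) (Zero C M Z)"
    unfolding exact_at_zero_right[OF Z Hn] using right_exact_cxD(3)[OF r, of n] M by auto
  ultimately show ?L unfolding extensions_nth using len A M ne Z by auto
qed

lemma extensionsD:
  assumes "E \<in> extensions C n M A"
  shows "length E = Suc n" "exact_cx n (ob E) ((!) E)" "right_exact_cx n (ob E) ((!) E)"
    "ob E 0 = A" "ob E (Suc n) = M"
    "k \<le> n \<Longrightarrow> E ! k \<in> Hom C (ob E k) (ob E (Suc k))" "A \<in> Ob C" "M \<in> Ob C"
proof -
  show *: "length E = Suc n" "exact_cx n (ob E) ((!) E)" "right_exact_cx n (ob E) ((!) E)"
    "ob E 0 = A" "ob E (Suc n) = M"
    using assms exact_cxD(1) by (auto simp: extensions_iff)
  show "k \<le> n \<Longrightarrow> E ! k \<in> Hom C (ob E k) (ob E (Suc k))"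
    by (rule right_exact_cxD(1)[OF *(3)])
  show "A \<in> Ob C" "M \<in> Ob C" using right_exact_cx_Ob[OF *(3), of 0] right_exact_cx_Ob[OF *(3), of "Suc n"] *(4,5)
    by simp_all
qed

lemma exact_cx_cong:
  assumes "exact_cx n X x" "\<And>k. k \<le> Suc n \<Longrightarrow> X' k = X k" "\<And>k. k \<le> n \<Longrightarrow> x' k = x k"
  shows "exact_cx n X' x'"
  using assms(1) unfolding exact_cx_def right_exact_cx_def by (simp add: assms(2,3))

lemma chain_map_cong:
  assumes "chain_map n X x Y y \<phi>" "\<And>k. k \<le> Suc n \<Longrightarrow> X' k = X k" "\<And>k. k \<le> n \<Longrightarrow> x' k = x k"
    "\<And>k. k \<le> Suc n \<Longrightarrow> Y' k = Y k" "\<And>k. k \<le> n \<Longrightarrow> y' k = y k"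
  shows "chain_map n X' x' Y' y' \<phi>"
  using assms unfolding chain_map_def by auto

text \<open>The way back from families to lists. Values beyond the relevant indices are lost, hence
  the bounded equations.\<close>

lemma ex_extension:
  assumes "exact_cx n X x"
  shows "\<exists>E \<in> extensions C n (X (Suc n)) (X 0). (\<forall>k\<le>Suc n. ob E k = X k) \<and> (\<forall>k\<le>n. E ! k = x k)"
proof -
  let ?E = "map x [0..<Suc n]"
  have nth: "?E ! k = x k" if "k \<le> n" for k
  proof -
    have "?E ! k = x ([0..<Suc n] ! k)" using that by (intro nth_map) simp
    then show ?thesis using that by (simp del: upt_Suc)
  qed
  note H = right_exact_cxD(1)[OF exact_cxD(1)[OF assms]]
  have o: "ob ?E k = X k" if "k \<le> Suc n" for k
  proof (cases k)
    case 0 then show ?thesis using nth[of 0] HomD(2)[OF H[of 0]] by (simp add: seq_object_def hd_conv_nth del: upt_Suc)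
  next
    case (Suc l) then show ?thesis using nth[of l] HomD(3)[OF H[of l]] that by (simp del: upt_Suc)
  qed
  have "exact_cx n (ob ?E) ((!) ?E)" by (rule exact_cx_cong[OF assms o nth])
  then have "?E \<in> extensions C n (X (Suc n)) (X 0)"
    unfolding extensions_iff using o by (simp del: upt_Suc seq_object_simps)
  then show ?thesis using nth o by blast
qed

text \<open>With an arbitrary left component \<open>h\<close>, one notion covers the Yoneda
  morphisms, where \<open>h\<close> is an identity, and the comparison of an extension with its
  pushforward along \<open>h\<close>.\<close>

definition ext_over :: "nat \<Rightarrow> 'a \<Rightarrow> 'b \<Rightarrow> 'b list \<Rightarrow> 'b list \<Rightarrow> bool" where
  "ext_over n M h E E' \<longleftrightarrow> (\<exists>\<phi>. chain_map n (ob E) ((!) E) (ob E') ((!) E') \<phi> \<and>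
     \<phi> 0 = h \<and> \<phi> (Suc n) = Id C M)"

lemma ext_overI:
  assumes "chain_map n (ob E) ((!) E) (ob E') ((!) E') \<phi>" "\<phi> 0 = h" "\<phi> (Suc n) = Id C M"
  shows "ext_over n M h E E'"
  using assms unfolding ext_over_def by blast

lemma ext_morphism_iff:
  "ext_morphism C n M A E E' \<longleftrightarrow> E \<in> extensions C n M A \<and> E' \<in> extensions C n M A \<and> ext_over n M (Id C A) E E'"
proof -
  have "(\<forall>k\<le>n. \<phi> k \<in> Hom C (Dom C (E ! k)) (Dom C (E' ! k)) \<and>
                 \<phi> (k + 1) \<in> Hom C (Cod C (E ! k)) (Cod C (E' ! k)) \<and>
                 \<phi> (k + 1) \<cdot> E ! k = E' ! k \<cdot> \<phi> k) \<longleftrightarrow>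
    chain_map n (ob E) ((!) E) (ob E') ((!) E') \<phi>" (is "?L \<longleftrightarrow> ?R")
    if E: "E \<in> extensions C n M A" and E': "E' \<in> extensions C n M A" for \<phi>
  proof -
    have d: "Dom C (E ! k) = ob E k" "Cod C (E ! k) = ob E (Suc k)"
      "Dom C (E' ! k) = ob E' k" "Cod C (E' ! k) = ob E' (Suc k)" if "k \<le> n" for k
      using HomD(2,3)[OF extensionsD(6)[OF E that]] HomD(2,3)[OF extensionsD(6)[OF E' that]] by auto
    show ?thesis
    proof
      assume L: ?L
      have "\<phi> k \<in> Hom C (ob E k) (ob E' k)" if "k \<le> Suc n" for k
        using L d[of k] d[of "k - 1"] that by (cases k) auto
      then show ?R unfolding chain_map_def using L by auto
    next
      assume R: ?R
      then show ?L using d chain_mapD[OF R] chain_mapD(1)[OF R, of "Suc k" for k] by simp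
    qed
  qed
  then show ?thesis unfolding ext_morphism_def ext_over_def by auto
qed

lemma ext_over_comp:
  assumes E: "E \<in> extensions C n M A" "E' \<in> extensions C n M A'" "E'' \<in> extensions C n M A''"
    and "ext_over n M h E E'" "ext_over n M h' E' E''"
  shows "ext_over n M (h' \<cdot> h) E E''"
proof -
  from assms obtain \<phi> \<psi> where \<phi>: "chain_map n (ob E) ((!) E) (ob E') ((!) E') \<phi>"
    "\<phi> 0 = h" "\<phi> (Suc n) = Id C M"
    and \<psi>: "chain_map n (ob E') ((!) E') (ob E'') ((!) E'') \<psi>"
    "\<psi> 0 = h'" "\<psi> (Suc n) = Id C M" unfolding ext_over_def by blast
  have "chain_map n (ob E) ((!) E) (ob E'') ((!) E'') (\<lambda>k. \<psi> k \<cdot> \<phi> k)"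
    by (rule chain_map_comp[OF \<phi>(1) \<psi>(1)]) (use extensionsD(6) E in blast)+
  then show ?thesis
    by (rule ext_overI) (use \<phi> \<psi> extensionsD(8)[OF E(1)] in simp_all)
qed

lemma ext_over_Hom:
  assumes "E \<in> extensions C n M A" "E' \<in> extensions C n M A'" "ext_over n M h E E'"
  shows "h \<in> Hom C A A'"
proof -
  from assms(3) obtain \<phi> where \<phi>: "chain_map n (ob E) ((!) E) (ob E') ((!) E') \<phi>" "\<phi> 0 = h"
    unfolding ext_over_def by blast
  show ?thesis using chain_mapD(1)[OF \<phi>(1), of 0] extensionsD(4)[OF assms(1)] extensionsD(4)[OF assms(2)] \<phi>(2) by simp
qed

section \<open>Yoneda equivalence and induction along zigzags\<close>

lemma ext_rel_mem:
  assumes "(E, E') \<in> ext_rel C n M A"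
  shows "E \<in> extensions C n M A" "E' \<in> extensions C n M A"
  using assms by (auto simp: ext_rel_def)

lemma ext_rel_refl: "E \<in> extensions C n M A \<Longrightarrow> (E, E) \<in> ext_rel C n M A"
  by (simp add: ext_rel_def)

lemma ext_rel_sym: "(E, E') \<in> ext_rel C n M A \<Longrightarrow> (E', E) \<in> ext_rel C n M A"
  by (auto simp: ext_rel_def intro: equivclp_sym)

lemma ext_rel_trans: "(E, E') \<in> ext_rel C n M A \<Longrightarrow> (E', E'') \<in> ext_rel C n M A \<Longrightarrow> (E, E'') \<in> ext_rel C n M A"
  by (auto simp: ext_rel_def intro: equivclp_trans)

lemma equiv_ext_rel: "equiv (extensions C n M A) (ext_rel C n M A)"
  by (rule equivI) (auto simp: refl_on_def sym_def trans_def ext_rel_refl dest: ext_rel_mem ext_rel_sym intro: ext_rel_trans)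

lemma ext_relI:
  assumes "E \<in> extensions C n M A" "E' \<in> extensions C n M A" "ext_over n M (Id C A) E E'"
  shows "(E, E') \<in> ext_rel C n M A"
  using assms r_into_equivclp[of "ext_morphism C n M A" E E'] unfolding ext_rel_def by (simp add: ext_morphism_iff)

text \<open>In \<open>bwd\<close> the morphism points against the direction of travel. The relation
  to the start \<open>E\<close> is carried along so that the current extension is known to have the
  right ends.\<close>

lemma ext_rel_induct [consumes 1, case_names base fwd bwd]:
  assumes "(E, E') \<in> ext_rel C n M A" and base: "P E"
    and fwd: "\<And>Y Z. \<lbrakk>(E, Y) \<in> ext_rel C n M A; Z \<in> extensions C n M A; ext_over n M (Id C A) Y Z; P Y\<rbrakk> \<Longrightarrow> P Z"
    and bwd: "\<And>Y Z. \<lbrakk>(E, Y) \<in> ext_rel C n M A; Z \<in> extensions C n M A; ext_over n M (Id C A) Z Y; P Y\<rbrakk> \<Longrightarrow> P Z"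
  shows "P E'"
proof -
  have E: "E \<in> extensions C n M A" using ext_rel_mem assms(1) by blast
  have "equivclp (ext_morphism C n M A) E E'" using assms(1) by (simp add: ext_rel_def)
  then have "(E, E') \<in> ext_rel C n M A \<and> P E'"
  proof (induction rule: equivclp_induct)
    case base
    then show ?case using ext_rel_refl[OF E] assms(2) by blast
  next
    case (step Y Z)
    then have Y: "(E, Y) \<in> ext_rel C n M A" "P Y" by auto
    from step(2) have Z: "Z \<in> extensions C n M A" by (auto simp: ext_morphism_iff)
    from step(2) consider "ext_over n M (Id C A) Y Z" | "ext_over n M (Id C A) Z Y"
      by (auto simp: ext_morphism_iff)
    then show ?case
    proof cases
      case 1
      then show ?thesis using fwd[OF Y(1) Z 1 Y(2)] ext_rel_trans[OF Y(1) ext_relI[OF _ Z 1]] ext_rel_mem[OF Y(1)] by blast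
    next
      case 2
      then show ?thesis using bwd[OF Y(1) Z 2 Y(2)] ext_rel_trans[OF Y(1) ext_rel_sym[OF ext_relI[OF Z _ 2]]]
          ext_rel_mem[OF Y(1)] by blast
    qed
  qed
  then show ?thesis by blast
qed

section \<open>Pushforward of extensions\<close>

lemma pushforward_props:
  assumes E: "E \<in> extensions C n M A" and n: "n \<ge> 1" and h: "h \<in> Hom C A B" and pf: "pushforward C h E E'"
  shows "E' \<in> extensions C n M B" "ext_over n M h E E'"
    "\<lbrakk>chain_map n (ob E) ((!) E) Y y \<psi>; \<And>k. k \<le> n \<Longrightarrow> y k \<in> Hom C (Y k) (Y (Suc k));
      y 1 \<cdot> y 0 = Zero C (Y 0) (Y 2); k0 \<in> Hom C B (Y 0); k0 \<cdot> h = \<psi> 0\<rbrakk> \<Longrightarrow>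
      \<exists>\<psi>'. chain_map n (ob E') ((!) E') Y y \<psi>' \<and> \<psi>' 0 = k0 \<and> \<psi>' (Suc n) = \<psi> (Suc n)"
proof -
  from pf obtain d d1 ds e e1 u where E': "E = d # d1 # ds" "E' = e # e1 # ds"
    and po: "is_pushout C h d e u" and e1: "e1 \<in> Hom C (Cod C e) (Cod C d1)"
     "e1 \<cdot> u = d1" "e1 \<cdot> e = Zero C (Dom C e) (Cod C d1)" unfolding pushforward_def by blast
  note X = extensionsD[OF E]
  have de: "Dom C e = B" using po h by (simp add: is_pushout_def Hom_def)
  let ?X = "(ob E)(0 := B, 1 := Cod C e)" and ?x = "((!) E)(0 := e, 1 := e1)"
  have ob: "ob E' k = ?X k" for k
  proof (cases k)
    case (Suc l)
    then show ?thesis using E' HomD(3)[OF e1(1)] by (cases l) (auto simp: nth_Cons split: nat.split)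
  qed (use de E' in simp)
  have ar: "E' ! k = ?x k" for k
  proof (cases k)
    case (Suc l)
    then show ?thesis using E' by (cases l) simp_all
  qed (use E' in simp)
  have h': "h \<in> Hom C (ob E 0) B" using h X(4) by simp
  have po': "is_pushout C h (E ! 0) e u" using po E' by simp
  have e1': "e1 \<in> Hom C (Cod C e) (ob E 2)" "e1 \<cdot> u = E ! 1" "e1 \<cdot> e = Zero C B (ob E 2)"
    using e1 E' de by (simp_all add: numeral_2_eq_2)
  note P = pushout_exact[OF X(2) n h' po' e1']
  have "exact_cx n (ob E') ((!) E')" by (rule exact_cx_cong[OF P(1) ob ar])
  moreover have "ob E' (Suc n) = M" using ob[of "Suc n"] n X(5) by simp
  ultimately show "E' \<in> extensions C n M B" unfolding extensions_iff using X(1) E' ob[of 0] by simp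
  show "ext_over n M h E E'"
  proof (rule ext_overI)
    show "chain_map n (ob E) ((!) E) (ob E') ((!) E') (\<lambda>k. if k = 0 then h else if k = 1 then u else Id C (ob E k))"
      by (rule chain_map_cong[OF P(2) _ _ ob ar]) auto
  qed (use n X(5) in auto)
  assume H: "chain_map n (ob E) ((!) E) Y y \<psi>" "\<And>k. k \<le> n \<Longrightarrow> y k \<in> Hom C (Y k) (Y (Suc k))"
      "y 1 \<cdot> y 0 = Zero C (Y 0) (Y 2)" "k0 \<in> Hom C B (Y 0)" "k0 \<cdot> h = \<psi> 0"
  obtain \<psi>' where \<psi>': "chain_map n ?X ?x Y y \<psi>'" "\<psi>' 0 = k0" "\<psi>' (Suc n) = \<psi> (Suc n)"
    using P(3)[OF H] by blast
  have "chain_map n (ob E') ((!) E') Y y \<psi>'" by (rule chain_map_cong[OF \<psi>'(1) ob ar]) auto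
  then show "\<exists>\<psi>'. chain_map n (ob E') ((!) E') Y y \<psi>' \<and> \<psi>' 0 = k0 \<and> \<psi>' (Suc n) = \<psi> (Suc n)"
    using \<psi>' by blast
qed

text \<open>The existence part of the universal property of the pushout, transferred to whole
  extensions.\<close>

lemma pushforward_universal:
  assumes E: "E \<in> extensions C n M A" and n: "n \<ge> 1" and h: "h \<in> Hom C A B" and pf: "pushforward C h E E'"
    and Y: "Y \<in> extensions C n M B'" and k: "k \<in> Hom C B B'" and ov: "ext_over n M (k \<cdot> h) E Y"
  shows "ext_over n M k E' Y"
proof -
  from ov obtain \<psi> where \<psi>: "chain_map n (ob E) ((!) E) (ob Y) ((!) Y) \<psi>" "\<psi> 0 = k \<cdot> h"
    "\<psi> (Suc n) = Id C M" unfolding ext_over_def by blast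
  note YD = extensionsD[OF Y]
  have "Y ! 1 \<cdot> Y ! 0 = Zero C (ob Y 0) (ob Y 2)"
    using right_exact_cxD(2)[OF YD(3), of 0] n by (simp add: numeral_2_eq_2)
  from pushforward_props(3)[OF E n h pf \<psi>(1) YD(6) this, where ?k0.0=k] k YD(4) \<psi> show ?thesis
    unfolding ext_over_def by auto
qed

lemma ex_pushforward:
  assumes E: "E \<in> extensions C n M A" and n: "n \<ge> 1" and h: "h \<in> Hom C A B"
  shows "\<exists>E'. pushforward C h E E'"
proof -
  note X = extensionsD[OF E]
  have "length E \<ge> 2" using X(1) n by simp
  then obtain d d1 ds where E': "E = d # d1 # ds" by (cases E rule: remdups_adj.cases) auto
  have d: "d \<in> Hom C A (Cod C d)" and d1: "d1 \<in> Hom C (Cod C d) (Cod C d1)"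
    using X(6)[of 0] X(6)[of 1] X(4) n E' by simp_all
  have dd: "d1 \<cdot> d = Zero C A (Cod C d1)" using right_exact_cxD(2)[OF X(3), of 0] X(4) n E' by simp
  obtain e u where po: "is_pushout C h d e u" using ex_pushout[OF h d] by blast
  obtain P where P: "e \<in> Hom C B P" "u \<in> Hom C (Cod C d) P" "P = Cod C e"
    "\<And>T x y. \<lbrakk>x \<in> Hom C B T; y \<in> Hom C (Cod C d) T; x \<cdot> h = y \<cdot> d\<rbrakk> \<Longrightarrow> \<exists>w. w \<in> Hom C P T \<and> w \<cdot> e = x \<and> w \<cdot> u = y"
    by (rule pushoutD[OF po h d]) (rule that; blast)
  note O = Hom_Ob[OF h] Hom_Ob[OF d1]
  have "Zero C B (Cod C d1) \<cdot> h = d1 \<cdot> d" using dd h O by (simp add: Hom_def)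
  from P(4)[OF Zero_Hom[OF O(2,4)] d1 this] obtain w
    where w: "w \<in> Hom C P (Cod C d1)" "w \<cdot> e = Zero C B (Cod C d1)" "w \<cdot> u = d1" by blast
  have "pushforward C h E (e # w # ds)" unfolding pushforward_def
    using E' po w P by (auto simp: Hom_def)
  then show ?thesis by blast
qed

lemma ext_over_Id_comp:
  assumes "E \<in> extensions C n M A" "E' \<in> extensions C n M B" "Y \<in> extensions C n M B"
    "ext_over n M h E E'" "ext_over n M (Id C B) E' Y"
  shows "ext_over n M h E Y"
proof -
  have "Id C B \<cdot> h = h" using Id_Comp[OF ext_over_Hom[OF assms(1,2,4)]] .
  then show ?thesis using ext_over_comp[OF assms] by simp
qed

lemma ext_over_comp_Id:
  assumes "E \<in> extensions C n M A" "E' \<in> extensions C n M A" "Y \<in> extensions C n M B"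
    "ext_over n M (Id C A) E E'" "ext_over n M h E' Y"
  shows "ext_over n M h E Y"
proof -
  have "h \<cdot> Id C A = h" using Comp_Id[OF ext_over_Hom[OF assms(2,3,5)]] .
  then show ?thesis using ext_over_comp[OF assms] by simp
qed

text \<open>The universal property is used with the identity as second arrow. Thus any target of a
  morphism over \<open>h\<close> represents the pushforward, and induced maps can be computed from
  arbitrary morphisms over \<open>h\<close>.\<close>

lemma pushforward_rel_target:
  assumes "E \<in> extensions C n M A" "n \<ge> 1" "h \<in> Hom C A B" "pushforward C h E E'" "Y \<in> extensions C n M B"
    "ext_over n M h E Y"
  shows "(E', Y) \<in> ext_rel C n M B"
proof (rule ext_relI[OF pushforward_props(1)[OF assms(1-4)] assms(5)])
  have "Id C B \<cdot> h = h" using Id_Comp[OF assms(3)] .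
  then show "ext_over n M (Id C B) E' Y"
    using pushforward_universal[OF assms(1-5) Id_Hom] Hom_Ob[OF assms(3)] assms(6) by simp
qed

lemma pushforward_cong:
  assumes "(E1, E2) \<in> ext_rel C n M A" and n: "n \<ge> 1" and h: "h \<in> Hom C A B"
    and "pushforward C h E1 E1'" "pushforward C h E2 E2'"
  shows "(E1', E2') \<in> ext_rel C n M B"
proof -
  note E1 = ext_rel_mem(1)[OF assms(1)]
  \<comment> \<open>A pushforward involves a choice of pushout, so the induction carries all of them
    at once.\<close>
  have "\<forall>E2'. pushforward C h E2 E2' \<longrightarrow> (E1', E2') \<in> ext_rel C n M B"
    using assms(1)
  proof (induction rule: ext_rel_induct)
    case base
    show ?case
    proof (intro allI impI)
      fix Y assume "pushforward C h E1 Y"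
      then show "(E1', Y) \<in> ext_rel C n M B"
        using pushforward_rel_target[OF E1 n h assms(4)] pushforward_props(1,2)[OF E1 n h] by blast
    qed
  next
    case (fwd Y Z)
    note Y = ext_rel_mem(2)[OF fwd(1)]
    obtain Y' where Y': "pushforward C h Y Y'" using ex_pushforward[OF Y n h] by blast
    show ?case
    proof (intro allI impI)
      fix Z' assume Z': "pushforward C h Z Z'"
      note P = pushforward_props(1,2)[OF fwd(2) n h Z']
      have "(Y', Z') \<in> ext_rel C n M B"
        by (rule pushforward_rel_target[OF Y n h Y' P(1) ext_over_comp_Id[OF Y fwd(2) P(1) fwd(3) P(2)]])
      then show "(E1', Z') \<in> ext_rel C n M B" using fwd(4) Y' ext_rel_trans by blast
    qed
  next
    case (bwd Y Z)
    note Y = ext_rel_mem(2)[OF bwd(1)]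
    obtain Y' where Y': "pushforward C h Y Y'" using ex_pushforward[OF Y n h] by blast
    note P = pushforward_props(1,2)[OF Y n h Y']
    show ?case
    proof (intro allI impI)
      fix Z' assume Z': "pushforward C h Z Z'"
      have "(Z', Y') \<in> ext_rel C n M B"
        by (rule pushforward_rel_target[OF bwd(2) n h Z' P(1) ext_over_comp_Id[OF bwd(2) Y P(1) bwd(3) P(2)]])
      then show "(E1', Z') \<in> ext_rel C n M B" using bwd(4) Y' ext_rel_trans ext_rel_sym by blast
    qed
  qed
  then show ?thesis using assms(5) by blast
qed

section \<open>Fibre products of extensions and lifting of zigzags\<close>

lemma ext_fiber_product:
  assumes F: "F \<in> extensions C n M B" and Y: "Y \<in> extensions C n M D" and X: "X \<in> extensions C n M A"
    and n: "n \<ge> 1" and g: "ext_over n M g F Y" "is_epi C g" and d: "ext_over n M d X Y"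
    and pb: "is_pullback C g d p q"
  shows "\<exists>H \<in> extensions C n M (Dom C p). ext_over n M p H F \<and> ext_over n M q H X"
proof -
  note FD = extensionsD[OF F] and YD = extensionsD[OF Y] and XD = extensionsD[OF X]
  obtain \<phi> where \<phi>: "chain_map n (ob F) ((!) F) (ob Y) ((!) Y) \<phi>" "\<phi> 0 = g"
    "\<phi> (Suc n) = Id C M" using g unfolding ext_over_def by blast
  obtain \<psi> where \<psi>: "chain_map n (ob X) ((!) X) (ob Y) ((!) Y) \<psi>" "\<psi> 0 = d"
    "\<psi> (Suc n) = Id C M" using d unfolding ext_over_def by blast
  have "\<exists>H h \<pi> \<rho>. exact_cx n H h \<and> H 0 = Dom C p \<and> H (Suc n) = M \<and>
     chain_map n H h (ob F) ((!) F) \<pi> \<and> \<pi> 0 = p \<and> \<pi> (Suc n) = Id C M \<and>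
     chain_map n H h (ob X) ((!) X) \<rho> \<and> \<rho> 0 = q \<and> \<rho> (Suc n) = Id C M"
  \<comment> \<open>For whole extensions the first arrows of \<open>X\<close> and \<open>Y\<close>
    are mono, so both kernel conditions of the fibre product hold trivially.\<close>
  proof (rule homotopy_fiber_product[OF FD(2) XD(3) YD(3) \<phi>(1) \<psi>(1) _ n FD(5) XD(5) YD(5) \<phi>(3) \<psi>(3)])
    show "is_epi C (\<phi> 0)" "is_pullback C (\<phi> 0) (\<psi> 0) p q" using \<phi> \<psi> g pb by simp_all
    have X0: "X ! 0 \<in> Hom C (ob X 0) (ob X 1)" and Y0: "Y ! 0 \<in> Hom C (ob Y 0) (ob Y 1)"
      using XD(6)[of 0] YD(6)[of 0] by simp_all
    fix T v assume v: "v \<in> Hom C T (ob X 0)" "X ! 0 \<cdot> v = Zero C T (ob X 1)"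
    show "v = Zero C T (ob X 0)" by (rule mono_zeroD[OF exact_cxD(2)[OF XD(2)] X0 v])
  next
    have X0: "X ! 0 \<in> Hom C (ob X 0) (ob X 1)" and Y0: "Y ! 0 \<in> Hom C (ob Y 0) (ob Y 1)"
      using XD(6)[of 0] YD(6)[of 0] by simp_all
    fix T d' assume v: "d' \<in> Hom C T (ob Y 0)" "Y ! 0 \<cdot> d' = Zero C T (ob Y 1)"
    have z: "d' = Zero C T (ob Y 0)" by (rule mono_zeroD[OF exact_cxD(2)[OF YD(2)] Y0 v])
    note O = Hom_Ob[OF v(1)] Hom_Ob[OF X0]
    have \<psi>0: "\<psi> 0 \<in> Hom C (ob X 0) (ob Y 0)" using chain_mapD(1)[OF \<psi>(1), of 0] by simp
    show "\<exists>T' e v. is_epi C e \<and> e \<in> Hom C T' T \<and> v \<in> Hom C T' (ob X 0) \<and>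
       X ! 0 \<cdot> v = Zero C T' (ob X 1) \<and> \<psi> 0 \<cdot> v = d' \<cdot> e"
      by (rule exI[of _ T], rule exI[of _ "Id C T"], rule exI[of _ "Zero C T (ob X 0)"])
         (use z O HomD[OF X0] HomD[OF \<psi>0] is_epi_Id Id_Hom Zero_Hom in \<open>simp del: seq_object_simps\<close>)
  qed simp
  then obtain H h \<pi> \<rho> where H: "exact_cx n H h" "H 0 = Dom C p" "H (Suc n) = M"
     "chain_map n H h (ob F) ((!) F) \<pi>" "\<pi> 0 = p" "\<pi> (Suc n) = Id C M"
     "chain_map n H h (ob X) ((!) X) \<rho>" "\<rho> 0 = q" "\<rho> (Suc n) = Id C M" by blast
  obtain G where G: "G \<in> extensions C n M (Dom C p)" "\<And>k. k \<le> Suc n \<Longrightarrow> ob G k = H k"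
    "\<And>k. k \<le> n \<Longrightarrow> G ! k = h k" using ex_extension[OF H(1)] H(2,3) by auto
  have "ext_over n M p G F" by (rule ext_overI[OF chain_map_cong[OF H(4) G(2,3)] H(5,6)]) auto
  moreover have "ext_over n M q G X" by (rule ext_overI[OF chain_map_cong[OF H(7) G(2,3)] H(8,9)]) auto
  ultimately show ?thesis using G(1) by blast
qed

text \<open>A morphism over an epi can follow its target through a zigzag, at the price of replacing
  its source by an equivalent one. Forward steps are compositions; backward steps are fibre
  products.\<close>

lemma zigzag_lift:
  assumes rel: "(Y, Y') \<in> ext_rel C n M D" and F: "F \<in> extensions C n M B" and n: "n \<ge> 1"
    and g: "ext_over n M g F Y" "is_epi C g"
  shows "\<exists>F'. (F, F') \<in> ext_rel C n M B \<and> ext_over n M g F' Y'"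
  using rel
proof (induction rule: ext_rel_induct)
  case base
  then show ?case using ext_rel_refl[OF F] g by blast
next
  case (fwd X Z)
  note X = ext_rel_mem(2)[OF fwd(1)]
  from fwd(4) obtain F' where F': "(F, F') \<in> ext_rel C n M B" "ext_over n M g F' X" by blast
  show ?case using ext_over_Id_comp[OF ext_rel_mem(2)[OF F'(1)] X fwd(2) F'(2) fwd(3)] F'(1) by blast
next
  case (bwd X Z)
  note X = ext_rel_mem(2)[OF bwd(1)]
  from bwd(4) obtain F' where F': "(F, F') \<in> ext_rel C n M B" "ext_over n M g F' X" by blast
  note F'E = ext_rel_mem(2)[OF F'(1)]
  note gH = ext_over_Hom[OF F'E X F'(2)]
  note O = Hom_Ob[OF gH]
  \<comment> \<open>The pullback along the identity of \<open>D\<close> is taken to be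
    \<open>B\<close> itself, so the fibre product maps to \<open>F'\<close> over the identity and is
    equivalent to it.\<close>
  have pb: "is_pullback C g (Id C D) (Id C B) g"
  proof (rule pullbackI[OF gH Id_Hom[OF O(2)] Id_Hom[OF O(1)] gH])
    fix T x y assume "x \<in> Hom C T B" "y \<in> Hom C T D" "g \<cdot> x = Id C D \<cdot> y"
    then show "\<exists>w. w \<in> Hom C T B \<and> Id C B \<cdot> w = x \<and> g \<cdot> w = y"
      by (intro exI[of _ x]) (simp add: Hom_def)
  qed (use HomD[OF gH] O in \<open>auto simp: Hom_def\<close>)
  have "Dom C (Id C B) = B" using O by simp
  with ext_fiber_product[OF F'E X bwd(2) n F'(2) g(2) bwd(3) pb] obtain H where
    H: "H \<in> extensions C n M B" "ext_over n M (Id C B) H F'" "ext_over n M g H Z" by auto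
  have "(F, H) \<in> ext_rel C n M B"
    by (rule ext_rel_trans[OF F'(1) ext_rel_sym[OF ext_relI[OF H(1) F'E H(2)]]])
  then show ?case using H(3) by blast
qed

subsection \<open>Splices and connecting maps\<close>

declare seq_object_simps [simp del]

lemma short_exact_iff:
  "short_exact C A B D f g \<longleftrightarrow> f \<in> Hom C A B \<and> g \<in> Hom C B D \<and> is_mono C f \<and> is_epi C g \<and> g \<cdot> f = Zero C A D \<and>
    (\<forall>T. \<forall>t\<in>Hom C T B. g \<cdot> t = Zero C T D \<longrightarrow> lifts f t)"
proof (cases "f \<in> Hom C A B \<and> g \<in> Hom C B D")
  case True
  then have f: "f \<in> Hom C A B" and g: "g \<in> Hom C B D" by auto
  let ?X = "ob [f, g]"
  have X: "?X 0 = A" "?X (Suc 0) = B" "?X (Suc (Suc 0)) = D" using HomD[OF f] HomD[OF g] by (simp_all add: seq_object_simps)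
  have e: "is_epi C g \<longleftrightarrow> (\<forall>T. \<forall>t\<in>Hom C T D. lifts g t)"
    using lifts_epi[OF _ g] epi_if_lifts[OF g] Id_Hom[OF Hom_Ob(2)[OF g]] by blast
  have "[f, g] \<in> extensions C 1 D A \<longleftrightarrow> is_mono C f \<and> right_exact_cx 1 ?X ((!) [f, g])"
    unfolding extensions_iff exact_cx_def using HomD[OF f] HomD[OF g] by (auto simp: seq_object_simps)
  moreover have "right_exact_cx 1 ?X ((!) [f, g]) \<longleftrightarrow> g \<cdot> f = Zero C A D \<and>
      (\<forall>T. \<forall>t\<in>Hom C T B. g \<cdot> t = Zero C T D \<longrightarrow> lifts f t) \<and> is_epi C g"
    unfolding right_exact_cx_def e using f g X by (simp add: le_Suc_eq all_conj_distrib)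
  ultimately show ?thesis using f g unfolding short_exact_def by auto
qed (auto simp: short_exact_def)

text \<open>A section of the last arrow allows the chain map to be \<open>s \<cdot> x n\<close> in
  degree \<open>n\<close> and zero between degrees 0 and \<open>n\<close>; it commutes because
  \<open>x n\<close> kills boundaries. In degree 0 any \<open>h\<close> killed by \<open>y 0\<close>
  may stand.\<close>

lemma chain_map_to_split:
  assumes X: "right_exact_cx n X x" and n: "n \<ge> 1" and y: "\<And>k. k \<le> n \<Longrightarrow> y k \<in> Hom C (Y k) (Y (Suc k))"
    and M: "X (Suc n) = M" "Y (Suc n) = M" and h: "h \<in> Hom C (X 0) (Y 0)" "y 0 \<cdot> h = Zero C (X 0) (Y 1)"
    and s: "s \<in> Hom C M (Y n)" "y n \<cdot> s = Id C M"
  shows "\<exists>\<phi>. chain_map n X x Y y \<phi> \<and> \<phi> 0 = h \<and> \<phi> (Suc n) = Id C M"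
proof -
  note XO = right_exact_cx_Ob[OF X] and xH = right_exact_cxD(1)[OF X]
  have YO: "Y k \<in> Ob C" if "k \<le> Suc n" for k
    using that Hom_Ob[OF y[of "k - 1"]] Hom_Ob[OF y[of 0]] by (cases k) simp_all
  define \<phi> where "\<phi> k = (if k = 0 then h else if k = Suc n then Id C M else if k = n then s \<cdot> x n else Zero C (X k) (Y k))" for k
  have xn: "x n \<in> Hom C (X n) M" and yn: "y n \<in> Hom C (Y n) M" using xH[of n] y[of n] M by simp_all
  have "chain_map n X x Y y \<phi>"
    unfolding chain_map_def
  proof (intro conjI allI impI)
    fix k assume k: "k \<le> Suc n"
    show "\<phi> k \<in> Hom C (X k) (Y k)"
      using h(1) M Id_Hom[OF XO[of "Suc n"]] Comp_Hom[OF xn s(1)] Zero_Hom[OF XO[OF k] YO[OF k]] by (simp add: \<phi>_def)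
  next
    fix k assume k: "k \<le> n"
    have k': "k \<le> Suc n" "Suc k \<le> Suc n" using k by auto
    note O = XO[OF k'(1)] YO[OF k'(1)] XO[OF k'(2)] YO[OF k'(2)]
    have yz: "y k \<cdot> \<phi> k = Zero C (X k) (Y (Suc k))" if "k < n"
      using that h y[OF k] O by (auto simp: \<phi>_def Hom_def)
    show "\<phi> (Suc k) \<cdot> x k = y k \<cdot> \<phi> k"
    proof (cases "k = n")
      case True
      have "y n \<cdot> (s \<cdot> x n) = Id C M \<cdot> x n" using Comp_eq_Comp'[OF s(2,1) yn xn] .
      then show ?thesis using True n by (simp add: \<phi>_def)
    next
      case False
      then have kn: "k < n" using k by simp
      have "\<phi> (Suc k) \<cdot> x k = Zero C (X k) (Y (Suc k))"
      proof (cases "Suc k = n")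
        case True
        have "x n \<cdot> x k = Zero C (X k) M" using right_exact_cxD(2)[OF X kn] True M by simp
        moreover have "(s \<cdot> x n) \<cdot> x k = s \<cdot> (x n \<cdot> x k)" using s(1) xn xH[OF k] True by (simp add: Hom_def)
        ultimately show ?thesis using True s(1) O M Hom_Ob[OF s(1)] by (simp add: \<phi>_def Hom_def)
      next
        case False
        then show ?thesis using kn xH[OF k] O by (simp add: \<phi>_def Hom_def)
      qed
      then show ?thesis using yz[OF kn] by simp
    qed
  qed
  then show ?thesis using n by (intro exI[of _ \<phi>]) (simp add: \<phi>_def)
qed

section \<open>Trivial extensions and the neutral class\<close>

lemma ex_trivial:
  assumes "A \<in> Ob C" "M \<in> Ob C"
  shows "\<exists>T. T \<in> trivial_extensions C n M A"
proof (cases "n = 1")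
  case True
  obtain P i j p q where "is_biproduct C A M P i j p q" using ex_biproduct[OF assms] by blast
  then have "[i, q] \<in> trivial_extensions C n M A" unfolding trivial_extensions_def using True by auto
  then show ?thesis by blast
next
  case False
  then show ?thesis using ex_zero_object unfolding trivial_extensions_def by auto
qed

lemma trivial_extension_1:
  assumes "T \<in> trivial_extensions C 1 M A"
  shows "T \<in> extensions C 1 M A \<and> (\<exists>s\<in>Hom C M (ob T 1). T ! 1 \<cdot> s = Id C M)"
proof -
  from assms obtain i q P j p where T: "T = [i, q]" and b: "is_biproduct C A M P i j p q"
    unfolding trivial_extensions_def by auto
  note bs = biproduct_simps[OF b]
  note O = Hom_Ob[OF bs(1)] Hom_Ob[OF bs(2)]
  have "short_exact C A P M i q"
    unfolding short_exact_iff
  proof (intro conjI allI ballI impI)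
    show "is_mono C i"
    proof (rule mono_zeroI[OF bs(1)])
      fix Z g assume g: "g \<in> Hom C Z A" "i \<cdot> g = Zero C Z P"
      show "g = Zero C Z A" using Comp_eq_Comp'[OF bs(5,1,3) g(1)] g bs(3) O Hom_Ob[OF g(1)] by (simp add: Hom_def)
    qed
    show "is_epi C q" by (rule split_epi[OF bs(4,2,6)])
    fix T t assume t: "t \<in> Hom C T P" "q \<cdot> t = Zero C T M"
    have pt: "p \<cdot> t \<in> Hom C T A" using t bs(3) Comp_Hom by blast
    have "t = i \<cdot> (p \<cdot> t)" using biproduct_expand[OF b t(1)] t(2) pt bs(1,2) Hom_Ob[OF t(1)] by (simp add: Hom_def)
    then show "lifts i t" using lifts_self[OF bs(1) pt] by simp
  qed (use bs in auto)
  then have "T \<in> extensions C 1 M A" unfolding short_exact_def T by simp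
  moreover have "j \<in> Hom C M (ob T 1)" using bs(2) HomD(3)[OF bs(1)] T by (simp add: seq_object_simps)
  ultimately show ?thesis using bs(6) T by auto
qed

lemma trivial_extension_ge_2:
  assumes n: "n \<ge> 2" and T: "T \<in> trivial_extensions C n M A" and O: "A \<in> Ob C" "M \<in> Ob C"
  shows "T \<in> extensions C n M A" "\<exists>s\<in>Hom C M (ob T n). T ! n \<cdot> s = Id C M" "ob T 1 = A"
    "T ! 0 = Id C A" "T ! 1 = Zero C A (ob T 2)"
proof -
  from T n obtain Z where Z: "is_zero_object C Z" and
    T': "T = Id C A # map2 (Zero C) (A # replicate (n - 2) Z) (replicate (n - 2) Z @ [M]) @ [Id C M]"
    unfolding trivial_extensions_def by auto
  note ZH = zero_object_Hom[OF Z]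
  \<comment> \<open>The objects are \<open>A, A, 0, ..., 0, M, M\<close>: index 1 is still
    \<open>A\<close> and index \<open>n\<close> is already \<open>M\<close>, with no zero object at
    all when \<open>n = 2\<close>.\<close>
  define X where "X k = (if k \<le> 1 then A else if k \<ge> n then M else Z)" for k :: nat
  define x where "x k = (if k = 0 then Id C A else if k = n then Id C M else Zero C (X k) (X (Suc k)))" for k
  have XO: "X k \<in> Ob C" for k using O ZH(1) by (simp add: X_def)
  have xH: "x k \<in> Hom C (X k) (X (Suc k))" if "k \<le> n" for k
    using that n XO[of k] XO[of "Suc k"] Zero_Hom Id_Hom O by (auto simp: x_def) (auto simp: X_def)
  have len: "length T = Suc n" using n T' by simp
  have nth: "T ! k = x k" if kn: "k \<le> n" for k
  proof -
    obtain m where m: "n = Suc (Suc m)" using n by (cases n rule: nat.exhaust; cases "n - 1") auto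
    consider "k = 0" | "k = n" | "0 < k" "k < n" using kn by linarith
    then show ?thesis
    proof cases
      case 1 then show ?thesis by (simp add: T' x_def)
    next
      case 2
      moreover have "n - Suc 0 = Suc (n - 2)" using n by simp
      ultimately show ?thesis using n unfolding T' by (simp add: x_def nth_Cons' nth_append)
    next
      case 3
      then obtain l where l: "k = Suc l" "l < n - 1" by (cases k) auto
      let ?a = "A # replicate (n - 2) Z" and ?b = "replicate (n - 2) Z @ [M]"
      have "T ! k = map2 (Zero C) ?a ?b ! l" using l m unfolding T' by (simp add: nth_append)
      also have "\<dots> = Zero C (?a ! l) (?b ! l)" using l(2) m by simp
      also have "?a ! l = X k" using l m by (cases l) (auto simp: X_def)
      also have "?b ! l = X (Suc k)" using l m by (auto simp: X_def nth_append)
      finally show ?thesis using l m by (simp add: x_def)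
    qed
  qed
  have ob: "ob T k = X k" if "k \<le> Suc n" for k
  proof (cases k)
    case 0 then show ?thesis using nth[of 0] HomD(2)[OF xH[of 0]] len by (simp add: seq_object_def hd_conv_nth[of T] flip: length_greater_0_conv)
  next
    case (Suc l) then show ?thesis using nth[of l] HomD(3)[OF xH[of l]] that by (simp add: seq_object_simps)
  qed
  have "right_exact_cx n X x"
    unfolding right_exact_cx_def
  proof (intro conjI allI impI ballI)
    fix k assume k: "k < n"
    have h: "x k \<in> Hom C (X k) (X (Suc k))" "x (Suc k) \<in> Hom C (X (Suc k)) (X (Suc (Suc k)))"
      using xH[of k] xH[of "Suc k"] k by auto
    \<comment> \<open>Only the first and the last arrow may be nonzero, and \<open>n \<ge> 2\<close>
      keeps these two from being adjacent.\<close>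
    have "x k = Zero C (X k) (X (Suc k)) \<or> x (Suc k) = Zero C (X (Suc k)) (X (Suc (Suc k)))"
      using k n by (auto simp: x_def)
    then show "x (Suc k) \<cdot> x k = Zero C (X k) (X (Suc (Suc k)))"
      using h XO by (auto simp: Hom_def)
  next
    fix k U t assume k: "k \<le> n" and t: "t \<in> Hom C U (X (Suc k))"
      and t0: "k < n \<longrightarrow> x (Suc k) \<cdot> t = Zero C U (X (Suc (Suc k)))"
    show "lifts (x k) t"
    proof (cases "k = 0 \<or> k = n")
      case True
      then have "x k = Id C (X k)" "X (Suc k) = X k" using n by (auto simp: x_def X_def)
      then show ?thesis using lifts_self[OF xH[OF k], of t U] t by (simp add: Hom_def)
    next
      case False
      have "t = Zero C U (X (Suc k))"
      proof (cases "Suc k = n")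
        case True
        then have "x (Suc k) = Id C M" "X (Suc k) = M" "X (Suc (Suc k)) = M" using n by (auto simp: x_def X_def)
        then show ?thesis using t0 t False k by (simp add: Hom_def)
      next
        case Z: False
        then have "X (Suc k) = Z" using False k by (auto simp: X_def)
        then show ?thesis using ZH(2)[of t U] t by simp
      qed
      then show ?thesis using lifts_zero[OF xH[OF k]] Hom_Ob[OF t] by simp
    qed
  qed (use xH in blast)
  moreover have "is_mono C (x 0)"
    using O by (auto simp: x_def is_mono_def Hom_def)
  ultimately have "exact_cx n X x" by (simp add: exact_cx_def)
  then have "exact_cx n (ob T) ((!) T)" by (rule exact_cx_cong[OF _ ob nth])
  then show "T \<in> extensions C n M A"
    unfolding extensions_iff using len ob n by (simp add: X_def)
  show "\<exists>s\<in>Hom C M (ob T n). T ! n \<cdot> s = Id C M"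
    using nth[of n] ob[of n] n O Id_Hom[OF O(2)] by (intro bexI[of _ "Id C M"]) (simp_all add: x_def X_def)
  show "ob T 1 = A" using ob[of 1] by (simp add: X_def)
  show "T ! 0 = Id C A" using nth[of 0] by (simp add: x_def)
  show "T ! 1 = Zero C A (ob T 2)" using nth[of 1] ob[of 2] n
    by (simp add: x_def X_def numeral_2_eq_2)
qed

lemma trivial_extension:
  assumes "n \<ge> 1" "T \<in> trivial_extensions C n M A" "A \<in> Ob C" "M \<in> Ob C"
  shows "T \<in> extensions C n M A" "\<exists>s\<in>Hom C M (ob T n). T ! n \<cdot> s = Id C M"
proof -
  have "T \<in> extensions C n M A \<and> (\<exists>s\<in>Hom C M (ob T n). T ! n \<cdot> s = Id C M)"
  proof (cases "n = 1")
    case True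
    then show ?thesis using trivial_extension_1[of T M A] assms by simp
  next
    case False
    then have "n \<ge> 2" using assms by simp
    then show ?thesis using trivial_extension_ge_2(1,2)[OF _ assms(2-4)] by blast
  qed
  then show "T \<in> extensions C n M A" "\<exists>s\<in>Hom C M (ob T n). T ! n \<cdot> s = Id C M" by auto
qed

text \<open>The last arrow of a trivial extension splits, so \<open>chain_map_to_split\<close>
  applies with zero in degree 0. With \<open>pushforward_rel_target\<close> this identifies
  pushforward along a zero arrow with the trivial extension.\<close>

lemma ext_over_zero_trivial:
  assumes E: "E \<in> extensions C n M A" and n: "n \<ge> 1" and T: "T \<in> trivial_extensions C n M D" and D: "D \<in> Ob C"
  shows "ext_over n M (Zero C A D) E T"
proof -
  note ED = extensionsD[OF E]
  note T' = trivial_extension[OF n T D ED(8)]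
  note TD = extensionsD[OF T'(1)]
  from T'(2) obtain s where s: "s \<in> Hom C M (ob T n)" "T ! n \<cdot> s = Id C M" by blast
  have T0: "T ! 0 \<in> Hom C D (ob T 1)" using TD(6)[of 0] TD(4) by simp
  note O = Hom_Ob[OF T0]
  have "\<exists>\<phi>. chain_map n (ob E) ((!) E) (ob T) ((!) T) \<phi> \<and> \<phi> 0 = Zero C A D \<and> \<phi> (Suc n) = Id C M"
  proof (rule chain_map_to_split[OF ED(3) n TD(6) ED(5) TD(5) _ _ s])
    show "Zero C A D \<in> Hom C (ob E 0) (ob T 0)" using ED(4,7) TD(4) Zero_Hom D by simp
    show "T ! 0 \<cdot> Zero C A D = Zero C (ob E 0) (ob T 1)"
      using T0 ED(4,7) O D by (simp add: Hom_def)
  qed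
  then show ?thesis unfolding ext_over_def by blast
qed

section \<open>Classes of extensions and induced maps\<close>

lemma Ext_carrier: "carrier (Ext C n M A) = extensions C n M A // ext_rel C n M A"
  by (simp add: Ext_def)

text \<open>All trivial extensions are equivalent, for every \<open>n\<close> at once: each of them
  represents the pushforward, along the arrow from a zero object to \<open>A\<close>, of one trivial
  extension by that zero object.\<close>

lemma Ext_one:
  assumes "n \<ge> 1" "T \<in> trivial_extensions C n M A" "A \<in> Ob C" "M \<in> Ob C"
  shows "\<one>\<^bsub>Ext C n M A\<^esub> = ext_rel C n M A `` {T}"
proof -
  have "(T, T') \<in> ext_rel C n M A" if T': "T' \<in> trivial_extensions C n M A" for T'
  proof -
    obtain Z where Z: "is_zero_object C Z" using ex_zero_object by blast
    note ZH = zero_object_Hom[OF Z]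
    obtain U where U: "U \<in> trivial_extensions C n M Z" using ex_trivial[OF ZH(1) assms(4)] by blast
    note UE = trivial_extension(1)[OF assms(1) U ZH(1) assms(4)]
    have h: "Zero C Z A \<in> Hom C Z A" using Zero_Hom ZH(1) assms(3) by blast
    obtain V where V: "pushforward C (Zero C Z A) U V" using ex_pushforward[OF UE assms(1) h] by blast
    have V': "(V, S) \<in> ext_rel C n M A" if "S \<in> trivial_extensions C n M A" for S
      using pushforward_rel_target[OF UE assms(1) h V trivial_extension(1)[OF assms(1) that assms(3,4)]
        ext_over_zero_trivial[OF UE assms(1) that assms(3)]] .
    show ?thesis by (rule ext_rel_trans[OF ext_rel_sym[OF V'[OF assms(2)]] V'[OF T']])
  qed
  then have "ext_rel C n M A `` trivial_extensions C n M A = ext_rel C n M A `` {T}"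
    using assms(2) ext_rel_trans by blast
  then show ?thesis by (simp add: Ext_def)
qed

lemma Ext_map_class:
  assumes E: "E \<in> extensions C n M A" and n: "n \<ge> 1" and h: "h \<in> Hom C A B" and pf: "pushforward C h E E'"
  shows "Ext_map C n M h (ext_rel C n M A `` {E}) = ext_rel C n M B `` {E'}"
proof -
  have "(E', F') \<in> ext_rel C n M B" if "(E, F) \<in> ext_rel C n M A" "pushforward C h F F'" for F F'
    using pushforward_cong[OF that(1) n h pf that(2)] .
  then show ?thesis unfolding Ext_map_def HomD(3)[OF h]
    using ext_rel_refl[OF E] pf ext_rel_trans by blast
qed

lemma ext_class_eq_iff:
  assumes "E \<in> extensions C n M A" "E' \<in> extensions C n M A"
  shows "ext_rel C n M A `` {E} = ext_rel C n M A `` {E'} \<longleftrightarrow> (E, E') \<in> ext_rel C n M A"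
  by (rule eq_equiv_class_iff[OF equiv_ext_rel assms])

text \<open>The splice replaces \<open>g\<close> and \<open>E ! 0\<close> by their composite. It is
  exact at \<open>B\<close> because the mono \<open>E ! 0\<close> does not change the kernel of
  \<open>g\<close>, and at the next object because the epi \<open>g\<close> does not change the
  image of \<open>E ! 0\<close>.\<close>

lemma splice_exact:
  assumes S: "short_exact C A B D f g" and E: "E \<in> extensions C n M D"
  shows "\<exists>V \<in> extensions C (Suc n) M A. V ! 0 = f \<and> V ! 1 = E ! 0 \<cdot> g \<and> ob V 1 = B \<and>
    (\<forall>k. 1 \<le> k \<and> k \<le> n \<longrightarrow> V ! Suc k = E ! k) \<and> (\<forall>k. 1 \<le> k \<and> k \<le> Suc n \<longrightarrow> ob V (Suc k) = ob E k)"
proof -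
  note ED = extensionsD[OF E]
  have f: "f \<in> Hom C A B" and g: "g \<in> Hom C B D" and mf: "is_mono C f" and eg: "is_epi C g"
    and gf: "g \<cdot> f = Zero C A D" and l: "\<And>T t. t \<in> Hom C T B \<Longrightarrow> g \<cdot> t = Zero C T D \<Longrightarrow> lifts f t"
    using S unfolding short_exact_iff by blast+
  define X where "X k = (if k = 0 then A else if k = 1 then B else ob E (k - 1))" for k
  define x where "x k = (if k = 0 then f else if k = 1 then E ! 0 \<cdot> g else E ! (k - 1))" for k
  have X_simps: "X 0 = A" "X (Suc 0) = B" "X (Suc (Suc k)) = ob E (Suc k)" for k by (simp_all add: X_def)
  have x_simps: "x 0 = f" "x (Suc 0) = E ! 0 \<cdot> g" "x (Suc (Suc k)) = E ! Suc k" for k by (simp_all add: x_def)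
  have E0: "E ! 0 \<in> Hom C D (ob E (Suc 0))" using ED(6)[of 0] ED(4) by simp
  note O = Hom_Ob[OF f] Hom_Ob[OF E0]
  have E0g: "E ! 0 \<cdot> g \<in> Hom C B (ob E (Suc 0))" using Comp_Hom[OF g E0] .
  have xH: "x k \<in> Hom C (X k) (X (Suc k))" if k: "k \<le> Suc n" for k
  proof -
    consider "k = 0" | "k = 1" | l where "k = Suc (Suc l)" by (metis One_nat_def nat.exhaust)
    then show ?thesis
    proof cases
      case 1 then show ?thesis using f by (simp add: x_simps X_simps)
    next
      case 2 then show ?thesis using E0g by (simp add: x_simps X_simps)
    next
      case 3 then show ?thesis using ED(6)[of "Suc l"] k by (simp add: x_simps X_simps)
    qed
  qed
  have "right_exact_cx (Suc n) X x"
    unfolding right_exact_cx_def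
  proof (intro conjI allI impI ballI)
    fix k assume k: "k < Suc n"
    consider "k = 0" | "k = 1" | l where "k = Suc (Suc l)" by (metis One_nat_def nat.exhaust)
    then show "x (Suc k) \<cdot> x k = Zero C (X k) (X (Suc (Suc k)))"
    proof cases
      case 1 then show ?thesis using f g gf E0 O by (simp add: x_simps X_simps Hom_def)
    next
      case 2
      then have n0: "0 < n" using k by simp
      have E1: "E ! Suc 0 \<in> Hom C (ob E (Suc 0)) (ob E (Suc (Suc 0)))" using ED(6)[of 1] n0 by simp
      have "E ! Suc 0 \<cdot> E ! 0 = Zero C D (ob E (Suc (Suc 0)))"
        using right_exact_cxD(2)[OF ED(3) n0] ED(4) by simp
      from Comp_eq_Comp'[OF this E0 E1 g] show ?thesis using 2 g Hom_Ob[OF E1]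
        by (simp add: x_simps X_simps Hom_def)
    next
      case 3 then show ?thesis using right_exact_cxD(2)[OF ED(3), of "Suc l"] k
        by (simp add: x_simps X_simps)
    qed
  next
    fix k T t assume k: "k \<le> Suc n" and t: "t \<in> Hom C T (X (Suc k))"
      and t0: "k < Suc n \<longrightarrow> x (Suc k) \<cdot> t = Zero C T (X (Suc (Suc k)))"
    consider "k = 0" | "k = 1" | l where "k = Suc (Suc l)" by (metis One_nat_def nat.exhaust)
    then show "lifts (x k) t"
    proof cases
      case 1
      have t': "t \<in> Hom C T B" "(E ! 0 \<cdot> g) \<cdot> t = Zero C T (ob E (Suc 0))"
        using t t0 1 by (simp_all add: x_simps X_simps)
      then have "E ! 0 \<cdot> (g \<cdot> t) = Zero C T (ob E (Suc 0))" using E0 g by (simp add: Hom_def)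
      then have "g \<cdot> t = Zero C T D" by (rule mono_zeroD[OF exact_cxD(2)[OF ED(2)] E0 Comp_Hom[OF t'(1) g]])
      then show ?thesis using l[OF t'(1)] 1 by (simp add: x_simps)
    next
      case 2
      have t': "t \<in> Hom C T (ob E (Suc 0))" using t 2 by (simp add: X_simps)
      have "lifts (E ! 0) t"
        by (rule right_exact_cxD(3)[OF ED(3) _ t']) (use t0 2 in \<open>simp_all add: x_simps X_simps\<close>)
      from liftsE[OF this t' E0] obtain T' e s where e: "is_epi C e" "e \<in> Hom C T' T" "s \<in> Hom C T' D" "E ! 0 \<cdot> s = t \<cdot> e" .
      obtain T'' e' r where r: "is_epi C e'" "e' \<in> Hom C T'' T'" "r \<in> Hom C T'' B" "g \<cdot> r = s \<cdot> e'"
        by (rule liftsE[OF lifts_epi[OF eg g e(3)] e(3) g])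
      have "lifts (E ! 0 \<cdot> g) t"
      proof (rule liftsI[OF _ _ r(3) _ t' E0g])
        show "is_epi C (e \<cdot> e')" using is_epi_comp[OF r(1) e(1)] r e by (simp add: Hom_def)
        show "e \<cdot> e' \<in> Hom C T'' T" using r e Comp_Hom by blast
        have "(E ! 0 \<cdot> g) \<cdot> r = E ! 0 \<cdot> (s \<cdot> e')" unfolding r(4)[symmetric] by (rule Comp_assoc[OF r(3) g E0])
        also have "\<dots> = t \<cdot> (e \<cdot> e')" by (rule Comp_eq_Comp[OF e(4,3) E0 e(2) t' r(2)])
        finally show "(E ! 0 \<cdot> g) \<cdot> r = t \<cdot> (e \<cdot> e')" .
      qed
      then show ?thesis using 2 by (simp add: x_simps)
    next
      case 3
      have t': "t \<in> Hom C T (ob E (Suc (Suc l)))" using t 3 by (simp add: X_simps)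
      have "lifts (E ! Suc l) t"
        by (rule right_exact_cxD(3)[OF ED(3) _ t']) (use t0 3 k in \<open>simp_all add: x_simps X_simps\<close>)
      then show ?thesis using 3 by (simp add: x_simps)
    qed
  qed (rule xH)
  then have "exact_cx (Suc n) X x" using mf by (simp add: exact_cx_def x_simps)
  from ex_extension[OF this] obtain V where V: "V \<in> extensions C (Suc n) (X (Suc (Suc n))) (X 0)"
    "\<And>k. k \<le> Suc (Suc n) \<Longrightarrow> ob V k = X k" "\<And>k. k \<le> Suc n \<Longrightarrow> V ! k = x k" by blast
  have "V \<in> extensions C (Suc n) M A" using V(1) ED(5) by (simp add: X_simps)
  moreover have "V ! 0 = f" "V ! 1 = E ! 0 \<cdot> g" "ob V 1 = B"
    using V(2)[of 1] V(3)[of 0] V(3)[of 1] by (simp_all add: x_simps X_simps)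
  moreover have "V ! Suc k = E ! k" if "1 \<le> k" "k \<le> n" for k
    using V(3)[of "Suc k"] that by (simp add: x_def)
  moreover have "ob V (Suc k) = ob E k" if "1 \<le> k" "k \<le> Suc n" for k
    using V(2)[of "Suc k"] that by (simp add: X_def)
  ultimately show ?thesis by blast
qed

section \<open>Tails of extensions and their coverings\<close>

lemma tail_right_exact:
  assumes "X \<in> extensions C (Suc n) M A"
  shows "right_exact_cx n (\<lambda>k. ob X (Suc k)) (\<lambda>k. X ! Suc k)"
  unfolding right_exact_cx_def
proof (intro conjI allI impI ballI)
  note r = extensionsD(3)[OF assms]
  fix k
  show "X ! Suc k \<in> Hom C (ob X (Suc k)) (ob X (Suc (Suc k)))" if "k \<le> n"
    using right_exact_cxD(1)[OF r, of "Suc k"] that by simp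
  show "X ! Suc (Suc k) \<cdot> X ! Suc k = Zero C (ob X (Suc k)) (ob X (Suc (Suc (Suc k))))" if "k < n"
    using right_exact_cxD(2)[OF r, of "Suc k"] that by simp
  fix T t assume "k \<le> n" "t \<in> Hom C T (ob X (Suc (Suc k)))"
    "k < n \<longrightarrow> X ! Suc (Suc k) \<cdot> t = Zero C T (ob X (Suc (Suc (Suc k))))"
  then show "lifts (X ! Suc k) t" using right_exact_cxD(3)[OF r, of "Suc k" t T] by simp
qed

text \<open>For a splice \<open>X\<close> of \<open>0 \<rightarrow> A \<rightarrow> B \<rightarrow> D \<rightarrow> 0\<close> with \<open>E\<close>, this says that \<open>E\<close> comes from
  \<open>Ext\<^sup>n(M, B)\<close>; unlike that condition it can be transported along morphisms of extensions.\<close>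

definition tail_covered :: "nat \<Rightarrow> 'a \<Rightarrow> 'b list \<Rightarrow> bool" where
  "tail_covered n M X \<longleftrightarrow> (\<exists>F \<in> extensions C n M (ob X 1).
     \<exists>\<phi>. chain_map n (ob F) ((!) F) (\<lambda>k. ob X (Suc k)) (\<lambda>k. X ! Suc k) \<phi> \<and>
       \<phi> 0 = Id C (ob X 1) \<and> \<phi> (Suc n) = Id C M)"

lemma chain_map_tail:
  assumes "chain_map (Suc n) X x Y y \<phi>"
  shows "chain_map n (\<lambda>k. X (Suc k)) (\<lambda>k. x (Suc k)) (\<lambda>k. Y (Suc k)) (\<lambda>k. y (Suc k)) (\<lambda>k. \<phi> (Suc k))"
  using assms unfolding chain_map_def by auto

text \<open>The covering is pushed forward along the degree 1 component of the morphism. The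
  composite chain map to the tail of \<open>Y\<close> has this component in degree 0, so it extends
  over the pushforward with the identity there.\<close>

lemma tail_covered_forward:
  assumes X: "X \<in> extensions C (Suc n) M A" and Y: "Y \<in> extensions C (Suc n) M A" and n: "n \<ge> 1"
    and ov: "ext_over (Suc n) M (Id C A) X Y" and tc: "tail_covered n M X"
  shows "tail_covered n M Y"
proof -
  let ?B = "ob X 1" and ?D = "ob Y 1"
  let ?tX = "\<lambda>k. ob X (Suc k)" and ?tx = "\<lambda>k. X ! Suc k"
  let ?tY = "\<lambda>k. ob Y (Suc k)" and ?ty = "\<lambda>k. Y ! Suc k"
  from tc obtain F \<phi> where F: "F \<in> extensions C n M ?B"
    and \<phi>: "chain_map n (ob F) ((!) F) ?tX ?tx \<phi>" "\<phi> 0 = Id C ?B" "\<phi> (Suc n) = Id C M"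
    unfolding tail_covered_def by blast
  from ov obtain \<psi> where \<psi>: "chain_map (Suc n) (ob X) ((!) X) (ob Y) ((!) Y) \<psi>"
    "\<psi> (Suc (Suc n)) = Id C M" unfolding ext_over_def by blast
  note rX = tail_right_exact[OF X] and rY = tail_right_exact[OF Y]
  have b: "\<psi> 1 \<in> Hom C ?B ?D" using chain_mapD(1)[OF \<psi>(1), of 1] by simp
  note O = Hom_Ob[OF b]
  have c: "chain_map n (ob F) ((!) F) ?tY ?ty (\<lambda>k. \<psi> (Suc k) \<cdot> \<phi> k)"
    by (rule chain_map_comp[OF \<phi>(1) chain_map_tail[OF \<psi>(1)], OF extensionsD(6)[OF F] right_exact_cxD(1)[OF rX] right_exact_cxD(1)[OF rY]])
  obtain F' where F': "pushforward C (\<psi> 1) F F'" using ex_pushforward[OF F n b] by blast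
  have "?ty 1 \<cdot> ?ty 0 = Zero C (?tY 0) (?tY 2)"
    using right_exact_cxD(2)[OF rY, of 0] n by (simp add: numeral_2_eq_2)
  moreover have "Id C ?D \<in> Hom C ?D (?tY 0)" using Id_Hom[OF O(2)] by simp
  moreover have "Id C ?D \<cdot> \<psi> 1 = \<psi> (Suc 0) \<cdot> \<phi> 0"
    using b O \<phi>(2) by (simp add: Hom_def)
  ultimately obtain \<chi> where "chain_map n (ob F') ((!) F') ?tY ?ty \<chi>" "\<chi> 0 = Id C ?D"
    "\<chi> (Suc n) = \<psi> (Suc (Suc n)) \<cdot> \<phi> (Suc n)"
    using pushforward_props(3)[OF F n b F' c, OF right_exact_cxD(1)[OF rY]] by blast
  moreover have "\<psi> (Suc (Suc n)) \<cdot> \<phi> (Suc n) = Id C M" using \<psi>(2) \<phi>(3) extensionsD(8)[OF X] by simp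
  ultimately show ?thesis using pushforward_props(1)[OF F n b F'] unfolding tail_covered_def by auto
qed

text \<open>The covering is pulled back along the map of tails. In both tails the first arrow has
  kernel \<open>A\<close>. Since the morphism is the identity on \<open>A\<close>, it matches the
  two kernels, which yields the conditions \<open>ker\<close> and \<open>jm\<close> of
  \<open>homotopy_fiber_product\<close>.\<close>

lemma tail_covered_backward:
  assumes X: "X \<in> extensions C (Suc n) M A" and Y: "Y \<in> extensions C (Suc n) M A" and n: "n \<ge> 1"
    and ov: "ext_over (Suc n) M (Id C A) X Y" and tc: "tail_covered n M Y"
  shows "tail_covered n M X"
proof -
  let ?B = "ob X 1" and ?D = "ob Y 1"
  let ?tX = "\<lambda>k. ob X (Suc k)" and ?tx = "\<lambda>k. X ! Suc k"
  let ?tY = "\<lambda>k. ob Y (Suc k)" and ?ty = "\<lambda>k. Y ! Suc k"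
  note XD = extensionsD[OF X] and YD = extensionsD[OF Y]
  from tc obtain F \<phi> where F: "F \<in> extensions C n M ?D"
    and \<phi>: "chain_map n (ob F) ((!) F) ?tY ?ty \<phi>" "\<phi> 0 = Id C ?D" "\<phi> (Suc n) = Id C M"
    unfolding tail_covered_def by blast
  from ov obtain \<psi> where \<psi>: "chain_map (Suc n) (ob X) ((!) X) (ob Y) ((!) Y) \<psi>"
    "\<psi> 0 = Id C A" "\<psi> (Suc (Suc n)) = Id C M" unfolding ext_over_def by blast
  note FD = extensionsD[OF F]
  note rX = tail_right_exact[OF X] and rY = tail_right_exact[OF Y]
  have b: "\<psi> 1 \<in> Hom C ?B ?D" using chain_mapD(1)[OF \<psi>(1), of 1] by simp
  note O = Hom_Ob[OF b]
  have X0: "X ! 0 \<in> Hom C A ?B" using XD(6)[of 0] XD(4) by simp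
  have Y0: "Y ! 0 \<in> Hom C A ?D" using YD(6)[of 0] YD(4) by simp
  have X1: "X ! 1 \<in> Hom C ?B (?tX 1)" and Y1: "Y ! 1 \<in> Hom C ?D (?tY 1)"
    using XD(6)[of 1] YD(6)[of 1] n by simp_all
  have X10: "X ! 1 \<cdot> X ! 0 = Zero C A (?tX 1)"
    using right_exact_cxD(2)[OF XD(3), of 0] XD(4) by simp
  have sq: "\<psi> 1 \<cdot> X ! 0 = Y ! 0" using chain_mapD(2)[OF \<psi>(1), of 0] \<psi>(2) Y0 XD(7) by (simp add: Hom_def)
  have "\<exists>H h \<pi> \<rho>. exact_cx n H h \<and> H 0 = ?B \<and> H (Suc n) = M \<and>
     chain_map n H h (ob F) ((!) F) \<pi> \<and> \<pi> 0 = \<psi> 1 \<and> \<pi> (Suc n) = Id C M \<and>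
     chain_map n H h ?tX ?tx \<rho> \<and> \<rho> 0 = Id C ?B \<and> \<rho> (Suc n) = Id C M"
  proof (rule homotopy_fiber_product[OF FD(2) rX rY \<phi>(1) chain_map_tail[OF \<psi>(1)] _ n FD(5) XD(5) YD(5) \<phi>(3) \<psi>(3)])
    show "is_epi C (\<phi> 0)" using \<phi>(2) is_epi_Id O by simp
    show "?B = Dom C (\<psi> 1)" using b by (simp add: Hom_def)
    \<comment> \<open>The covering is the identity in degree 0, so the pullback there is
      \<open>?B\<close> and the fibre product is again an extension by \<open>?B\<close>.\<close>
    have "is_pullback C (Id C ?D) (\<psi> 1) (\<psi> 1) (Id C ?B)"
    proof (rule pullbackI[OF Id_Hom[OF O(2)] b b Id_Hom[OF O(1)]])
      fix T x y assume "x \<in> Hom C T ?D" "y \<in> Hom C T ?B" "Id C ?D \<cdot> x = \<psi> 1 \<cdot> y"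
      then show "\<exists>w. w \<in> Hom C T ?B \<and> \<psi> 1 \<cdot> w = x \<and> Id C ?B \<cdot> w = y"
        by (intro exI[of _ y]) (simp add: Hom_def)
    qed (use b O in \<open>auto simp: Hom_def\<close>)
    then show "is_pullback C (\<phi> 0) (\<psi> (Suc 0)) (\<psi> 1) (Id C ?B)" using \<phi>(2) by simp
  next
    \<comment> \<open>Injectivity on kernels: after an epi, \<open>v\<close> comes from some
      \<open>s\<close> in \<open>A\<close>, and the mono \<open>Y ! 0\<close> sends \<open>s\<close>
      to the image of \<open>v\<close> in \<open>?D\<close>, which is zero.\<close>
    fix T v assume "v \<in> Hom C T (?tX 0)" "?tx 0 \<cdot> v = Zero C T (?tX 1)" "\<psi> (Suc 0) \<cdot> v = Zero C T (?tY 0)"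
    then have v: "v \<in> Hom C T ?B" "X ! 1 \<cdot> v = Zero C T (?tX 1)" "\<psi> 1 \<cdot> v = Zero C T ?D"
      by simp_all
    have "lifts (X ! 0) v" using right_exact_cxD(3)[OF XD(3), of 0 v T] v by simp
    from liftsE[OF this v(1) X0] obtain T' e s where e: "is_epi C e" "e \<in> Hom C T' T" "s \<in> Hom C T' A" "X ! 0 \<cdot> s = v \<cdot> e" .
    have "Y ! 0 \<cdot> s = \<psi> 1 \<cdot> (v \<cdot> e)" using Comp_eq_Comp'[OF sq X0 b e(3)] e(4) by simp
    also have "\<dots> = Zero C T' ?D" using Comp_eq_Comp'[OF v(3,1) b e(2)] e(2) O by (simp add: Hom_def)
    finally have "s = Zero C T' A" by (rule mono_zeroD[OF exact_cxD(2)[OF YD(2)] Y0 e(3)])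
    then have "v \<cdot> e = Zero C T' ?B" using e(3,4) X0 Hom_Ob[OF e(3)] by (simp add: Hom_def)
    then show "v = Zero C T (?tX 0)" using epi_zeroD[OF e(1,2) v(1)] by simp
  next
    \<comment> \<open>Surjectivity on kernels: after an epi, \<open>d\<close> comes from some
      \<open>s\<close> in \<open>A\<close>, and \<open>X ! 0 \<cdot> s\<close> is the required
      element.\<close>
    fix T d assume "d \<in> Hom C T (?tY 0)" "?ty 0 \<cdot> d = Zero C T (?tY 1)"
    then have d: "d \<in> Hom C T ?D" "Y ! 1 \<cdot> d = Zero C T (?tY 1)" by simp_all
    have "lifts (Y ! 0) d" using right_exact_cxD(3)[OF YD(3), of 0 d T] d by simp
    from liftsE[OF this d(1) Y0] obtain T' e s where e: "is_epi C e" "e \<in> Hom C T' T" "s \<in> Hom C T' A" "Y ! 0 \<cdot> s = d \<cdot> e" .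
    have 1: "X ! 0 \<cdot> s \<in> Hom C T' ?B" using Comp_Hom[OF e(3) X0] .
    have 2: "X ! 1 \<cdot> (X ! 0 \<cdot> s) = Zero C T' (?tX 1)"
      using Comp_eq_Comp'[OF X10 X0 X1 e(3)] e(3) Hom_Ob[OF X1] by (simp add: Hom_def)
    have 3: "\<psi> 1 \<cdot> (X ! 0 \<cdot> s) = d \<cdot> e" using Comp_eq_Comp'[OF sq X0 b e(3)] e(4) by simp
    show "\<exists>T' e v. is_epi C e \<and> e \<in> Hom C T' T \<and> v \<in> Hom C T' (?tX 0) \<and>
       ?tx 0 \<cdot> v = Zero C T' (?tX 1) \<and> \<psi> (Suc 0) \<cdot> v = d \<cdot> e"
      using e(1,2) 1 2 3 by (intro exI[of _ T'] exI[of _ e] exI[of _ "X ! 0 \<cdot> s"]) simp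
  qed
  then obtain H h \<rho> where H: "exact_cx n H h" "H 0 = ?B" "H (Suc n) = M"
     "chain_map n H h ?tX ?tx \<rho>" "\<rho> 0 = Id C ?B" "\<rho> (Suc n) = Id C M" by blast
  obtain G where G: "G \<in> extensions C n M ?B" "\<And>k. k \<le> Suc n \<Longrightarrow> ob G k = H k"
    "\<And>k. k \<le> n \<Longrightarrow> G ! k = h k" using ex_extension[OF H(1)] H(2,3) by auto
  have "chain_map n (ob G) ((!) G) ?tX ?tx \<rho>" by (rule chain_map_cong[OF H(4) G(2,3)]) auto
  then show ?thesis unfolding tail_covered_def using G(1) H(5,6) by blast
qed

lemma tail_covered_cong:
  assumes "(X, Y) \<in> ext_rel C (Suc n) M A" "n \<ge> 1" "tail_covered n M X"
  shows "tail_covered n M Y"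
  using assms(1)
proof (induction rule: ext_rel_induct)
  case base
  show ?case by (rule assms(3))
next
  case (fwd Y Z)
  show ?case by (rule tail_covered_forward[OF ext_rel_mem(2)[OF fwd(1)] fwd(2) assms(2) fwd(3,4)])
next
  case (bwd Y Z)
  show ?case by (rule tail_covered_backward[OF bwd(2) ext_rel_mem(2)[OF bwd(1)] assms(2) bwd(3,4)])
qed

text \<open>The tail of \<open>T\<close> begins with a zero arrow out of \<open>A\<close> and ends
  with a split epi, so an \<open>n\<close>-fold extension by \<open>A\<close> maps to it with the
  identity in degree 0.\<close>

lemma tail_covered_trivial:
  assumes T: "T \<in> trivial_extensions C (Suc n) M A" and n: "n \<ge> 1" and O: "A \<in> Ob C" "M \<in> Ob C"
  shows "tail_covered n M T"
proof -
  have n2: "Suc n \<ge> 2" using n by simp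
  note T' = trivial_extension_ge_2[OF n2 T O]
  note TD = extensionsD[OF T'(1)]
  from T'(2) obtain s where s: "s \<in> Hom C M (ob T (Suc n))" "T ! Suc n \<cdot> s = Id C M" by blast
  obtain F where "F \<in> trivial_extensions C n M A" using ex_trivial[OF O] by blast
  then have F: "F \<in> extensions C n M A" using trivial_extension(1)[OF n _ O] by blast
  note FD = extensionsD[OF F]
  have T2: "ob T 2 \<in> Ob C" using right_exact_cx_Ob[OF TD(3), of 2] n by simp
  have "\<exists>\<phi>. chain_map n (ob F) ((!) F) (\<lambda>k. ob T (Suc k)) (\<lambda>k. T ! Suc k) \<phi> \<and>
    \<phi> 0 = Id C A \<and> \<phi> (Suc n) = Id C M"
  proof (rule chain_map_to_split[where y="\<lambda>k. T ! Suc k" and Y="\<lambda>k. ob T (Suc k)",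
        OF FD(3) n right_exact_cxD(1)[OF tail_right_exact[OF T'(1)]] FD(5) TD(5) _ _ s])
    show "Id C A \<in> Hom C (ob F 0) (ob T (Suc 0))"
      using FD(4) T'(3) Id_Hom[OF O(1)] by simp
    show "T ! Suc 0 \<cdot> Id C A = Zero C (ob F 0) (ob T (Suc 1))"
      using FD(4) T'(5) O T2 by (simp add: numeral_2_eq_2)
  qed
  then show ?thesis unfolding tail_covered_def T'(3) using F by blast
qed

text \<open>A covering gives a zigzag of length two. The split extension of \<open>ob E 1\<close> by
  \<open>A\<close>, spliced with the covering, maps to \<open>E\<close> through the copairing of
  \<open>E ! 0\<close> and the identity, and to \<open>T\<close> through the projection onto
  \<open>A\<close>.\<close>

lemma tail_covered_imp_trivial:
  assumes E: "E \<in> extensions C (Suc n) M A" and n: "n \<ge> 1" and tc: "tail_covered n M E"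
    and T: "T \<in> trivial_extensions C (Suc n) M A"
  shows "(E, T) \<in> ext_rel C (Suc n) M A"
proof -
  let ?B = "ob E 1"
  let ?tE = "\<lambda>k. ob E (Suc k)" and ?te = "\<lambda>k. E ! Suc k"
  note ED = extensionsD[OF E]
  from tc obtain F \<phi> where F: "F \<in> extensions C n M ?B"
    and \<phi>: "chain_map n (ob F) ((!) F) ?tE ?te \<phi>" "\<phi> 0 = Id C ?B" "\<phi> (Suc n) = Id C M"
    unfolding tail_covered_def by blast
  note FD = extensionsD[OF F]
  note AO = ED(7) and MO = ED(8) and BO = FD(7)
  obtain P i j p q where b: "is_biproduct C A ?B P i j p q" using ex_biproduct[OF AO BO] by blast
  note bs = biproduct_simps[OF b]
  have "[i, q] \<in> trivial_extensions C 1 ?B A" unfolding trivial_extensions_def using b by auto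
  then have "[i, q] \<in> extensions C 1 ?B A" using trivial_extension_1 by blast
  then have S: "short_exact C A P ?B i q" unfolding short_exact_def using bs by blast
  from splice_exact[OF S F] obtain V where V: "V \<in> extensions C (Suc n) M A" "V ! 0 = i" "V ! 1 = F ! 0 \<cdot> q"
    "ob V 1 = P" "\<And>k. \<lbrakk>1 \<le> k; k \<le> n\<rbrakk> \<Longrightarrow> V ! Suc k = F ! k"
    "\<And>k. \<lbrakk>1 \<le> k; k \<le> Suc n\<rbrakk> \<Longrightarrow> ob V (Suc k) = ob F k" by blast
  note VD = extensionsD[OF V(1)]
  have E0: "E ! 0 \<in> Hom C A ?B" using ED(6)[of 0] ED(4) by simp
  have E1: "E ! 1 \<in> Hom C ?B (?tE 1)" using ED(6)[of 1] n by simp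
  have E10: "E ! 1 \<cdot> E ! 0 = Zero C A (?tE 1)" using right_exact_cxD(2)[OF ED(3), of 0] ED(4) by simp
  have F0: "F ! 0 \<in> Hom C ?B (ob F 1)" using FD(6)[of 0] FD(4) by simp
  define w where "w = Add C (E ! 0 \<cdot> p) (Id C ?B \<cdot> q)"
  have w: "w \<in> Hom C P ?B" "w \<cdot> i = E ! 0" using biproduct_copair[OF b E0 Id_Hom[OF BO]] by (simp_all add: w_def)
  have \<phi>1: "\<phi> 1 \<in> Hom C (ob F 1) (?tE 1)" using chain_mapD(1)[OF \<phi>(1), of 1] by simp
  have \<phi>sq: "\<phi> 1 \<cdot> F ! 0 = E ! 1" using chain_mapD(2)[OF \<phi>(1), of 0] \<phi>(2) E1 BO by (simp add: Hom_def)
  \<comment> \<open>The summand through \<open>E ! 0\<close> disappears after \<open>E ! 1\<close>,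
    so the square to the right of \<open>w\<close> reduces to the first square of
    \<open>\<phi>\<close>.\<close>
  have E1w: "E ! 1 \<cdot> w = E ! 1 \<cdot> q"
  proof -
    have "E ! 1 \<cdot> (E ! 0 \<cdot> p) = Zero C P (?tE 1)"
      using Comp_eq_Comp'[OF E10 E0 E1 bs(3)] bs(3) Hom_Ob[OF E1] by (simp add: Hom_def)
    then show ?thesis unfolding w_def using E0 E1 bs(3,4) BO by (simp add: Hom_def)
  qed
  define \<chi> where "\<chi> k = (if k = 0 then Id C A else if k = 1 then w else \<phi> (k - 1))" for k
  have "chain_map (Suc n) (ob V) ((!) V) (ob E) ((!) E) \<chi>"
    unfolding chain_map_def
  proof (intro conjI allI impI)
    fix k assume k: "k \<le> Suc (Suc n)"
    consider "k = 0" | "k = 1" | "k \<ge> 2" by linarith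
    then show "\<chi> k \<in> Hom C (ob V k) (ob E k)"
    proof cases
      case 1 then show ?thesis using Id_Hom[OF AO] VD(4) ED(4) by (simp add: \<chi>_def)
    next
      case 2 then show ?thesis using w V(4) by (simp add: \<chi>_def)
    next
      case 3
      then obtain l where l: "k = Suc l" "1 \<le> l" "l \<le> Suc n" using k by (cases k) auto
      then show ?thesis using chain_mapD(1)[OF \<phi>(1) l(3)] V(6)[OF l(2,3)] by (simp add: \<chi>_def)
    qed
  next
    fix k assume k: "k \<le> Suc n"
    consider "k = 0" | "k = 1" | "k \<ge> 2" by linarith
    then show "\<chi> (Suc k) \<cdot> V ! k = E ! k \<cdot> \<chi> k"
    proof cases
      case 1 then show ?thesis using w(2) V(2) E0 AO by (simp add: \<chi>_def Hom_def)
    next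
      case 2
      have "\<phi> 1 \<cdot> (F ! 0 \<cdot> q) = E ! 1 \<cdot> q" by (rule Comp_eq_Comp'[OF \<phi>sq F0 \<phi>1 bs(4)])
      then show ?thesis using 2 V(3) E1w by (simp add: \<chi>_def)
    next
      case 3
      then obtain l where l: "k = Suc l" "1 \<le> l" "l \<le> n" using k by (cases k) auto
      then show ?thesis using chain_mapD(2)[OF \<phi>(1) l(3)] V(5)[OF l(2,3)] by (simp add: \<chi>_def)
    qed
  qed
  then have "ext_over (Suc n) M (Id C A) V E"
    by (rule ext_overI) (use \<phi>(3) n in \<open>simp_all add: \<chi>_def\<close>)
  then have VE: "(V, E) \<in> ext_rel C (Suc n) M A" by (rule ext_relI[OF V(1) E])
  have n2: "Suc n \<ge> 2" using n by simp
  note T' = trivial_extension_ge_2[OF n2 T AO MO]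
  note TD = extensionsD[OF T'(1)]
  from T'(2) obtain s where s: "s \<in> Hom C M (ob T (Suc n))" "T ! Suc n \<cdot> s = Id C M" by blast
  have T2: "ob T 2 \<in> Ob C" using right_exact_cx_Ob[OF TD(3), of 2] n by simp
  have "\<exists>\<psi>. chain_map n (\<lambda>k. ob V (Suc k)) (\<lambda>k. V ! Suc k) (\<lambda>k. ob T (Suc k)) (\<lambda>k. T ! Suc k) \<psi> \<and>
    \<psi> 0 = p \<and> \<psi> (Suc n) = Id C M"
  proof (rule chain_map_to_split[where y="\<lambda>k. T ! Suc k" and Y="\<lambda>k. ob T (Suc k)",
        OF tail_right_exact[OF V(1)] n right_exact_cxD(1)[OF tail_right_exact[OF T'(1)]] VD(5) TD(5) _ _ s])
    show "p \<in> Hom C (ob V (Suc 0)) (ob T (Suc 0))"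
      using V(4) T'(3) bs(3) by simp
    show "T ! Suc 0 \<cdot> p = Zero C (ob V (Suc 0)) (ob T (Suc 1))"
      using V(4) T'(5) bs(3) T2 by (simp add: numeral_2_eq_2 Hom_def)
  qed
  then obtain \<psi> where \<psi>: "chain_map n (\<lambda>k. ob V (Suc k)) (\<lambda>k. V ! Suc k) (\<lambda>k. ob T (Suc k)) (\<lambda>k. T ! Suc k) \<psi>"
    "\<psi> 0 = p" "\<psi> (Suc n) = Id C M" by blast
  \<comment> \<open>The identity of \<open>A\<close> can be put in front because
    \<open>p \<cdot> i\<close> is the identity and the first arrow of \<open>T\<close> is one as
    well.\<close>
  define \<tau> where "\<tau> k = (case k of 0 \<Rightarrow> Id C A | Suc l \<Rightarrow> \<psi> l)" for k
  have "chain_map (Suc n) (ob V) ((!) V) (ob T) ((!) T) \<tau>"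
    unfolding chain_map_def
  proof (intro conjI allI impI)
    fix k assume "k \<le> Suc (Suc n)"
    then show "\<tau> k \<in> Hom C (ob V k) (ob T k)"
      using chain_mapD(1)[OF \<psi>(1), of "k - 1"] Id_Hom[OF AO] VD(4) TD(4) by (cases k) (simp_all add: \<tau>_def)
  next
    fix k assume "k \<le> Suc n"
    then show "\<tau> (Suc k) \<cdot> V ! k = T ! k \<cdot> \<tau> k"
      using chain_mapD(2)[OF \<psi>(1), of "k - 1"] V(2) T'(4) \<psi>(2) bs(5) AO by (cases k) (simp_all add: \<tau>_def)
  qed
  then have "ext_over (Suc n) M (Id C A) V T"
    by (rule ext_overI) (use \<psi>(3) in \<open>simp_all add: \<tau>_def\<close>)
  then have "(V, T) \<in> ext_rel C (Suc n) M A" by (rule ext_relI[OF V(1) T'(1)])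
  then show ?thesis using VE ext_rel_sym ext_rel_trans by blast
qed

subsection \<open>Right exactness and vanishing\<close>

lemma Ext_carrierE:
  assumes "\<xi> \<in> carrier (Ext C n M A)"
  obtains E where "E \<in> extensions C n M A" "\<xi> = ext_rel C n M A `` {E}"
  using assms unfolding Ext_carrier by (rule quotientE)

lemma Ext_carrierI: "E \<in> extensions C n M A \<Longrightarrow> ext_rel C n M A `` {E} \<in> carrier (Ext C n M A)"
  unfolding Ext_carrier by (rule quotientI)

lemma Ext_map_eqI:
  assumes E: "E \<in> extensions C n M A" and n: "n \<ge> 1" and Y: "Y \<in> extensions C n M B" and ov: "ext_over n M h E Y"
  shows "Ext_map C n M h (ext_rel C n M A `` {E}) = ext_rel C n M B `` {Y}"
proof -
  note h = ext_over_Hom[OF E Y ov]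
  obtain G where G: "pushforward C h E G" using ex_pushforward[OF E n h] by blast
  show ?thesis
    unfolding Ext_map_class[OF E n h G] ext_class_eq_iff[OF pushforward_props(1)[OF E n h G] Y]
    by (rule pushforward_rel_target[OF E n h G Y ov])
qed

text \<open>Equality of classes only provides a zigzag from the pushforward to \<open>Y\<close>;
  \<open>zigzag_lift\<close> turns it into a single morphism at the price of changing
  \<open>E\<close> within its class. This is where \<open>h\<close> has to be epi.\<close>

lemma Ext_map_eqD:
  assumes E: "E \<in> extensions C n M A" and n: "n \<ge> 1" and Y: "Y \<in> extensions C n M B"
    and h: "h \<in> Hom C A B" "is_epi C h"
    and eq: "Ext_map C n M h (ext_rel C n M A `` {E}) = ext_rel C n M B `` {Y}"
  obtains F where "(E, F) \<in> ext_rel C n M A" "ext_over n M h F Y"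
proof -
  obtain G where G: "pushforward C h E G" using ex_pushforward[OF E n h(1)] by blast
  note P = pushforward_props(1,2)[OF E n h(1) G]
  have "(G, Y) \<in> ext_rel C n M B"
    using eq unfolding Ext_map_class[OF E n h(1) G] ext_class_eq_iff[OF P(1) Y] .
  from zigzag_lift[OF this E n P(2) h(2)] show thesis using that by blast
qed

lemma Ext_map_carrier:
  assumes "\<xi> \<in> carrier (Ext C n M A)" and n: "n \<ge> 1" and h: "h \<in> Hom C A B"
  shows "Ext_map C n M h \<xi> \<in> carrier (Ext C n M B)"
proof -
  obtain E where E: "E \<in> extensions C n M A" "\<xi> = ext_rel C n M A `` {E}" using assms(1) by (rule Ext_carrierE)
  obtain G where G: "pushforward C h E G" using ex_pushforward[OF E(1) n h] by blast
  show ?thesis unfolding E(2) Ext_map_class[OF E(1) n h G]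
    by (rule Ext_carrierI[OF pushforward_props(1)[OF E(1) n h G]])
qed

text \<open>The converse of splicing: \<open>K\<close> is the cokernel of \<open>E ! 0\<close>, and
  \<open>E ! 1\<close> factors as \<open>g\<close> followed by a mono, which becomes the first arrow
  of \<open>E'\<close>.\<close>

lemma cokernel_extension:
  assumes E: "E \<in> extensions C (Suc n) M A" and n: "n \<ge> 1"
  shows "\<exists>K g E'. short_exact C A (ob E 1) K (E ! 0) g \<and> E' \<in> extensions C n M K \<and> E' ! 0 \<cdot> g = E ! 1 \<and>
    (\<forall>k. 1 \<le> k \<and> k \<le> n \<longrightarrow> E' ! k = E ! Suc k) \<and> (\<forall>k. 1 \<le> k \<and> k \<le> Suc n \<longrightarrow> ob E' k = ob E (Suc k))"
proof -
  let ?B = "ob E 1" and ?D = "ob E 2"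
  note ED = extensionsD[OF E]
  have E0: "E ! 0 \<in> Hom C A ?B" using ED(6)[of 0] ED(4) by simp
  have E1: "E ! 1 \<in> Hom C ?B ?D" using ED(6)[of 1] n by (simp add: numeral_2_eq_2)
  have E10: "E ! 1 \<cdot> E ! 0 = Zero C A ?D" using right_exact_cxD(2)[OF ED(3), of 0] ED(4) by (simp add: numeral_2_eq_2)
  have l0: "lifts (E ! 0) t" if "t \<in> Hom C T ?B" "E ! 1 \<cdot> t = Zero C T ?D" for T t
    using right_exact_cxD(3)[OF ED(3), of 0 t T] that by (simp add: numeral_2_eq_2)
  obtain K g where g: "g \<in> Hom C ?B K" "g \<cdot> E ! 0 = Zero C A K" "is_epi C g"
    "\<And>T t. \<lbrakk>t \<in> Hom C ?B T; t \<cdot> E ! 0 = Zero C A T\<rbrakk> \<Longrightarrow> \<exists>u. u \<in> Hom C K T \<and> u \<cdot> g = t"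
    by (rule obtain_cokernel[OF E0]) (rule that; blast)
  obtain m where m: "m \<in> Hom C K ?D" "m \<cdot> g = E ! 1" using g(4)[OF E1 E10] by blast
  note O = Hom_Ob[OF m(1)]
  have S: "short_exact C A ?B K (E ! 0) g"
    unfolding short_exact_iff
  proof (intro conjI allI ballI impI)
    fix T t assume t: "t \<in> Hom C T ?B" "g \<cdot> t = Zero C T K"
    have "E ! 1 \<cdot> t = m \<cdot> (g \<cdot> t)" using Comp_eq_Comp'[OF m(2) g(1) m(1) t(1)] by simp
    then have "E ! 1 \<cdot> t = Zero C T ?D" unfolding t(2) using m(1) Hom_Ob[OF t(1)] by (simp add: Hom_def)
    then show "lifts (E ! 0) t" by (rule l0[OF t(1)])
  qed (use E0 g exact_cxD(2)[OF ED(2)] in blast)+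
  \<comment> \<open>An element killed by \<open>m\<close> is lifted along the epi \<open>g\<close>.
    The lift is killed by \<open>E ! 1\<close>, so by exactness it comes from \<open>A\<close>, and
    \<open>g\<close> kills what comes from \<open>A\<close>.\<close>
  have mm: "is_mono C m"
  proof (rule mono_zeroI[OF m(1)])
    fix T t assume t: "t \<in> Hom C T K" "m \<cdot> t = Zero C T ?D"
    obtain T' e s where s: "is_epi C e" "e \<in> Hom C T' T" "s \<in> Hom C T' ?B" "g \<cdot> s = t \<cdot> e"
      by (rule liftsE[OF lifts_epi[OF g(3,1) t(1)] t(1) g(1)])
    have "E ! 1 \<cdot> s = m \<cdot> (t \<cdot> e)" using Comp_eq_Comp'[OF m(2) g(1) m(1) s(3)] s(4) by simp
    also have "\<dots> = Zero C T' ?D" using Comp_eq_Comp'[OF t(2,1) m(1) s(2)] s(2) O by (simp add: Hom_def)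
    finally obtain T'' e' r where r: "is_epi C e'" "e' \<in> Hom C T'' T'" "r \<in> Hom C T'' A" "E ! 0 \<cdot> r = s \<cdot> e'"
      using liftsE[OF l0[OF s(3)] s(3) E0] by blast
    have ee: "is_epi C (e \<cdot> e')" "e \<cdot> e' \<in> Hom C T'' T" using is_epi_comp[OF r(1) s(1)] r(2) s(2) by (simp_all add: Hom_def)
    have "t \<cdot> (e \<cdot> e') = g \<cdot> (s \<cdot> e')" by (rule Comp_eq_Comp[OF s(4,3) g(1) s(2) t(1) r(2), symmetric])
    also have "\<dots> = Zero C T'' K" unfolding r(4)[symmetric]
      using Comp_eq_Comp'[OF g(2) E0 g(1) r(3)] r(3) O by (simp add: Hom_def)
    finally show "t = Zero C T K" by (rule epi_zeroD[OF ee t(1)])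
  qed
  define X where "X k = (case k of 0 \<Rightarrow> K | Suc l \<Rightarrow> ob E (Suc k))" for k
  define x where "x k = (case k of 0 \<Rightarrow> m | Suc l \<Rightarrow> E ! Suc k)" for k
  have X_simps: "X 0 = K" "X (Suc k) = ob E (Suc (Suc k))" for k by (simp_all add: X_def)
  have x_simps: "x 0 = m" "x (Suc k) = E ! Suc (Suc k)" for k by (simp_all add: x_def)
  have m': "m \<in> Hom C K (X 1)" using m(1) by (simp add: X_simps numeral_2_eq_2)
  have "right_exact_cx n X x"
    unfolding right_exact_cx_def
  proof (intro conjI allI impI ballI)
    fix k assume "k \<le> n"
    then show "x k \<in> Hom C (X k) (X (Suc k))"
      using ED(6)[of "Suc k"] m' by (cases k) (simp_all add: x_simps X_simps)
  next
    fix k assume k: "k < n"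
    show "x (Suc k) \<cdot> x k = Zero C (X k) (X (Suc (Suc k)))"
    proof (cases k)
      case 0
      have E2: "E ! 2 \<in> Hom C ?D (ob E (Suc 2))" using ED(6)[of 2] k by simp
      have "E ! 2 \<cdot> E ! 1 = Zero C ?B (ob E (Suc 2))"
        using right_exact_cxD(2)[OF ED(3), of 1] k n by (simp add: numeral_2_eq_2)
      then have "(E ! 2 \<cdot> m) \<cdot> g = Zero C ?B (ob E (Suc 2))"
        using m E2 g(1) by (simp add: Hom_def)
      then have "E ! 2 \<cdot> m = Zero C K (ob E (Suc 2))"
        by (rule epi_zeroD[OF g(3,1) Comp_Hom[OF m(1) E2]])
      then show ?thesis using 0 by (simp add: x_simps X_simps numeral_2_eq_2)
    next
      case (Suc l)
      then show ?thesis using right_exact_cxD(2)[OF ED(3), of "Suc k"] k by (simp add: x_simps X_simps)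
    qed
  next
    fix k T t assume k: "k \<le> n" and t: "t \<in> Hom C T (X (Suc k))"
      and t0: "k < n \<longrightarrow> x (Suc k) \<cdot> t = Zero C T (X (Suc (Suc k)))"
    have l: "lifts (E ! Suc k) t"
      by (rule right_exact_cxD(3)[OF ED(3)]) (use k t t0 in \<open>simp_all add: x_simps X_simps\<close>)
    show "lifts (x k) t"
    proof (cases k)
      case 0
      then have t': "t \<in> Hom C T ?D" and l1: "lifts (E ! 1) t" using t l by (simp_all add: X_simps numeral_2_eq_2)
      obtain T' e s where s: "is_epi C e" "e \<in> Hom C T' T" "s \<in> Hom C T' ?B" "E ! 1 \<cdot> s = t \<cdot> e"
        by (rule liftsE[OF l1 t' E1])
      have "m \<cdot> (g \<cdot> s) = t \<cdot> e" using Comp_eq_Comp'[OF m(2) g(1) m(1) s(3)] s(4) by simp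
      then have "lifts m t" by (rule liftsI[OF s(1,2) Comp_Hom[OF s(3) g(1)] _ t' m(1)])
      then show ?thesis using 0 by (simp add: x_simps)
    next
      case (Suc l)
      then show ?thesis using \<open>lifts (E ! Suc k) t\<close> by (simp add: x_simps)
    qed
  qed
  then have "exact_cx n X x" using mm by (simp add: exact_cx_def x_simps)
  from ex_extension[OF this] obtain E' where E': "E' \<in> extensions C n (X (Suc n)) (X 0)"
    "\<And>k. k \<le> Suc n \<Longrightarrow> ob E' k = X k" "\<And>k. k \<le> n \<Longrightarrow> E' ! k = x k" by blast
  have "E' \<in> extensions C n M K" using E'(1) ED(5) by (simp add: X_simps)
  moreover have "E' ! 0 \<cdot> g = E ! 1" using E'(3)[of 0] m(2) by (simp add: x_simps)
  moreover have "E' ! k = E ! Suc k" if "1 \<le> k" "k \<le> n" for k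
    using E'(3)[OF that(2)] that(1) by (cases k) (simp_all add: x_simps)
  moreover have "ob E' k = ob E (Suc k)" if "1 \<le> k" "k \<le> Suc n" for k
    using E'(2)[OF that(2)] that(1) by (cases k) (simp_all add: X_simps)
  ultimately show ?thesis using S by blast
qed

text \<open>An arbitrary extension is written as a splice at the cokernel \<open>K\<close> of its
  first arrow. Surjectivity of the map induced by \<open>ob E 1 \<rightarrow> K\<close> provides an
  extension by \<open>ob E 1\<close> over the second factor, and this covers the tail of
  \<open>E\<close>.\<close>

lemma Ext_vanishes_if_right_exact:
  assumes R: "\<forall>M\<in>Ob C. Ext_right_exact C n M" and n: "n \<ge> 1" and O: "A \<in> Ob C" "M \<in> Ob C"
  shows "carrier (Ext C (Suc n) M A) = {\<one>\<^bsub>Ext C (Suc n) M A\<^esub>}"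
proof -
  obtain T where T: "T \<in> trivial_extensions C (Suc n) M A" using ex_trivial[OF O] by blast
  have one: "\<one>\<^bsub>Ext C (Suc n) M A\<^esub> = ext_rel C (Suc n) M A `` {T}" using Ext_one[OF _ T O] by simp
  have TE: "T \<in> extensions C (Suc n) M A" using trivial_extension(1)[OF _ T O] by simp
  have "(E, T) \<in> ext_rel C (Suc n) M A" if E: "E \<in> extensions C (Suc n) M A" for E
  proof -
    let ?B = "ob E 1"
    obtain K g E' where S: "short_exact C A ?B K (E ! 0) g" and E': "E' \<in> extensions C n M K" "E' ! 0 \<cdot> g = E ! 1"
      "\<And>k. \<lbrakk>1 \<le> k; k \<le> n\<rbrakk> \<Longrightarrow> E' ! k = E ! Suc k" "\<And>k. \<lbrakk>1 \<le> k; k \<le> Suc n\<rbrakk> \<Longrightarrow> ob E' k = ob E (Suc k)"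
      using cokernel_extension[OF E n] by blast
    note g = S[unfolded short_exact_iff]
    have "Ext_map C n M g ` carrier (Ext C n M ?B) = carrier (Ext C n M K)"
      using R O(2) S unfolding Ext_right_exact_def by blast
    then obtain \<xi> where \<xi>: "\<xi> \<in> carrier (Ext C n M ?B)" "Ext_map C n M g \<xi> = ext_rel C n M K `` {E'}"
      using Ext_carrierI[OF E'(1)] by (metis imageE)
    obtain F where F: "F \<in> extensions C n M ?B" "\<xi> = ext_rel C n M ?B `` {F}" using \<xi>(1) by (rule Ext_carrierE)
    obtain G where G: "(F, G) \<in> ext_rel C n M ?B" "ext_over n M g G E'"
      using Ext_map_eqD[OF F(1) n E'(1) _ _ \<xi>(2)[unfolded F(2)]] g by blast
    note GE = ext_rel_mem(2)[OF G(1)]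
    note GD = extensionsD[OF GE]
    obtain \<phi> where \<phi>: "chain_map n (ob G) ((!) G) (ob E') ((!) E') \<phi>" "\<phi> 0 = g" "\<phi> (Suc n) = Id C M"
      using G(2) unfolding ext_over_def by blast
    \<comment> \<open>The tail starts with \<open>E ! 1\<close>, which is
      \<open>E' ! 0 \<cdot> g\<close>; absorbing \<open>g\<close> into this arrow leaves the
      identity in degree 0.\<close>
    let ?\<chi> = "\<phi>(0 := Id C ?B)"
    have E1: "E ! 1 \<in> Hom C ?B (ob E 2)" using extensionsD(6)[OF E, of 1] n by (simp add: numeral_2_eq_2)
    have "chain_map n (ob G) ((!) G) (\<lambda>k. ob E (Suc k)) (\<lambda>k. E ! Suc k) ?\<chi>"
      unfolding chain_map_def
    proof (intro conjI allI impI)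
      fix k assume k: "k \<le> Suc n"
      show "?\<chi> k \<in> Hom C (ob G k) (ob E (Suc k))"
        using chain_mapD(1)[OF \<phi>(1) k] E'(4)[of k] GD(4) Id_Hom[OF GD(7)] k
        by (cases "k = 0") simp_all
    next
      fix k assume k: "k \<le> n"
      show "?\<chi> (Suc k) \<cdot> G ! k = E ! Suc k \<cdot> ?\<chi> k"
        using chain_mapD(2)[OF \<phi>(1) k] E'(2) E'(3)[of k] \<phi>(2) E1 k
        by (cases "k = 0") (simp_all add: Hom_def)
    qed
    then have "tail_covered n M E" unfolding tail_covered_def using GE \<phi>(3) by (intro bexI[of _ G] exI[of _ ?\<chi>]) auto
    then show ?thesis using tail_covered_imp_trivial[OF E n _ T] by blast
  qed
  then have eq: "ext_rel C (Suc n) M A `` {E} = ext_rel C (Suc n) M A `` {T}" if "E \<in> extensions C (Suc n) M A" for E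
    using that ext_class_eq_iff[OF that TE] by blast
  show ?thesis unfolding one
  proof (intro equalityI subsetI)
    fix \<xi> assume "\<xi> \<in> carrier (Ext C (Suc n) M A)"
    then obtain E where "E \<in> extensions C (Suc n) M A" "\<xi> = ext_rel C (Suc n) M A `` {E}" by (rule Ext_carrierE)
    then show "\<xi> \<in> {ext_rel C (Suc n) M A `` {T}}" using eq by simp
  next
    fix \<xi> assume "\<xi> \<in> {ext_rel C (Suc n) M A `` {T}}"
    then show "\<xi> \<in> carrier (Ext C (Suc n) M A)" using Ext_carrierI[OF TE] by simp
  qed
qed

text \<open>For surjectivity, the splice with a given extension is trivial by assumption, so its
  tail is covered, and a covering is a preimage. In the middle, a preimage is the fibre product with
  a trivial extension by a zero object, since the pullback of \<open>g\<close> along the zero object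
  is its kernel \<open>A\<close>.\<close>

lemma right_exact_if_Ext_vanishes:
  assumes V: "\<forall>A\<in>Ob C. \<forall>M\<in>Ob C. carrier (Ext C (Suc n) M A) = {\<one>\<^bsub>Ext C (Suc n) M A\<^esub>}"
    and n: "n \<ge> 1" and M: "M \<in> Ob C"
  shows "Ext_right_exact C n M"
  unfolding Ext_right_exact_def
proof (intro allI impI conjI)
  fix A B D f g assume S: "short_exact C A B D f g"
  then have f: "f \<in> Hom C A B" and g: "g \<in> Hom C B D" and mf: "is_mono C f" and eg: "is_epi C g"
    and gf: "g \<cdot> f = Zero C A D" and lf: "\<And>T t. t \<in> Hom C T B \<Longrightarrow> g \<cdot> t = Zero C T D \<Longrightarrow> lifts f t"
    unfolding short_exact_iff by blast+
  have O: "A \<in> Ob C" "B \<in> Ob C" "D \<in> Ob C" using Hom_Ob f g by blast+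
  obtain T where T: "T \<in> trivial_extensions C n M D" using ex_trivial[OF O(3) M] by blast
  note TE = trivial_extension(1)[OF n T O(3) M]
  note one = Ext_one[OF n T O(3) M]
  show "Ext_map C n M g ` carrier (Ext C n M B) = carrier (Ext C n M D)"
  proof (intro equalityI subsetI)
    fix \<xi> assume "\<xi> \<in> Ext_map C n M g ` carrier (Ext C n M B)"
    then show "\<xi> \<in> carrier (Ext C n M D)" using Ext_map_carrier[OF _ n g] by blast
  next
    fix \<xi> assume "\<xi> \<in> carrier (Ext C n M D)"
    then obtain E where E: "E \<in> extensions C n M D" "\<xi> = ext_rel C n M D `` {E}" by (rule Ext_carrierE)
    note ED = extensionsD[OF E(1)]
    obtain X where X: "X \<in> extensions C (Suc n) M A" "X ! 1 = E ! 0 \<cdot> g" "ob X 1 = B"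
      "\<And>k. \<lbrakk>1 \<le> k; k \<le> n\<rbrakk> \<Longrightarrow> X ! Suc k = E ! k"
      "\<And>k. \<lbrakk>1 \<le> k; k \<le> Suc n\<rbrakk> \<Longrightarrow> ob X (Suc k) = ob E k"
      using splice_exact[OF S E(1)] by blast
    obtain U where U: "U \<in> trivial_extensions C (Suc n) M A" using ex_trivial[OF O(1) M] by blast
    have n': "Suc n \<ge> 1" by simp
    \<comment> \<open>A carrier with one element identifies the splice with a trivial extension,
      whose tail is covered.\<close>
    have "ext_rel C (Suc n) M A `` {X} = ext_rel C (Suc n) M A `` {U}"
      using Ext_carrierI[OF X(1)] V[rule_format, OF O(1) M] Ext_one[OF n' U O(1) M] by simp
    then have "(U, X) \<in> ext_rel C (Suc n) M A"
      using ext_class_eq_iff[OF X(1) trivial_extension(1)[OF n' U O(1) M]] ext_rel_sym by blast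
    then have "tail_covered n M X" by (rule tail_covered_cong[OF _ n tail_covered_trivial[OF U n O(1) M]])
    then obtain F \<phi> where F: "F \<in> extensions C n M B"
      and \<phi>: "chain_map n (ob F) ((!) F) (\<lambda>k. ob X (Suc k)) (\<lambda>k. X ! Suc k) \<phi>"
       "\<phi> 0 = Id C B" "\<phi> (Suc n) = Id C M" unfolding tail_covered_def X(3) by blast
    note FD = extensionsD[OF F]
    have E0: "E ! 0 \<in> Hom C D (ob E 1)" using ED(6)[of 0] ED(4) by simp
    \<comment> \<open>The factor \<open>g\<close> of the first arrow of the tail is moved back into
      degree 0, where it replaces the identity.\<close>
    let ?\<psi> = "\<phi>(0 := g)"
    have "chain_map n (ob F) ((!) F) (ob E) ((!) E) ?\<psi>"
      unfolding chain_map_def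
    proof (intro conjI allI impI)
      fix k assume k: "k \<le> Suc n"
      show "?\<psi> k \<in> Hom C (ob F k) (ob E k)"
        using chain_mapD(1)[OF \<phi>(1) k] X(5)[of k] FD(4) ED(4) g k
        by (cases "k = 0") simp_all
    next
      fix k assume k: "k \<le> n"
      show "?\<psi> (Suc k) \<cdot> F ! k = E ! k \<cdot> ?\<psi> k"
        using chain_mapD(2)[OF \<phi>(1) k] X(2) X(4)[of k] \<phi>(2) E0 g O k
        by (cases "k = 0") (simp_all add: Hom_def)
    qed
    then have "ext_over n M g F E" by (rule ext_overI) (use \<phi> in simp_all)
    then have "\<xi> = Ext_map C n M g (ext_rel C n M B `` {F})" using Ext_map_eqI[OF F n E(1)] E(2) by simp
    then show "\<xi> \<in> Ext_map C n M g ` carrier (Ext C n M B)" using Ext_carrierI[OF F] by blast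
  qed
  show "Ext_map C n M f ` carrier (Ext C n M A) = kernel (Ext C n M B) (Ext C n M D) (Ext_map C n M g)"
  proof (intro equalityI subsetI)
    fix \<xi> assume "\<xi> \<in> Ext_map C n M f ` carrier (Ext C n M A)"
    then obtain \<eta> where \<eta>: "\<eta> \<in> carrier (Ext C n M A)" "\<xi> = Ext_map C n M f \<eta>" by blast
    obtain E where E: "E \<in> extensions C n M A" "\<eta> = ext_rel C n M A `` {E}" using \<eta>(1) by (rule Ext_carrierE)
    obtain F where F: "pushforward C f E F" using ex_pushforward[OF E(1) n f] by blast
    note FP = pushforward_props(1,2)[OF E(1) n f F]
    have \<xi>: "\<xi> = ext_rel C n M B `` {F}" unfolding \<eta>(2) E(2) by (rule Ext_map_class[OF E(1) n f F])
    have "ext_over n M (Zero C A D) E T" by (rule ext_over_zero_trivial[OF E(1) n T O(3)])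
    \<comment> \<open>As \<open>g \<cdot> f\<close> is zero, the morphism from \<open>E\<close> to
      \<open>T\<close> over the zero arrow factors through the pushforward along
      \<open>f\<close>.\<close>
    then have "ext_over n M g F T" using pushforward_universal[OF E(1) n f F TE g] gf by simp
    then have "Ext_map C n M g \<xi> = \<one>\<^bsub>Ext C n M D\<^esub>" unfolding \<xi> one by (rule Ext_map_eqI[OF FP(1) n TE])
    moreover have "\<xi> \<in> carrier (Ext C n M B)" unfolding \<eta>(2) by (rule Ext_map_carrier[OF \<eta>(1) n f])
    ultimately show "\<xi> \<in> kernel (Ext C n M B) (Ext C n M D) (Ext_map C n M g)" by (simp add: kernel_def)
  next
    fix \<xi> assume "\<xi> \<in> kernel (Ext C n M B) (Ext C n M D) (Ext_map C n M g)"
    then have \<xi>: "\<xi> \<in> carrier (Ext C n M B)" "Ext_map C n M g \<xi> = ext_rel C n M D `` {T}"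
      by (simp_all add: kernel_def one)
    obtain E where E: "E \<in> extensions C n M B" "\<xi> = ext_rel C n M B `` {E}" using \<xi>(1) by (rule Ext_carrierE)
    obtain F where F: "(E, F) \<in> ext_rel C n M B" "ext_over n M g F T"
      by (rule Ext_map_eqD[OF E(1) n TE g eg \<xi>(2)[unfolded E(2)]])
    note FE = ext_rel_mem(2)[OF F(1)]
    obtain Z where Z: "is_zero_object C Z" using ex_zero_object by blast
    note ZH = zero_object_Hom[OF Z]
    obtain U where U: "U \<in> trivial_extensions C n M Z" using ex_trivial[OF ZH(1) M] by blast
    note UE = trivial_extension(1)[OF n U ZH(1) M]
    \<comment> \<open>A pullback of \<open>g\<close> along the arrow from a zero object is a kernel
      of \<open>g\<close>, and \<open>f\<close> is one.\<close>
    have pb: "is_pullback C g (Zero C Z D) f (Zero C A Z)"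
    proof (rule pullbackI[OF g Zero_Hom[OF ZH(1) O(3)] f Zero_Hom[OF O(1) ZH(1)]])
      show "g \<cdot> f = Zero C Z D \<cdot> Zero C A Z" using gf O ZH(1) by simp
    next
      fix T x y assume xy: "x \<in> Hom C T B" "y \<in> Hom C T Z" "g \<cdot> x = Zero C Z D \<cdot> y"
      have gx: "g \<cdot> x = Zero C T D" using xy(2,3) O by (simp add: Hom_def)
      \<comment> \<open>Exactness lifts \<open>x\<close> to \<open>f\<close> only after an epi. As
        \<open>f\<close> is a kernel of some \<open>r\<close>, and \<open>r \<cdot> x\<close>
        vanishes after that epi, \<open>x\<close> itself factors through \<open>f\<close>.\<close>
      from mono_is_kernel[OF mf] obtain r where r: "is_kernel C r f" by blast
      then have rH: "r \<in> Hom C B (Cod C r)" using f by (auto simp: is_kernel_def Hom_def)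
      obtain A' where A': "f \<in> Hom C A' B" "r \<cdot> f = Zero C A' (Cod C r)"
        "\<And>T t. \<lbrakk>t \<in> Hom C T B; r \<cdot> t = Zero C T (Cod C r)\<rbrakk> \<Longrightarrow> \<exists>u. u \<in> Hom C T A' \<and> f \<cdot> u = t"
        by (rule kernelD[OF r rH]) (rule that; blast)
      have AA: "A' = A" using A'(1) f by (simp add: Hom_def)
      obtain T' e s where s: "is_epi C e" "e \<in> Hom C T' T" "s \<in> Hom C T' A" "f \<cdot> s = x \<cdot> e"
        by (rule liftsE[OF lf[OF xy(1) gx] xy(1) f])
      have "(r \<cdot> x) \<cdot> e = r \<cdot> (f \<cdot> s)" unfolding s(4) by (rule Comp_assoc[OF s(2) xy(1) rH])
      also have "\<dots> = Zero C T' (Cod C r)"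
        using Comp_eq_Comp'[OF A'(2)[unfolded AA] f rH s(3)] s(3) Hom_Ob[OF rH] by (simp add: Hom_def)
      finally have "r \<cdot> x = Zero C T (Cod C r)" by (rule epi_zeroD[OF s(1,2) Comp_Hom[OF xy(1) rH]])
      then obtain w where w: "w \<in> Hom C T A" "f \<cdot> w = x" using A'(3)[OF xy(1)] AA by blast
      have "Zero C A Z \<cdot> w = y" using ZH(2)[OF xy(2)] w(1) ZH(1) by (simp add: Hom_def)
      then show "\<exists>w. w \<in> Hom C T A \<and> f \<cdot> w = x \<and> Zero C A Z \<cdot> w = y" using w by blast
    next
      fix T w assume "w \<in> Hom C T A" "f \<cdot> w = Zero C T B"
      then show "w = Zero C T A" by (rule mono_zeroD[OF mf f])
    qed
    \<comment> \<open>\<open>F\<close> and the trivial extension by \<open>Z\<close> both map to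
      \<open>T\<close>, over \<open>g\<close> and over a zero arrow; their fibre product is an
      extension by \<open>A\<close> that maps to \<open>F\<close> over \<open>f\<close>.\<close>
    obtain H where H: "H \<in> extensions C n M (Dom C f)" "ext_over n M f H F"
      using ext_fiber_product[OF FE TE UE n F(2) eg ext_over_zero_trivial[OF UE n T O(3)] pb] by blast
    have HA: "H \<in> extensions C n M A" using H(1) f by (simp add: Hom_def)
    have "\<xi> = ext_rel C n M B `` {F}" using E(2) F(1) ext_class_eq_iff[OF E(1) FE] by simp
    then have "\<xi> = Ext_map C n M f (ext_rel C n M A `` {H})" using Ext_map_eqI[OF HA n FE H(2)] by simp
    then show "\<xi> \<in> Ext_map C n M f ` carrier (Ext C n M A)" using Ext_carrierI[OF HA] by blast
  qed
qed

end

theorem theorem2p1: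
  fixes C :: "('o, 'a) category_data" and n :: nat
  assumes "abelian_category C" and "n \<ge> 1"
  shows "(\<forall>M\<in>Ob C. Ext_right_exact C n M) \<longleftrightarrow>
    (\<forall>A\<in>Ob C. \<forall>M\<in>Ob C. carrier (Ext C (n + 1) M A) = {\<one>\<^bsub>Ext C (n + 1) M A\<^esub>})"
proof -
  interpret abelian_category C by (rule assms(1))
  show ?thesis
    using Ext_vanishes_if_right_exact[OF _ assms(2)] right_exact_if_Ext_vanishes[OF _ assms(2)]
    by (simp add: Suc_eq_plus1[symmetric] del: Suc_eq_plus1) blast
qed

end
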